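(* There is a constant $C>0$, independent of $h$ and of how $\partial\Omega$ intersects the mesh, such that $$\|\nabla^m E_hv\|_{L^2(\Omega_h)}\le C\,\|\nabla^m v\|_{L^2(\Omega)},\qquad 0\le m\le k,\quad v\in V_{h,p,k}.$$
   Context: Spline spaces. $\widetilde{\mathcal{T}}_h$ is a uniform tensor product mesh on $\mathbb{R}^d$ with mesh parameter $h\in(0,h_0]$. $\mathbb{Q}_p(T)$ is the space of tensor products of one-dimensional polynomials of degree $p$ on $T$. For $0\le k\le p-1$, $\widetilde V_{h,p,k}\subset C^k(\mathbb{R}^d)$ is the spline space of $C^k$ functions that are in $\mathbb{Q}_p(T)$ on each $T\in\widetilde{\mathcal{T}}_h$ (polynomials are represented exactly). $\widetilde{\mathcal{B}}=\{\varphi_i\}_{i\in\widetilde I}$ is a basis of $\widetilde V_{h,p,k}$ satisfying: (A1) local support: the number of elements contained in $\operatorname{supp}\varphi_i$ is uniformly bounded, and $\operatorname{diam}(\operatorname{supp}\varphi_i)\lesssim h$; (A2) for each element $T$ the restrictions to $T$ of the basis functions $\varphi_i$ with $T\subset\operatorname{supp}\varphi_i$ form a basis of $\mathbb{Q}_p(T)$, and this basis is stable: if $v=\sum_i \widehat v_{T,i}\varphi_i|_T\in\mathbb{Q}_p(T)$ then $h^d\sum_i|\widehat v_{T,i}|^2\sim\|v\|_{L^2(T)}^2$. Active objects. $\Omega\subset\mathbb{R}^d$ is a domain with Lipschitz boundary $\partial\Omega$. $\mathcal{T}_h=\{T\in\widetilde{\mathcal{T}}_h: T\cap\Omega\ne\emptyset\}$,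 $\Omega_h=\bigcup_{T\in\mathcal{T}_h}T$. $I$ is the set of indices $i$ such that $\operatorname{supp}\varphi_i$ contains some $T\in\mathcal{T}_h$; $\mathcal{B}=\{\varphi_i\}_{i\in I}$; $V_{h,p,k}=\operatorname{span}\mathcal{B}$. $V_{h,p,-1}$ is the space of discontinuous functions on $\Omega_h$ that are in $\mathbb{Q}_p(T)$ on each $T\in\mathcal{T}_h$. For $T\in\mathcal{T}_h$, $I_T=\{i\in I: T\subset\operatorname{supp}\varphi_i\}$, and for $i\in I$, $\mathcal{T}_{h,i}=\{T\in\mathcal{T}_h:T\subset\operatorname{supp}\varphi_i\}$. Interpolation operator. For $T\in\mathcal{T}_h$ let $P_{T,p}:L^2(T)\to\mathbb{Q}_p(T)$ be the $L^2(T)$ projection, and for $v\in L^2(\Omega_h)$ write $P_{T,p}(v|_T)=\sum_{i\in I_T}\widehat v_{T,i}\varphi_i|_T$. Then $\pi_h v=\sum_{i\in I}\big(\sum_{T\in\mathcal{T}_{h,i}}\kappa_{T,i}\widehat v_{T,i}\big)\varphi_i$, with arbitrary weights $0\le\kappa_{T,i}\le1$, $\sum_{T\in\mathcal{T}_{h,i}}\kappa_{T,i}=1$. Extension operator. Let $\gamma\ge0$ be a fixed parameter. The large elements are $\mathcal{T}_h^L=\{T\in\mathcal{T}_h:\gamma h^d\le|T\cap\Omega|\}$ and the small elements are $\mathcal{T}_h^S=\mathcal{T}_h\setminus\mathcal{T}_h^L$. $S_h:\mathcal{T}_h^S\to\mathcal{T}_h^L$ is a mapping with $\operatorname{diam}(S_h(T)\cup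 T)\lesssim h$ (such a mapping exists for domains with Lipschitz boundary when the mesh is sufficiently fine). The operator $B_h$, with values in $V_{h,p,-1}$, is defined by $(B_hv)|_T=v|_T$ for $T\in\mathcal{T}_h^L$ and $(B_hv)|_T=(v|_{S_h(T)})^e|_T$ for $T\in\mathcal{T}_h^S$, where $q^e$ is the canonical extension of a polynomial $q$ on an element to a polynomial on $\mathbb{R}^d$. Finally $E_hv=\pi_hB_hv\in V_{h,p,k}$. ($B_h$ and $E_h$ are introduced on the span $V^L_{h,p,k}$ of the active basis functions having a large element in their support, but $B_hv$ and $E_hv$ depend only on $v$ on the large elements, so the same formulas apply to all $v\in V_{h,p,k}$.) Convention: $a\lesssim b$ means $a\le Cb$, and $a\sim b$ means $a\lesssim b\lesssim a$, with constants independent of $h$ and of the intersection of the mesh and the domain boundary, but possibly depending on $p$ and $k$; the same holds for the constant in the claim.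
   Formalization: The parameter γ is taken positive: for γ = 0 one has E_h v = v and the bound fails for v meeting Ω only in a thin sliver. For unbounded Ω (uniformly Lipschitz boundary) the mesh must be sufficiently fine, since S_h could otherwise link distant parts of Ω. *)

theory Defs
  imports "HOL-Analysis.Analysis"
begin

section \<open>Functions, norms and domains\<close>

definition supp :: "(real^'n \<Rightarrow> real) \<Rightarrow> (real^'n) set" where
  "supp f = closure {x. f x \<noteq> 0}"

definition partial :: "'n \<Rightarrow> (real^'n \<Rightarrow> real) \<Rightarrow> real^'n \<Rightarrow> real" where
  "partial i f x = frechet_derivative f (at x) (axis i 1)"

fun Ck :: "nat \<Rightarrow> (real^'n \<Rightarrow> real) \<Rightarrow> bool" where
  "Ck 0 f \<longleftrightarrow> continuous_on UNIV f"
| "Ck (Suc k) f \<longleftrightarrow> (\<forall>x. f differentiable (at x)) \<and> (\<forall>i. Ck k (partial i f))"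

definition L2norm :: "(real^'n) set \<Rightarrow> (real^'n \<Rightarrow> real) \<Rightarrow> real" where
  "L2norm S f = sqrt (LINT x:S|lborel. (f x)\<^sup>2)"

text \<open>The pointwise Euclidean norm of the tensor of all \<open>m\<close>-th order partial derivatives; lists of
  length \<open>m\<close> are the multi-indices in \<open>{1..d}\<^sup>m\<close>. Derivatives are classical: below, the
  functions are of class \<open>C\<^sup>k\<close> on the whole space, \<open>m \<le> k\<close>.\<close>

definition grad_norm :: "nat \<Rightarrow> (real^'n \<Rightarrow> real) \<Rightarrow> real^'n \<Rightarrow> real" where
  "grad_norm m f x = L2_set (\<lambda>is. foldr partial is f x) {is :: 'n list. length is = m}"

text \<open>Around each boundary point the domain is, in suitable orthonormal coordinates with vertical
  direction \<open>n\<close>, the part above the graph of a Lipschitz function; \<open>g\<close> is evaluated only at points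
  of the hyperplane orthogonal to \<open>n\<close>. The radius and the Lipschitz constant do not depend on the
  point. For bounded domains this is automatic by compactness of the boundary.\<close>

definition lipschitz_boundary :: "(real^'n) set \<Rightarrow> bool" where
  "lipschitz_boundary \<Omega> \<longleftrightarrow> (\<exists>r>0. \<exists>L. \<forall>z\<in>frontier \<Omega>. \<exists>n g. norm n = 1 \<and> L-lipschitz_on UNIV g \<and>
     (\<forall>x\<in>ball z r. x \<in> \<Omega> \<longleftrightarrow> g (x - (x \<bullet> n) *\<^sub>R n) < x \<bullet> n))"

section \<open>Mesh and spline spaces\<close>

text \<open>The uniform mesh of cubes with side \<open>h\<close> having \<open>x0\<close> as one of its vertices.\<close>

definition mesh :: "real \<Rightarrow> real^'n \<Rightarrow> (real^'n) set set" where
  "mesh h x0 = range (\<lambda>j :: 'n \<Rightarrow> int.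
     cbox (\<chi> i. x0 $ i + h * of_int (j i)) (\<chi> i. x0 $ i + h * (of_int (j i) + 1)))"

definition Qpoly :: "nat \<Rightarrow> (real^'n \<Rightarrow> real) set" where
  "Qpoly p = {q. \<exists>c. q = (\<lambda>x. \<Sum>\<alpha> | \<forall>i. \<alpha> i \<le> p. c \<alpha> * (\<Prod>i\<in>UNIV. (x $ i) ^ \<alpha> i))}"

definition Qpoly_on :: "nat \<Rightarrow> (real^'n) set \<Rightarrow> (real^'n \<Rightarrow> real) set" where
  "Qpoly_on p T = {v. \<exists>q\<in>Qpoly p. \<forall>x\<in>T. v x = q x}"

definition spline_space :: "nat \<Rightarrow> nat \<Rightarrow> real \<Rightarrow> real^'n \<Rightarrow> (real^'n \<Rightarrow> real) set" where
  "spline_space p k h x0 = {v. Ck k v \<and> (\<forall>T\<in>mesh h x0. v \<in> Qpoly_on p T)}"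

text \<open>Sums that are finite at each point, as is needed for the infinitely many basis functions on
  the whole space. For finite \<open>J\<close> this is the ordinary linear combination.\<close>

definition lincomb :: "'i set \<Rightarrow> ('i \<Rightarrow> real^'n \<Rightarrow> real) \<Rightarrow> ('i \<Rightarrow> real) \<Rightarrow> real^'n \<Rightarrow> real" where
  "lincomb J \<phi> c x = (\<Sum>i | i \<in> J \<and> \<phi> i x \<noteq> 0. c i * \<phi> i x)"

text \<open>The family of restrictions of \<open>\<phi> i\<close> (\<open>i \<in> J\<close>) to \<open>D\<close> is a basis of the space of
  restrictions of \<open>W\<close> to \<open>D\<close>, with respect to pointwise finite linear combinations: every element of
  the infinite-dimensional spline space on the whole space is an infinite, locally finite sum.\<close>

definition basis_on ::
  "(real^'n) set \<Rightarrow> (real^'n \<Rightarrow> real) set \<Rightarrow> 'i set \<Rightarrow> ('i \<Rightarrow> real^'n \<Rightarrow> real) \<Rightarrow> bool" where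
  "basis_on D W J \<phi> \<longleftrightarrow>
     (\<forall>i\<in>J. \<phi> i \<in> W) \<and>
     (\<forall>x\<in>D. finite {i \<in> J. \<phi> i x \<noteq> 0}) \<and>
     (\<forall>v\<in>W. \<exists>c. \<forall>x\<in>D. v x = lincomb J \<phi> c x) \<and>
     (\<forall>c. (\<forall>x\<in>D. lincomb J \<phi> c x = 0) \<longrightarrow> (\<forall>i\<in>J. c i = 0))"

text \<open>\<open>N\<close> and \<open>A\<close> are the constants of the local support property, \<open>A'\<close> is the constant of the
  local stability of the basis on each element.\<close>

definition spline_basis ::
  "nat \<Rightarrow> real \<Rightarrow> real \<Rightarrow> nat \<Rightarrow> nat \<Rightarrow> real \<Rightarrow> real^'n \<Rightarrow> 'i set \<Rightarrow> ('i \<Rightarrow> real^'n \<Rightarrow> real) \<Rightarrow> bool" where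
  "spline_basis N A A' p k h x0 J \<phi> \<longleftrightarrow>
     basis_on UNIV (spline_space p k h x0) J \<phi> \<and>
     (\<forall>i\<in>J. finite {T \<in> mesh h x0. T \<subseteq> supp (\<phi> i)} \<and> card {T \<in> mesh h x0. T \<subseteq> supp (\<phi> i)} \<le> N \<and>
        bounded (supp (\<phi> i)) \<and> diameter (supp (\<phi> i)) \<le> A * h) \<and>
     (\<forall>T\<in>mesh h x0. let J\<^sub>T = {i \<in> J. T \<subseteq> supp (\<phi> i)} in
        finite J\<^sub>T \<and> basis_on T (Qpoly_on p T) J\<^sub>T \<phi> \<and>
        (\<forall>c. h ^ CARD('n) * (\<Sum>i\<in>J\<^sub>T. (c i)\<^sup>2) \<le> A' * (L2norm T (lincomb J\<^sub>T \<phi> c))\<^sup>2 \<and>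
             (L2norm T (lincomb J\<^sub>T \<phi> c))\<^sup>2 \<le> A' * (h ^ CARD('n) * (\<Sum>i\<in>J\<^sub>T. (c i)\<^sup>2))))"

section \<open>Active elements and basis functions\<close>

definition active_mesh :: "real \<Rightarrow> real^'n \<Rightarrow> (real^'n) set \<Rightarrow> (real^'n) set set" where
  "active_mesh h x0 \<Omega> = {T \<in> mesh h x0. T \<inter> \<Omega> \<noteq> {}}"

definition active_domain :: "real \<Rightarrow> real^'n \<Rightarrow> (real^'n) set \<Rightarrow> (real^'n) set" where
  "active_domain h x0 \<Omega> = \<Union> (active_mesh h x0 \<Omega>)"

definition active_idx ::
  "real \<Rightarrow> real^'n \<Rightarrow> (real^'n) set \<Rightarrow> 'i set \<Rightarrow> ('i \<Rightarrow> real^'n \<Rightarrow> real) \<Rightarrow> 'i set" where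
  "active_idx h x0 \<Omega> J \<phi> = {i \<in> J. \<exists>T\<in>active_mesh h x0 \<Omega>. T \<subseteq> supp (\<phi> i)}"

definition active_span ::
  "real \<Rightarrow> real^'n \<Rightarrow> (real^'n) set \<Rightarrow> 'i set \<Rightarrow> ('i \<Rightarrow> real^'n \<Rightarrow> real) \<Rightarrow> (real^'n \<Rightarrow> real) set" where
  "active_span h x0 \<Omega> J \<phi> =
     {v. \<exists>F c. finite F \<and> F \<subseteq> active_idx h x0 \<Omega> J \<phi> \<and> v = (\<lambda>x. \<Sum>i\<in>F. c i * \<phi> i x)}"

section \<open>Interpolation operator\<close>

text \<open>In the next two definitions \<open>I\<close> stands for the set of active indices, \<open>\<T>\<close> for the active mesh.\<close>

definition L2proj :: "nat \<Rightarrow> (real^'n) set \<Rightarrow> (real^'n \<Rightarrow> real) \<Rightarrow> real^'n \<Rightarrow> real" where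
  "L2proj p T v = (THE q. q \<in> Qpoly p \<and> (\<forall>r\<in>Qpoly p. (LINT x:T|lborel. (v x - q x) * r x) = 0))"

definition local_coeff ::
  "nat \<Rightarrow> 'i set \<Rightarrow> ('i \<Rightarrow> real^'n \<Rightarrow> real) \<Rightarrow> (real^'n) set \<Rightarrow> (real^'n \<Rightarrow> real) \<Rightarrow> 'i \<Rightarrow> real" where
  "local_coeff p I \<phi> T v = (let I\<^sub>T = {i \<in> I. T \<subseteq> supp (\<phi> i)} in
     THE c. (\<forall>i. i \<notin> I\<^sub>T \<longrightarrow> c i = 0) \<and> (\<forall>x\<in>T. L2proj p T v x = (\<Sum>i\<in>I\<^sub>T. c i * \<phi> i x)))"

definition interp ::
  "nat \<Rightarrow> (real^'n) set set \<Rightarrow> 'i set \<Rightarrow> ('i \<Rightarrow> real^'n \<Rightarrow> real) \<Rightarrow> ((real^'n) set \<Rightarrow> 'i \<Rightarrow> real) \<Rightarrow>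
     (real^'n \<Rightarrow> real) \<Rightarrow> real^'n \<Rightarrow> real" where
  "interp p \<T> I \<phi> \<kappa> v =
     lincomb I \<phi> (\<lambda>i. \<Sum>T | T \<in> \<T> \<and> T \<subseteq> supp (\<phi> i). \<kappa> T i * local_coeff p I \<phi> T v i)"

definition weights ::
  "(real^'n) set set \<Rightarrow> 'i set \<Rightarrow> ('i \<Rightarrow> real^'n \<Rightarrow> real) \<Rightarrow> ((real^'n) set \<Rightarrow> 'i \<Rightarrow> real) \<Rightarrow> bool" where
  "weights \<T> I \<phi> \<kappa> \<longleftrightarrow> (\<forall>i\<in>I. let \<T>\<^sub>i = {T \<in> \<T>. T \<subseteq> supp (\<phi> i)} in
     (\<forall>T\<in>\<T>\<^sub>i. 0 \<le> \<kappa> T i \<and> \<kappa> T i \<le> 1) \<and> (\<Sum>T\<in>\<T>\<^sub>i. \<kappa> T i) = 1)"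

section \<open>Extension operator\<close>

definition large_elems :: "real \<Rightarrow> real \<Rightarrow> real^'n \<Rightarrow> (real^'n) set \<Rightarrow> (real^'n) set set" where
  "large_elems \<gamma> h x0 \<Omega> = {T \<in> active_mesh h x0 \<Omega>. \<gamma> * h ^ CARD('n) \<le> measure lborel (T \<inter> \<Omega>)}"

definition small_elems :: "real \<Rightarrow> real \<Rightarrow> real^'n \<Rightarrow> (real^'n) set \<Rightarrow> (real^'n) set set" where
  "small_elems \<gamma> h x0 \<Omega> = active_mesh h x0 \<Omega> - large_elems \<gamma> h x0 \<Omega>"

definition elem_map ::
  "real \<Rightarrow> real \<Rightarrow> real \<Rightarrow> real^'n \<Rightarrow> (real^'n) set \<Rightarrow> ((real^'n) set \<Rightarrow> (real^'n) set) \<Rightarrow> bool" where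
  "elem_map A \<gamma> h x0 \<Omega> S \<longleftrightarrow> (\<forall>T\<in>small_elems \<gamma> h x0 \<Omega>.
     S T \<in> large_elems \<gamma> h x0 \<Omega> \<and> diameter (S T \<union> T) \<le> A * h)"

definition poly_ext :: "nat \<Rightarrow> (real^'n) set \<Rightarrow> (real^'n \<Rightarrow> real) \<Rightarrow> real^'n \<Rightarrow> real" where
  "poly_ext p T v = (THE q. q \<in> Qpoly p \<and> (\<forall>x\<in>T. v x = q x))"

text \<open>Functions in the discontinuous space are \<open>L\<^sup>2\<close> functions; their values on the faces of the
  elements, a null set where the one-sided values differ, are set to \<open>0\<close> (as outside the active
  domain).\<close>

definition Bh ::
  "nat \<Rightarrow> real \<Rightarrow> real \<Rightarrow> real^'n \<Rightarrow> (real^'n) set \<Rightarrow> ((real^'n) set \<Rightarrow> (real^'n) set) \<Rightarrow>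
     (real^'n \<Rightarrow> real) \<Rightarrow> real^'n \<Rightarrow> real" where
  "Bh p \<gamma> h x0 \<Omega> S v x =
     (if \<exists>T\<in>active_mesh h x0 \<Omega>. x \<in> interior T
      then let T = (THE T. T \<in> active_mesh h x0 \<Omega> \<and> x \<in> interior T)
           in if T \<in> large_elems \<gamma> h x0 \<Omega> then v x else poly_ext p (S T) v x
      else 0)"

definition Eh ::
  "nat \<Rightarrow> real \<Rightarrow> real \<Rightarrow> real^'n \<Rightarrow> (real^'n) set \<Rightarrow> 'i set \<Rightarrow> ('i \<Rightarrow> real^'n \<Rightarrow> real) \<Rightarrow>
     ((real^'n) set \<Rightarrow> 'i \<Rightarrow> real) \<Rightarrow> ((real^'n) set \<Rightarrow> (real^'n) set) \<Rightarrow>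
     (real^'n \<Rightarrow> real) \<Rightarrow> real^'n \<Rightarrow> real" where
  "Eh p \<gamma> h x0 \<Omega> J \<phi> \<kappa> S v =
     interp p (active_mesh h x0 \<Omega>) (active_idx h x0 \<Omega> J \<phi>) \<phi> \<kappa> (Bh p \<gamma> h x0 \<Omega> S v)"

end

theory Submission
  imports Defs
begin

text \<open>Let \<open>T\<close> be an active element and \<open>t\<close> the Taylor polynomial of degree less than \<open>m\<close> of \<open>v\<close> at a
  point of the large element that represents \<open>T\<close>. Both \<open>B\<^sub>h\<close> and \<open>\<pi>\<^sub>h\<close> reproduce \<open>t\<close>, so by the inverse
  inequality and the stability of the basis it is enough to bound \<open>v - t\<close> by \<open>h\<^sup>m |\<nabla>\<^sup>m v|\<close> on all large
  elements near \<open>T\<close>. These elements contain balls of radius \<open>c h\<close> inside \<open>\<Omega>\<close>, and any two such balls at a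
  distance comparable to \<open>h\<close> are joined by a bounded number of segments of length comparable to \<open>h\<close> that
  stay at a distance of at least \<open>c' h\<close> from the complement of \<open>\<Omega>\<close>: near the boundary one goes up in
  the direction of the graph, across, and down again. At points of the segments \<open>|\<nabla>\<^sup>m v|\<close> is bounded by its
  \<open>L\<^sup>2\<close> norm on a small cube inside \<open>\<Omega>\<close>, because \<open>v\<close> is piecewise polynomial, and integrating \<open>\<nabla>\<^sup>m v\<close>
  \<open>m\<close> times along the segments gives the bound. Mesh sizes that are not small occur only for bounded
  \<open>\<Omega>\<close>, where connectedness and compactness replace the graph argument.\<close>

section \<open>Partial derivatives\<close>

text \<open>What shapes the proof is that \<open>\<Omega>\<close> may cut the elements near
  \<open>T\<close> arbitrarily: its part in such a patch can be thin, far from star-shaped, even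
  disconnected, so that a Poincare inequality on the patch itself has no constant independent of the
  cut. The quantitative data are the volume share \<open>\<gamma>\<close> of the large elements and
  the Lipschitz charts. The volume yields the balls: on fine meshes, a large element without a point
  of depth \<open>c h\<close> would meet \<open>\<Omega>\<close> in a slab above the graph too thin
  for its volume. Neighbouring elements carry different polynomials, so smallness of
  \<open>v - t\<close> cannot pass from one to the next by polynomial inequalities alone; it passes
  through the continuity of the derivatives across faces, which is where \<open>m \<le> k\<close>
  enters. The segments may cross faces or cut corners of elements anywhere. They therefore keep away
  from the complement of \<open>\<Omega>\<close>: around each of their points there is room for a
  cube, of side comparable to \<open>h\<close>, inside \<open>\<Omega>\<close> and inside a single
  element, however short the stretch of segment in that element is.\<close>

abbreviation derivs :: "'n list \<Rightarrow> (real^'n \<Rightarrow> real) \<Rightarrow> real^'n \<Rightarrow> real" where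
  "derivs is f \<equiv> foldr partial is f"

lemma partial_eq: "(f has_derivative f') (at x) \<Longrightarrow> partial i f x = f' (axis i 1)"
  unfolding partial_def by (simp add: frechet_derivative_at[symmetric])

lemma differentiableD:
  fixes f :: "real^'n \<Rightarrow> real"
  assumes "f differentiable (at x)"
  shows "(f has_derivative (\<lambda>h. \<Sum>i\<in>UNIV. h $ i * partial i f x)) (at x)"
proof -
  have d: "(f has_derivative frechet_derivative f (at x)) (at x)"
    using assms frechet_derivative_works by blast
  have "frechet_derivative f (at x) = (\<lambda>h. \<Sum>i\<in>UNIV. h $ i * partial i f x)"
  proof
    fix h :: "real^'n"
    have lin: "linear (frechet_derivative f (at x))"
      using d has_derivative_linear by blast
    have "frechet_derivative f (at x) h = frechet_derivative f (at x) (\<Sum>i\<in>UNIV. h $ i *\<^sub>R axis i 1)"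
      by (simp flip: scalar_mult_eq_scaleR add: basis_expansion)
    also have "\<dots> = (\<Sum>i\<in>UNIV. h $ i * partial i f x)"
      by (simp add: linear_sum[OF lin] linear_scale[OF lin] partial_def)
    finally show "frechet_derivative f (at x) h = \<dots>" .
  qed
  with d show ?thesis by simp
qed

text \<open>\<open>frechet_derivative\<close> is defined by choice, so equal sets of candidates for
  the derivative give equal values, also at points of non-differentiability.\<close>

lemma partial_cong_open:
  assumes "open U" "\<And>x. x \<in> U \<Longrightarrow> f x = g x" "x \<in> U"
  shows "partial i f x = partial i g x"
proof -
  have "(f has_derivative f') (at x) \<longleftrightarrow> (g has_derivative f') (at x)" for f'
    using has_derivative_transform_within_open[OF _ assms(1,3)] assms(2) by metis
  then show ?thesis unfolding partial_def frechet_derivative_def by simp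
qed

lemma derivs_cong_open:
  assumes "open U" "\<And>x. x \<in> U \<Longrightarrow> f x = g x" "x \<in> U"
  shows "derivs is f x = derivs is g x"
  using assms(3)
proof (induction "is" arbitrary: x)
  case Nil
  then show ?case using assms(2) by simp
next
  case (Cons i js)
  then show ?case using partial_cong_open[OF assms(1), where f = "derivs js f" and g = "derivs js g"] by fastforce
qed

lemma partial_zero [simp]: "partial i (\<lambda>x. 0) = (\<lambda>x. 0)"
  by (rule ext, subst partial_eq[where f' = "\<lambda>x. 0"]) auto

lemma derivs_zero [simp]: "derivs is (\<lambda>x. 0) = (\<lambda>x. 0)"
  by (induction "is") auto

lemma partial_add:
  fixes f g :: "real^'n \<Rightarrow> real"
  assumes "f differentiable (at x)" "g differentiable (at x)"
  shows "partial i (\<lambda>x. f x + g x) x = partial i f x + partial i g x"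
proof -
  have "((\<lambda>x. f x + g x) has_derivative
      (\<lambda>h. frechet_derivative f (at x) h + frechet_derivative g (at x) h)) (at x)"
    using assms frechet_derivative_works by (intro has_derivative_add) blast+
  from partial_eq[OF this] show ?thesis by (simp add: partial_def)
qed

lemma partial_cmult:
  fixes f :: "real^'n \<Rightarrow> real"
  assumes "f differentiable (at x)"
  shows "partial i (\<lambda>x. c * f x) x = c * partial i f x"
proof -
  have "((\<lambda>x. c * f x) has_derivative (\<lambda>h. c * frechet_derivative f (at x) h)) (at x)"
    using assms frechet_derivative_works by (intro has_derivative_mult_right) blast
  from partial_eq[OF this] show ?thesis by (simp add: partial_def)
qed

lemma Ck_SucD: "Ck (Suc k) f \<Longrightarrow> Ck k f"
proof (induction k arbitrary: f)
  case 0
  then show ?case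
    by (auto intro!: continuous_at_imp_continuous_on differentiable_imp_continuous_within)
qed auto

lemma Ck_mono: "Ck k f \<Longrightarrow> m \<le> k \<Longrightarrow> Ck m f"
proof (induction k)
  case (Suc k)
  then show ?case using Ck_SucD[of k f] by (cases "m = Suc k") auto
qed simp

lemma Ck_derivs: "Ck k f \<Longrightarrow> length is \<le> k \<Longrightarrow> Ck (k - length is) (derivs is f)"
proof (induction "is" arbitrary: k)
  case (Cons i js)
  then have "Ck (k - length js) (derivs js f)" by auto
  moreover have "k - length js = Suc (k - length (i # js))" using Cons by auto
  ultimately show ?case by auto
qed auto

lemma Ck_derivs_continuous: "Ck k f \<Longrightarrow> length is \<le> k \<Longrightarrow> continuous_on UNIV (derivs is f)"
  using Ck_mono[OF Ck_derivs, of k f "is" 0] by auto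

lemma Ck_derivs_differentiable:
  assumes "Ck k f" "length is < k"
  shows "derivs is f differentiable (at x)"
proof -
  have "Ck (Suc 0) (derivs is f)" using Ck_mono[OF Ck_derivs[OF assms(1)], of "is" "Suc 0"] assms(2) by auto
  then show ?thesis by auto
qed

lemma Ck_add: "Ck k f \<Longrightarrow> Ck k g \<Longrightarrow> Ck k (\<lambda>x. f x + g x)"
proof (induction k arbitrary: f g)
  case 0 then show ?case by (auto intro: continuous_intros)
next
  case (Suc k)
  then have "partial i (\<lambda>x. f x + g x) = (\<lambda>x. partial i f x + partial i g x)" for i
    by (auto simp: partial_add)
  with Suc show ?case by auto
qed

lemma Ck_cmult: "Ck k f \<Longrightarrow> Ck k (\<lambda>x. c * f x)"
proof (induction k arbitrary: f)
  case 0 then show ?case by (auto intro: continuous_intros)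
next
  case (Suc k)
  then have "partial i (\<lambda>x. c * f x) = (\<lambda>x. c * partial i f x)" for i
    by (auto simp: partial_cmult)
  with Suc show ?case by (auto intro: differentiable_mult)
qed

lemma Ck_zero: "Ck k (\<lambda>x. 0)"
  by (induction k) auto

lemma Ck_sum: "(\<And>i. i \<in> F \<Longrightarrow> Ck k (f i)) \<Longrightarrow> Ck k (\<lambda>x. \<Sum>i\<in>F. f i x)"
proof (induction F rule: infinite_finite_induct)
  case (insert i F)
  then show ?case using Ck_add[of k "f i" "\<lambda>x. \<Sum>i\<in>F. f i x"] by simp
qed (auto simp: Ck_zero)

lemma derivs_add:
  assumes "Ck k f" "Ck k g" "length is \<le> k"
  shows "derivs is (\<lambda>x. f x + g x) = (\<lambda>x. derivs is f x + derivs is g x)"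
  using assms
proof (induction "is")
  case (Cons i js)
  then show ?case
    by (auto simp: partial_add Ck_derivs_differentiable Suc_le_eq)
qed auto

lemma derivs_cmult:
  assumes "Ck k f" "length is \<le> k"
  shows "derivs is (\<lambda>x. c * f x) = (\<lambda>x. c * derivs is f x)"
  using assms
proof (induction "is")
  case (Cons i js)
  then show ?case
    by (auto simp: partial_cmult Ck_derivs_differentiable Suc_le_eq)
qed auto

lemma Ck_diff: "Ck k f \<Longrightarrow> Ck k g \<Longrightarrow> Ck k (\<lambda>x. f x - g x)"
  using Ck_add[of k f "\<lambda>x. -1 * g x"] Ck_cmult[of k g "-1"] by simp

lemma derivs_diff:
  assumes "Ck k f" "Ck k g" "length is \<le> k"
  shows "derivs is (\<lambda>x. f x - g x) = (\<lambda>x. derivs is f x - derivs is g x)"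
  using derivs_add[of k f "\<lambda>x. -1 * g x" "is"] derivs_cmult[of k g "is" "-1"] Ck_cmult[of k g "-1"] assms
  by simp

lemma derivs_sum:
  assumes "\<And>i. i \<in> F \<Longrightarrow> Ck k (f i)" "length is \<le> k"
  shows "derivs is (\<lambda>x. \<Sum>i\<in>F. f i x) = (\<lambda>x. \<Sum>i\<in>F. derivs is (f i) x)"
  using assms
proof (induction F rule: infinite_finite_induct)
  case (insert i F)
  then show ?case using derivs_add[of k "f i" "\<lambda>x. \<Sum>i\<in>F. f i x" "is"] Ck_sum[of F k f] by simp
qed auto

section \<open>Tensor product polynomials\<close>

text \<open>A partial derivative acts on a single factor by \<open>pderiv\<close>. Monomials,
  shifted monomials and tensor Lagrange polynomials all have this shape, so their derivatives reduce
  to one variable.\<close>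

definition tpoly :: "('n \<Rightarrow> real poly) \<Rightarrow> real^'n \<Rightarrow> real" where
  "tpoly f x = (\<Prod>i\<in>UNIV. poly (f i) (x $ i))"

lemma finite_multi: "finite {\<alpha> :: 'n::finite \<Rightarrow> nat. \<forall>i. \<alpha> i \<le> p}"
proof -
  have "{\<alpha> :: 'n \<Rightarrow> nat. \<forall>i. \<alpha> i \<le> p} = PiE UNIV (\<lambda>_. {..p})" by auto
  then show ?thesis by (simp add: finite_PiE)
qed

lemma tensor_expand:
  fixes F :: "'n::finite \<Rightarrow> nat \<Rightarrow> real"
  shows "(\<Prod>i\<in>UNIV. \<Sum>a\<le>p. F i a) = (\<Sum>\<alpha> | \<forall>i. \<alpha> i \<le> p. \<Prod>i\<in>UNIV. F i (\<alpha> i))"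
proof -
  have "{\<alpha> :: 'n \<Rightarrow> nat. \<forall>i. \<alpha> i \<le> p} = PiE UNIV (\<lambda>_. {..p})" by auto
  then show ?thesis by (simp add: prod_sum_PiE)
qed

lemma Qpoly_add: "f \<in> Qpoly p \<Longrightarrow> g \<in> Qpoly p \<Longrightarrow> (\<lambda>x. f x + g x) \<in> Qpoly p"
  unfolding Qpoly_def
proof clarsimp
  fix c d :: "('a \<Rightarrow> nat) \<Rightarrow> real"
  show "\<exists>e. (\<lambda>x::real^'a. (\<Sum>\<alpha> | \<forall>i. \<alpha> i \<le> p. c \<alpha> * (\<Prod>i\<in>UNIV. (x $ i) ^ \<alpha> i))
      + (\<Sum>\<alpha> | \<forall>i. \<alpha> i \<le> p. d \<alpha> * (\<Prod>i\<in>UNIV. (x $ i) ^ \<alpha> i))) =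
      (\<lambda>x. \<Sum>\<alpha> | \<forall>i. \<alpha> i \<le> p. e \<alpha> * (\<Prod>i\<in>UNIV. (x $ i) ^ \<alpha> i))"
    by (intro exI[of _ "\<lambda>\<alpha>. c \<alpha> + d \<alpha>"]) (simp add: sum.distrib distrib_right)
qed

lemma Qpoly_cmult: "f \<in> Qpoly p \<Longrightarrow> (\<lambda>x. a * f x) \<in> Qpoly p"
  unfolding Qpoly_def
proof clarsimp
  fix c :: "('a \<Rightarrow> nat) \<Rightarrow> real"
  show "\<exists>e. (\<lambda>x::real^'a. a * (\<Sum>\<alpha> | \<forall>i. \<alpha> i \<le> p. c \<alpha> * (\<Prod>i\<in>UNIV. (x $ i) ^ \<alpha> i))) =
      (\<lambda>x. \<Sum>\<alpha> | \<forall>i. \<alpha> i \<le> p. e \<alpha> * (\<Prod>i\<in>UNIV. (x $ i) ^ \<alpha> i))"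
    by (intro exI[of _ "\<lambda>\<alpha>. a * c \<alpha>"]) (simp add: sum_distrib_left mult.assoc)
qed

lemma Qpoly_zero: "(\<lambda>x. 0) \<in> Qpoly p"
  unfolding Qpoly_def by (auto intro!: exI[of _ "\<lambda>_. 0"])

lemma Qpoly_diff: "f \<in> Qpoly p \<Longrightarrow> g \<in> Qpoly p \<Longrightarrow> (\<lambda>x. f x - g x) \<in> Qpoly p"
  using Qpoly_add[of f p "\<lambda>x. -1 * g x"] Qpoly_cmult[of g p "-1"] by simp

lemma Qpoly_sum: "(\<And>i. i \<in> F \<Longrightarrow> f i \<in> Qpoly p) \<Longrightarrow> (\<lambda>x. \<Sum>i\<in>F. f i x) \<in> Qpoly p"
proof (induction F rule: infinite_finite_induct)
  case (insert i F)
  then show ?case using Qpoly_add[of "f i" p "\<lambda>x. \<Sum>i\<in>F. f i x"] by simp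
qed (auto simp: Qpoly_zero)

lemma tpoly_Qpoly:
  assumes "\<And>i. degree (f i) \<le> p"
  shows "tpoly f \<in> Qpoly p"
proof -
  have "poly (f i) t = (\<Sum>a\<le>p. coeff (f i) a * t ^ a)" for i t
  proof -
    have "(\<Sum>a\<le>p. coeff (f i) a * t ^ a) = (\<Sum>a\<le>degree (f i). coeff (f i) a * t ^ a)"
      using assms[of i] by (intro sum.mono_neutral_right) (auto simp: coeff_eq_0)
    then show ?thesis by (simp add: poly_altdef)
  qed
  then have "tpoly f = (\<lambda>x. \<Sum>\<alpha> | \<forall>i. \<alpha> i \<le> p. (\<Prod>i\<in>UNIV. coeff (f i) (\<alpha> i)) * (\<Prod>i\<in>UNIV. (x $ i) ^ \<alpha> i))"
    by (simp add: tpoly_def fun_eq_iff tensor_expand prod.distrib)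
  then show ?thesis unfolding Qpoly_def mem_Collect_eq
    by (intro exI[of _ "\<lambda>\<alpha>. \<Prod>i\<in>UNIV. coeff (f i) (\<alpha> i)"])
qed

text \<open>Monomials are tensor products and span \<open>Qpoly p\<close>; statements linear in the
  polynomial need only be checked on \<open>tpoly f\<close>.\<close>

lemma Qpoly_induct [consumes 1, case_names tensor zero add]:
  assumes q: "q \<in> Qpoly p"
    and tensor: "\<And>f. (\<And>i. degree (f i) \<le> p) \<Longrightarrow> P (tpoly f)"
    and zero: "P (\<lambda>x. 0)"
    and add: "\<And>a f g. f \<in> Qpoly p \<Longrightarrow> g \<in> Qpoly p \<Longrightarrow> P f \<Longrightarrow> P g \<Longrightarrow> P (\<lambda>x. a * f x + g x)"
  shows "P q"
proof -
  obtain c where c: "q = (\<lambda>x. \<Sum>\<alpha> | \<forall>i. \<alpha> i \<le> p. c \<alpha> * (\<Prod>i\<in>UNIV. (x $ i) ^ \<alpha> i))"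
    using q unfolding Qpoly_def by auto
  have "P (\<lambda>x. \<Sum>\<alpha>\<in>A. c \<alpha> * (\<Prod>i\<in>UNIV. (x $ i) ^ \<alpha> i)) \<and>
      (\<lambda>x. \<Sum>\<alpha>\<in>A. c \<alpha> * (\<Prod>i\<in>UNIV. (x $ i) ^ \<alpha> i)) \<in> Qpoly p"
    if "finite A" "A \<subseteq> {\<alpha>. \<forall>i. \<alpha> i \<le> p}" for A
    using that
  proof (induction A)
    case empty
    then show ?case using zero Qpoly_zero by simp
  next
    case (insert \<alpha> A)
    let ?f = "\<lambda>i. monom (1::real) (\<alpha> i)"
    have e: "tpoly ?f = (\<lambda>x. \<Prod>i\<in>UNIV. (x $ i) ^ \<alpha> i)"
      by (simp add: tpoly_def fun_eq_iff poly_monom)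
    have d: "degree (?f i) \<le> p" for i
      using insert.prems by (auto simp: degree_monom_eq)
    have "P (\<lambda>x. c \<alpha> * tpoly ?f x + (\<Sum>\<alpha>\<in>A. c \<alpha> * (\<Prod>i\<in>UNIV. (x $ i) ^ \<alpha> i)))"
      by (rule add) (use insert tensor[of ?f] d tpoly_Qpoly[of ?f] in auto)
    moreover have "(\<lambda>x. c \<alpha> * tpoly ?f x + (\<Sum>\<alpha>\<in>A. c \<alpha> * (\<Prod>i\<in>UNIV. (x $ i) ^ \<alpha> i))) \<in> Qpoly p"
      by (intro Qpoly_add Qpoly_cmult tpoly_Qpoly) (use insert d in auto)
    ultimately show ?case using insert by (simp add: e)
  qed
  from this[OF finite_multi] show ?thesis unfolding c by auto
qed

lemma tpoly_has_derivative:
  "(tpoly f has_derivative (\<lambda>h. \<Sum>j\<in>UNIV. h $ j * tpoly (f(j := pderiv (f j))) x)) (at x)"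
proof -
  have "((\<lambda>x. \<Prod>i\<in>UNIV. poly (f i) (x $ i)) has_derivative
     (\<lambda>h. \<Sum>i\<in>UNIV. (poly (pderiv (f i)) (x $ i) * (h $ i)) * (\<Prod>j\<in>UNIV-{i}. poly (f j) (x $ j)))) (at x)"
  proof (rule has_derivative_prod)
    fix i
    have "(poly (f i) has_derivative (*) (poly (pderiv (f i)) (x $ i))) (at (x $ i))"
      using poly_DERIV has_field_derivative_def by blast
    moreover have "((\<lambda>x. x $ i) has_derivative (\<lambda>h. h $ i)) (at x)"
      by (rule bounded_linear_imp_has_derivative[OF bounded_linear_vec_nth])
    ultimately show "((\<lambda>x. poly (f i) (x $ i)) has_derivative (\<lambda>h. poly (pderiv (f i)) (x $ i) * h $ i)) (at x)"
      using has_derivative_compose by blast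
  qed
  moreover have "tpoly (f(j := pderiv (f j))) x = poly (pderiv (f j)) (x $ j) * (\<Prod>i\<in>UNIV-{j}. poly (f i) (x $ i))" for j
    unfolding tpoly_def by (subst prod.remove[of _ j]) (auto intro!: prod.cong)
  ultimately show ?thesis unfolding tpoly_def[abs_def] by (simp add: mult_ac)
qed

lemma partial_tpoly: "partial j (tpoly f) = tpoly (f(j := pderiv (f j)))"
proof
  fix x
  have "partial j (tpoly f) x = (\<Sum>i\<in>UNIV. axis j 1 $ i * tpoly (f(i := pderiv (f i))) x)"
    by (rule partial_eq[OF tpoly_has_derivative])
  also have "\<dots> = (\<Sum>i\<in>UNIV. if i = j then tpoly (f(i := pderiv (f i))) x else 0)"
    by (intro sum.cong) (auto simp: axis_def)
  finally show "partial j (tpoly f) x = tpoly (f(j := pderiv (f j))) x" by simp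
qed

lemma derivs_tpoly: "derivs is (tpoly f) = tpoly (\<lambda>i. (pderiv ^^ count_list is i) (f i))"
proof (induction "is")
  case (Cons j js)
  then show ?case by (simp add: partial_tpoly) (rule arg_cong[where f = tpoly], auto)
qed simp

lemma Qpoly_partial_diff:
  assumes "q \<in> Qpoly p"
  shows "q differentiable (at x) \<and> partial i q \<in> Qpoly p"
proof -
  have "(\<forall>x. q differentiable (at x)) \<and> partial i q \<in> Qpoly p"
    using assms
  proof (induction rule: Qpoly_induct)
    case (tensor f)
    have "degree ((f(i := pderiv (f i))) j) \<le> p" for j
      using tensor[of j] by (auto simp: degree_pderiv)
    then show ?case using tpoly_has_derivative[of f]
      by (auto simp: partial_tpoly differentiable_def intro!: tpoly_Qpoly)
  next
    case zero
    then show ?case by (simp add: Qpoly_zero)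
  next
    case (add a f g)
    then have "partial i (\<lambda>x. a * f x + g x) = (\<lambda>x. a * partial i f x + partial i g x)"
      by (subst fun_eq_iff, subst partial_add) (auto simp: partial_cmult intro: differentiable_mult)
    with add show ?case
      by (auto intro!: Qpoly_add Qpoly_cmult differentiable_add differentiable_mult)
  qed
  then show ?thesis by blast
qed

lemma Qpoly_derivs: "q \<in> Qpoly p \<Longrightarrow> derivs is q \<in> Qpoly p"
  by (induction "is") (auto simp: Qpoly_partial_diff)

lemma Qpoly_Ck: "q \<in> Qpoly p \<Longrightarrow> Ck k q"
proof (induction k arbitrary: q)
  case 0
  then show ?case using Qpoly_partial_diff
    by (auto intro!: continuous_at_imp_continuous_on differentiable_imp_continuous_within)
qed (auto simp: Qpoly_partial_diff)

lemma Qpoly_continuous: "q \<in> Qpoly p \<Longrightarrow> continuous_on S q"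
  using Qpoly_Ck[of q p 0] continuous_on_subset by auto

lemma Qpoly_translate: "q \<in> Qpoly p \<Longrightarrow> (\<lambda>x. q (x + y)) \<in> Qpoly p"
proof (induction rule: Qpoly_induct)
  case (tensor f)
  have "(\<lambda>x. tpoly f (x + y)) = tpoly (\<lambda>i. pcompose (f i) [: y $ i, 1 :])"
    by (simp add: tpoly_def fun_eq_iff poly_pcompose add.commute)
  then show ?case using tensor by (auto intro!: tpoly_Qpoly simp: degree_pcompose)
qed (auto simp: Qpoly_zero intro!: Qpoly_add Qpoly_cmult)

section \<open>Taylor polynomials inside the tensor product space\<close>

lemma Qpoly_taylor_expansion:
  assumes "q \<in> Qpoly p"
  obtains c where "q = (\<lambda>x. \<Sum>\<alpha> | \<forall>i. \<alpha> i \<le> p. c \<alpha> * tpoly (\<lambda>i. [: - (y $ i), 1 :] ^ \<alpha> i) x)"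
proof -
  obtain c where "(\<lambda>x. q (x + y)) = (\<lambda>x. \<Sum>\<alpha> | \<forall>i. \<alpha> i \<le> p. c \<alpha> * (\<Prod>i\<in>UNIV. (x $ i) ^ \<alpha> i))"
    using Qpoly_translate[OF assms, of y] unfolding Qpoly_def by auto
  then have "q (x - y + y) = (\<Sum>\<alpha> | \<forall>i. \<alpha> i \<le> p. c \<alpha> * (\<Prod>i\<in>UNIV. ((x - y) $ i) ^ \<alpha> i))" for x
    by metis
  then have "q = (\<lambda>x. \<Sum>\<alpha> | \<forall>i. \<alpha> i \<le> p. c \<alpha> * tpoly (\<lambda>i. [: - (y $ i), 1 :] ^ \<alpha> i) x)"
    by (simp add: fun_eq_iff tpoly_def)
  then show ?thesis by (rule that)
qed

lemma pderiv_funpow_power_dvd: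
  "j \<le> a \<Longrightarrow> [: - y, 1 :] ^ (a - j) dvd (pderiv ^^ j) ([: - (y::real), 1 :] ^ a)"
proof (induction j)
  case (Suc j)
  then obtain r where r: "(pderiv ^^ j) ([: - y, 1 :] ^ a) = [: - y, 1 :] ^ (a - j) * r"
    by (auto simp: dvd_def)
  have "a - j = Suc (a - Suc j)" using Suc by simp
  with r have e: "(pderiv ^^ j) ([: - y, 1 :] ^ a) = [: - y, 1 :] ^ Suc (a - Suc j) * r" by metis
  have "[: - y, 1 :] ^ (a - Suc j) dvd pderiv ([: - y, 1 :] ^ Suc (a - Suc j) * r)"
    unfolding pderiv_mult pderiv_power_Suc
    by (intro dvd_add dvd_mult dvd_mult2 dvd_smult dvd_refl le_imp_power_dvd) simp
  then show ?case using e by simp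
qed simp

lemma pderiv_funpow_zero: "degree (f::real poly) < n \<Longrightarrow> (pderiv ^^ n) f = 0"
proof (induction n arbitrary: f)
  case (Suc n)
  show ?case
  proof (cases "degree f = 0")
    case True
    then have "pderiv f = 0" by (simp add: pderiv_eq_0_iff)
    moreover have "(pderiv ^^ n) (0::real poly) = 0" for n by (induction n) auto
    ultimately show ?thesis by (simp del: funpow.simps add: funpow_Suc_right)
  next
    case False
    then have "degree (pderiv f) < n" using Suc by (simp add: degree_pderiv)
    then show ?thesis using Suc.IH by (simp del: funpow.simps add: funpow_Suc_right)
  qed
qed simp

lemma sum_count_list_UNIV: "(\<Sum>i\<in>UNIV. count_list is (i::'n::finite)) = length is"
  using sum_count_set[of "is" UNIV] by simp

text \<open>Truncating the expansion in powers of \<open>x - y\<close> at total degree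
  \<open>m\<close> only deletes terms, so the Taylor polynomial stays in \<open>Qpoly p\<close>
  although that space is defined by degrees in each variable.\<close>

lemma Qpoly_taylor:
  fixes y :: "real^'n"
  assumes "q \<in> Qpoly p"
  obtains t where "t \<in> Qpoly p" "\<And>is. length is = m \<Longrightarrow> derivs is t = (\<lambda>x. 0)"
    "\<And>is. length is < m \<Longrightarrow> derivs is (\<lambda>x. q x - t x) y = 0"
proof -
  obtain c where c: "q = (\<lambda>x. \<Sum>\<alpha> | \<forall>i. \<alpha> i \<le> p. c \<alpha> * tpoly (\<lambda>i. [: - (y $ i), 1 :] ^ \<alpha> i) x)"
    using Qpoly_taylor_expansion[OF assms] by blast
  define X where "X \<alpha> = tpoly (\<lambda>i. [: - (y $ i), 1 :] ^ \<alpha> i)" for \<alpha> :: "'n \<Rightarrow> nat"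
  define A where "A = {\<alpha> :: 'n \<Rightarrow> nat. \<forall>i. \<alpha> i \<le> p}"
  define B where "B = {\<alpha>\<in>A. sum \<alpha> UNIV < m}"
  define t where "t x = (\<Sum>\<alpha>\<in>B. c \<alpha> * X \<alpha> x)" for x
  have XQ: "X \<alpha> \<in> Qpoly p" if "\<alpha> \<in> A" for \<alpha>
    using that unfolding X_def A_def
    by (intro tpoly_Qpoly) (auto simp: degree_power_eq)
  \<comment> \<open>With more derivatives than the total degree, some variable is differentiated
    more often than its exponent.\<close>
  have low: "derivs is (X \<alpha>) = (\<lambda>x. 0)" if "sum \<alpha> UNIV < length is" for "is" \<alpha>
  proof -
    obtain i where i: "\<alpha> i < count_list is i"
    proof (rule ccontr)
      assume "\<not> thesis"
      with that have "\<And>i. count_list is i \<le> \<alpha> i" by (meson leI that)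
      then have "(\<Sum>i\<in>UNIV. count_list is i) \<le> sum \<alpha> UNIV" by (intro sum_mono)
      then show False using \<open>sum \<alpha> UNIV < length is\<close> by (simp add: sum_count_list_UNIV)
    qed
    then have "(pderiv ^^ count_list is i) ([: - (y $ i), 1 :] ^ \<alpha> i) = 0"
      by (intro pderiv_funpow_zero) (simp add: degree_power_eq)
    then have "poly ((pderiv ^^ count_list is i) ([: - (y $ i), 1 :] ^ \<alpha> i)) (x $ i) = 0" for x :: "real^'n"
      by simp
    then show ?thesis unfolding X_def derivs_tpoly tpoly_def
      by (intro ext prod_zero bexI[of _ i]) auto
  qed
  \<comment> \<open>With fewer derivatives than the total degree, some variable keeps a factor that
    vanishes at \<open>y\<close>.\<close>
  have high: "derivs is (X \<alpha>) y = 0" if "length is < sum \<alpha> UNIV" for "is" \<alpha>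
  proof -
    obtain i where i: "count_list is i < \<alpha> i"
    proof (rule ccontr)
      assume "\<not> thesis"
      with that have "\<And>i. \<alpha> i \<le> count_list is i" by (meson leI that)
      then have "sum \<alpha> UNIV \<le> (\<Sum>i\<in>UNIV. count_list is i)" by (intro sum_mono)
      then show False using \<open>length is < sum \<alpha> UNIV\<close> by (simp add: sum_count_list_UNIV)
    qed
    then obtain r where "(pderiv ^^ count_list is i) ([: - (y $ i), 1 :] ^ \<alpha> i) =
        [: - (y $ i), 1 :] ^ (\<alpha> i - count_list is i) * r"
      using pderiv_funpow_power_dvd[of "count_list is i" "\<alpha> i" "y $ i"] by (auto simp: dvd_def)
    then have "poly ((pderiv ^^ count_list is i) ([: - (y $ i), 1 :] ^ \<alpha> i)) (y $ i) = 0"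
      using i by simp
    then show ?thesis unfolding X_def derivs_tpoly tpoly_def by (intro prod_zero bexI[of _ i]) auto
  qed
  have finA: "finite A" unfolding A_def by (rule finite_multi)
  have Dsum: "derivs is (\<lambda>x. \<Sum>\<alpha>\<in>E. c \<alpha> * X \<alpha> x) = (\<lambda>x. \<Sum>\<alpha>\<in>E. c \<alpha> * derivs is (X \<alpha>) x)" if "E \<subseteq> A" for E "is"
  proof -
    have "derivs is (\<lambda>x. \<Sum>\<alpha>\<in>E. c \<alpha> * X \<alpha> x) = (\<lambda>x. \<Sum>\<alpha>\<in>E. derivs is (\<lambda>x. c \<alpha> * X \<alpha> x) x)"
      by (rule derivs_sum[where k = "length is"]) (use that in \<open>auto intro: Ck_cmult[OF Qpoly_Ck[OF XQ]]\<close>)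
    also have "\<dots> = (\<lambda>x. \<Sum>\<alpha>\<in>E. c \<alpha> * derivs is (X \<alpha>) x)"
      using derivs_cmult[OF Qpoly_Ck[OF XQ] order_refl] that
      by (intro ext sum.cong) (auto simp: fun_eq_iff)
    finally show ?thesis .
  qed
  show ?thesis
  proof (rule that)
    show "t \<in> Qpoly p" unfolding t_def B_def by (intro Qpoly_sum Qpoly_cmult XQ) auto
  next
    fix "is" :: "'n list" assume "length is = m"
    then show "derivs is t = (\<lambda>x. 0)"
      unfolding t_def using Dsum[of B "is"] low by (auto simp: B_def fun_eq_iff intro!: sum.neutral)
  next
    fix "is" :: "'n list" assume l: "length is < m"
    have "q x - t x = (\<Sum>\<alpha>\<in>A-B. c \<alpha> * X \<alpha> x)" for x
      using finA unfolding c t_def X_def[symmetric] A_def[symmetric] by (subst sum_diff) (auto simp: B_def)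
    moreover have "derivs is (X \<alpha>) y = 0" if "\<alpha> \<in> A - B" for \<alpha>
      using that l by (intro high) (auto simp: B_def)
    ultimately show "derivs is (\<lambda>x. q x - t x) y = 0"
      using Dsum[of "A - B" "is"] by (auto intro!: sum.neutral)
  qed
qed

section \<open>Inverse estimates\<close>

definition cube :: "real^'n \<Rightarrow> real \<Rightarrow> (real^'n) set" where
  "cube a s = cbox a (\<chi> i. a $ i + s)"

lemma mem_cube: "x \<in> cube a s \<longleftrightarrow> (\<forall>i. a $ i \<le> x $ i \<and> x $ i \<le> a $ i + s)"
  by (simp add: cube_def mem_box_cart)

lemma compact_cube [simp]: "compact (cube a s)"
  by (simp add: cube_def)

lemma measure_cube: "s > 0 \<Longrightarrow> measure lborel (cube (a::real^'n) s) = s ^ CARD('n)"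
  unfolding cube_def by (subst content_cbox_cart) (auto simp: interval_eq_empty_cart not_less)

lemma cube_sets [measurable, simp]: "cube a s \<in> sets borel" by (simp add: cube_def)

lemma continuous_cube_integrable:
  fixes f :: "real^'n \<Rightarrow> real"
  assumes "continuous_on (cube a s) f"
  shows "set_integrable lborel (cube a s) f"
  unfolding set_integrable_def by (rule borel_integrable_compact) (use assms in auto)

lemma set_integral_sum:
  fixes f :: "'i \<Rightarrow> 'a \<Rightarrow> real"
  assumes "\<And>i. i \<in> I \<Longrightarrow> set_integrable M A (f i)"
  shows "set_integrable M A (\<lambda>x. \<Sum>i\<in>I. f i x)"
    and "(LINT x:A|M. (\<Sum>i\<in>I. f i x)) = (\<Sum>i\<in>I. LINT x:A|M. f i x)"
  using assms unfolding set_integrable_def set_lebesgue_integral_def scaleR_sum_right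
  by (auto intro: Bochner_Integration.integrable_sum Bochner_Integration.integral_sum)

text \<open>The nodes fill only the left half of the unit interval. A grid scaled by
  \<open>s\<close> can then be shifted by any vector of a cube of side \<open>s/2\<close> without
  leaving the cube of side \<open>s\<close>, which the averaging in
  \<open>inverse_estimate_L1\<close> exploits.\<close>

definition node :: "nat \<Rightarrow> nat \<Rightarrow> real" where
  "node p b = real b / (2 * (real p + 1))"

definition lagrange :: "nat \<Rightarrow> nat \<Rightarrow> real poly" where
  "lagrange p b = (\<Prod>c\<in>{..p} - {b}. smult (1 / (node p b - node p c)) [: - node p c, 1 :])"

lemma node_inj: "node p b = node p c \<longleftrightarrow> b = c"
  by (auto simp: node_def divide_simps)

lemma node_bounds: "b \<le> p \<Longrightarrow> 0 \<le> node p b \<and> node p b \<le> 1/2"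
  by (auto simp: node_def divide_simps)

lemma lagrange_node: "b \<le> p \<Longrightarrow> c \<le> p \<Longrightarrow> poly (lagrange p b) (node p c) = (if b = c then 1 else 0)"
  by (auto simp: lagrange_def poly_prod node_inj diff_divide_distrib[symmetric] intro!: prod.neutral)

lemma degree_lagrange: "b \<le> p \<Longrightarrow> degree (lagrange p b) \<le> p"
proof -
  assume b: "b \<le> p"
  have "degree (lagrange p b) \<le> (\<Sum>c\<in>{..p} - {b}. degree (smult (1 / (node p b - node p c)) [: - node p c, 1 :]))"
    unfolding lagrange_def by (rule order_trans[OF degree_prod_sum_le]) (auto simp: comp_def)
  also have "\<dots> \<le> (\<Sum>c\<in>{..p} - {b}. 1)" by (intro sum_mono) auto
  also have "\<dots> \<le> p" using b by simp
  finally show ?thesis .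
qed

lemma lagrange_interpolation:
  assumes "degree f \<le> p"
  shows "poly f x = (\<Sum>b\<le>p. poly f (node p b) * poly (lagrange p b) x)"
proof -
  let ?g = "\<Sum>b\<le>p. smult (poly f (node p b)) (lagrange p b)"
  have "f = ?g"
  proof (rule poly_eqI_degree[where A = "node p ` {..p}"])
    have c: "card (node p ` {..p}) = Suc p"
      by (subst card_image) (auto simp: inj_on_def node_inj)
    show "degree f < card (node p ` {..p})" using c assms by simp
    have "degree ?g \<le> p"
      by (intro degree_sum_le) (auto intro: order_trans[OF degree_smult_le] degree_lagrange)
    then show "degree ?g < card (node p ` {..p})" using c by simp
    fix x assume "x \<in> node p ` {..p}"
    then obtain c where c: "c \<le> p" "x = node p c" by auto
    then have "poly ?g x = (\<Sum>b\<le>p. if b = c then poly f (node p b) else 0)"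
      by (auto simp: poly_sum lagrange_node if_distrib[where f = "\<lambda>x. _ * x"] intro!: sum.cong cong: if_cong)
    then show "poly f x = poly ?g x" using c by simp
  qed
  then have "poly f x = poly ?g x" by simp
  then show ?thesis by (simp add: poly_sum)
qed

text \<open>Both sides are linear in \<open>q\<close>, and for a tensor product the identity is the
  product over the coordinates of interpolation in the variable \<open>(x - z) / s\<close>.\<close>

lemma Qpoly_lagrange:
  assumes "q \<in> Qpoly p" "s > 0"
  shows "q x = (\<Sum>\<beta> | \<forall>i. \<beta> i \<le> p. q (\<chi> i. z $ i + s * node p (\<beta> i)) *
           tpoly (\<lambda>i. pcompose (lagrange p (\<beta> i)) [: - (z $ i) / s, 1 / s :]) x)"
  using assms(1)
proof (induction rule: Qpoly_induct)
  case (tensor f)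
  have "poly (f i) (x $ i) = (\<Sum>b\<le>p. poly (f i) (z $ i + s * node p b) *
          poly (pcompose (lagrange p b) [: - (z $ i) / s, 1 / s :]) (x $ i))" for i
  proof -
    have "poly (f i) (x $ i) = poly (pcompose (f i) [: z $ i, s :]) ((x $ i - z $ i) / s)"
      using assms(2) by (simp add: poly_pcompose)
    also have "\<dots> = (\<Sum>b\<le>p. poly (pcompose (f i) [: z $ i, s :]) (node p b) *
          poly (lagrange p b) ((x $ i - z $ i) / s))"
      by (rule lagrange_interpolation) (use tensor[of i] in \<open>simp add: degree_pcompose\<close>)
    finally show ?thesis
      by (simp add: poly_pcompose diff_divide_distrib mult.commute)
  qed
  then show ?case by (simp add: tpoly_def tensor_expand prod.distrib)
next
  case (add a f g)
  then show ?case
    by (simp add: sum_distrib_left distrib_right sum.distrib mult.assoc)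
qed simp

lemma pderiv_funpow_pcompose_linear:
  "(pderiv ^^ j) (pcompose f [: a, b :]) = smult (b ^ j) (pcompose ((pderiv ^^ j) f) [: a, (b::real) :])"
  by (induction j) (auto simp: pderiv_smult pderiv_pcompose pderiv_pCons mult.commute)

text \<open>Each derivative brings out one factor \<open>1 / s\<close>. A single variable is
  differentiated at most \<open>length is\<close> times, so a bound for that range of orders
  suffices.\<close>

lemma derivs_tpoly_scaled_bound:
  fixes f :: "'n::finite \<Rightarrow> real poly"
  assumes "s > 0" "\<And>j i. j \<le> length is \<Longrightarrow> \<bar>poly ((pderiv ^^ j) (f i)) ((x $ i - z $ i) / s)\<bar> \<le> B"
  shows "\<bar>derivs is (tpoly (\<lambda>i. pcompose (f i) [: - (z $ i) / s, 1 / s :])) x\<bar> \<le> B ^ CARD('n) / s ^ length is"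
proof -
  let ?c = "\<lambda>i. count_list is i"
  have c: "?c i \<le> length is" for i by (rule count_le_length)
  have "derivs is (tpoly (\<lambda>i. pcompose (f i) [: - (z $ i) / s, 1 / s :])) x =
     (\<Prod>i\<in>UNIV. (1/s) ^ ?c i * poly ((pderiv ^^ ?c i) (f i)) ((x $ i - z $ i) / s))"
    unfolding derivs_tpoly tpoly_def
    by (intro prod.cong) (auto simp: pderiv_funpow_pcompose_linear poly_pcompose diff_divide_distrib)
  also have "\<dots> = (\<Prod>i\<in>UNIV. (1/s) ^ ?c i) * (\<Prod>i\<in>UNIV. poly ((pderiv ^^ ?c i) (f i)) ((x $ i - z $ i) / s))"
    by (rule prod.distrib)
  also have "(\<Prod>i\<in>UNIV. (1/s) ^ ?c i) = (1/s) ^ length is"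
    by (simp add: power_sum[symmetric] sum_count_list_UNIV)
  finally have "\<bar>derivs is (tpoly (\<lambda>i. pcompose (f i) [: - (z $ i) / s, 1 / s :])) x\<bar> =
     (1/s) ^ length is * (\<Prod>i\<in>UNIV. \<bar>poly ((pderiv ^^ ?c i) (f i)) ((x $ i - z $ i) / s)\<bar>)"
    using assms(1) by (simp add: abs_mult abs_prod)
  also have "\<dots> \<le> (1/s) ^ length is * (\<Prod>i\<in>(UNIV::'n set). B)"
    using assms(1) by (intro mult_left_mono prod_mono) (auto intro!: assms(2)[OF c])
  finally show ?thesis by (simp add: power_divide)
qed

lemma integral_translate_cube_le:
  fixes q :: "real^'n \<Rightarrow> real"
  assumes "continuous_on UNIV q" "\<And>i. 0 \<le> t $ i" "\<And>i. t $ i \<le> r"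
  shows "set_integrable lborel (cube y s) (\<lambda>z. \<bar>q (z + t)\<bar>)"
    and "(LINT z:cube y s|lborel. \<bar>q (z + t)\<bar>) \<le> (LINT z:cube y (s + r)|lborel. \<bar>q z\<bar>)"
proof -
  show "set_integrable lborel (cube y s) (\<lambda>z. \<bar>q (z + t)\<bar>)"
    by (intro continuous_cube_integrable continuous_on_rabs continuous_on_compose2[OF assms(1)])
      (auto intro: continuous_intros)
  define F where "F x = indicator (cube (y + t) s) x * \<bar>q x\<bar>" for x
  have qm: "q \<in> borel_measurable borel" using assms(1) by (simp add: borel_measurable_continuous_onI)
  have Fm: "F \<in> borel_measurable borel" unfolding F_def using qm by measurable
  have "(LINT z:cube y s|lborel. \<bar>q (z + t)\<bar>) = (LINT z|lborel. F (t + z))"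
    unfolding set_lebesgue_integral_def F_def
    by (intro Bochner_Integration.integral_cong) (auto simp: mem_cube indicator_def add.commute)
  also have "\<dots> = integral\<^sup>L (distr lborel borel ((+) t)) F"
    by (subst integral_distr) (use Fm in auto)
  also have "\<dots> = integral\<^sup>L lborel F" by (simp add: lborel_distr_plus)
  also have "\<dots> \<le> (LINT z:cube y (s + r)|lborel. \<bar>q z\<bar>)"
    unfolding set_lebesgue_integral_def
  proof (rule integral_mono)
    show "integrable lborel F"
      using continuous_cube_integrable[of "y + t" s "\<lambda>x. \<bar>q x\<bar>"] assms(1) continuous_on_subset
      unfolding set_integrable_def F_def real_scaleR_def by (auto intro!: continuous_on_rabs)
    show "integrable lborel (\<lambda>x. indicat_real (cube y (s + r)) x *\<^sub>R \<bar>q x\<bar>)"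
      using continuous_cube_integrable[of y "s + r" "\<lambda>x. \<bar>q x\<bar>"] assms(1) continuous_on_subset
      unfolding set_integrable_def by (auto intro!: continuous_on_rabs)
    fix x
    have "x \<in> cube (y + t) s \<Longrightarrow> x \<in> cube y (s + r)"
      using assms(2,3) unfolding mem_cube vector_add_component
      by (smt (verit))
    then show "F x \<le> indicat_real (cube y (s + r)) x *\<^sub>R \<bar>q x\<bar>"
      unfolding F_def by (auto simp: indicator_def)
  qed
  finally show "(LINT z:cube y s|lborel. \<bar>q (z + t)\<bar>) \<le> (LINT z:cube y (s + r)|lborel. \<bar>q z\<bar>)" .
qed

lemma polys_bounded:
  assumes "finite P"
  obtains B where "B \<ge> 1" "\<And>f u. f \<in> P \<Longrightarrow> \<bar>u\<bar> \<le> r \<Longrightarrow> \<bar>poly (f::real poly) u\<bar> \<le> B"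
proof -
  have "\<exists>B. \<forall>u. \<bar>u\<bar> \<le> r \<longrightarrow> \<bar>poly f u\<bar> \<le> B" for f :: "real poly"
  proof -
    have "bounded (poly f ` {-r..r})"
      by (intro compact_imp_bounded compact_continuous_image continuous_intros compact_Icc)
    then obtain B where "\<forall>u\<in>{-r..r}. \<bar>poly f u\<bar> \<le> B" unfolding bounded_iff by auto
    then show ?thesis by (intro exI[of _ B]) (simp add: abs_le_iff minus_le_iff)
  qed
  then obtain B where B: "\<And>f u. \<bar>u\<bar> \<le> r \<Longrightarrow> \<bar>poly (f :: real poly) u\<bar> \<le> B f" by metis
  show ?thesis
  proof (rule that[of "1 + (\<Sum>f\<in>P. \<bar>B f\<bar>)"])
    fix f u assume "f \<in> P" "\<bar>u\<bar> \<le> r"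
    then have "\<bar>poly f u\<bar> \<le> \<bar>B f\<bar>" using B[of u f] by simp
    also have "\<dots> \<le> (\<Sum>f\<in>P. \<bar>B f\<bar>)" using \<open>f \<in> P\<close> assms by (intro member_le_sum) auto
    finally show "\<bar>poly f u\<bar> \<le> 1 + (\<Sum>f\<in>P. \<bar>B f\<bar>)" by simp
  qed (simp add: sum_nonneg)
qed

text \<open>Lagrange interpolation expresses \<open>q x\<close> by the values of \<open>q\<close> on a grid in \<open>cube y s\<close>; averaging over
  all translates of the grid that stay in the cube turns these values into an integral.\<close>

lemma inverse_estimate_L1:
  assumes "lam \<ge> 0"
  obtains C where "C > 0"
    "\<And>(q::real^'n\<Rightarrow>real) y s is x. q \<in> Qpoly p \<Longrightarrow> s > 0 \<Longrightarrow> length is \<le> m \<Longrightarrow>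
      (\<And>i. \<bar>x $ i - y $ i\<bar> \<le> lam * s) \<Longrightarrow>
      \<bar>derivs is q x\<bar> \<le> C / s ^ (length is + CARD('n)) * (LINT z:cube y s|lborel. \<bar>q z\<bar>)"
proof -
  \<comment> \<open>\<open>lam + 1\<close>: \<open>x\<close> is within \<open>lam * s\<close> of
    \<open>y\<close>, and the base point \<open>z\<close> of the grid is within \<open>s\<close> of
    \<open>y\<close>.\<close>
  obtain B where B: "B \<ge> 1" "\<And>f u. f \<in> (\<lambda>(j,b). (pderiv ^^ j) (lagrange p b)) ` ({..m} \<times> {..p}) \<Longrightarrow>
       \<bar>u\<bar> \<le> lam + 1 \<Longrightarrow> \<bar>poly f u\<bar> \<le> B"
    by (rule polys_bounded[of "(\<lambda>(j,b). (pderiv ^^ j) (lagrange p b)) ` ({..m} \<times> {..p})" "lam + 1"]) auto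
  define M where "M = {\<beta> :: 'n \<Rightarrow> nat. \<forall>i. \<beta> i \<le> p}"
  have finM: "finite M" unfolding M_def by (rule finite_multi)
  have "(\<lambda>_. 0) \<in> M" by (auto simp: M_def)
  then have cardM: "card M > 0" using finM card_gt_0_iff by blast
  \<comment> \<open>There are \<open>card M\<close> grid points, each basis polynomial costs
    \<open>B ^ CARD('n)\<close>, and \<open>2 ^ CARD('n)\<close> comes from dividing by the volume
    of the cube of side \<open>s/2\<close> over which \<open>z\<close> is averaged.\<close>
  define C where "C = 2 ^ CARD('n) * B ^ CARD('n) * card M"
  show ?thesis
  proof (rule that)
    show "C > 0" using B(1) cardM unfolding C_def by simp
  next
    fix q :: "real^'n \<Rightarrow> real" and y x :: "real^'n" and s and "is" :: "'n list"
    assume q: "q \<in> Qpoly p" and s: "s > 0" and len: "length is \<le> m"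
      and x: "\<And>i. \<bar>x $ i - y $ i\<bar> \<le> lam * s"
    have qc: "continuous_on UNIV q" using q by (rule Qpoly_continuous)
    define \<tau> where "\<tau> \<beta> = (\<chi> i. s * node p (\<beta> i))" for \<beta> :: "'n \<Rightarrow> nat"
    define I where "I = (LINT z:cube y s|lborel. \<bar>q z\<bar>)"
    define E where "E = B ^ CARD('n) / s ^ length is"
    have E: "E \<ge> 0" unfolding E_def using s B(1) by simp
    define L where "L \<beta> z = tpoly (\<lambda>i. pcompose (lagrange p (\<beta> i)) [: - (z $ i) / s, 1 / s :])"
      for \<beta> :: "'n \<Rightarrow> nat" and z
    have Lb: "\<bar>derivs is (L \<beta> z) x\<bar> \<le> E" if z: "z \<in> cube y (s/2)" and \<beta>: "\<beta> \<in> M" for z \<beta>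
      unfolding L_def E_def
    proof (rule derivs_tpoly_scaled_bound[OF s])
      fix j i assume j: "j \<le> length is"
      have "\<bar>x $ i - z $ i\<bar> \<le> \<bar>x $ i - y $ i\<bar> + \<bar>y $ i - z $ i\<bar>" by simp
      also have "\<dots> \<le> lam * s + s"
      proof -
        have "y $ i \<le> z $ i \<and> z $ i \<le> y $ i + s/2" using z by (simp add: mem_cube)
        then have "\<bar>y $ i - z $ i\<bar> \<le> s" using s by (simp add: abs_le_iff)
        with x[of i] show ?thesis by simp
      qed
      finally have "\<bar>(x $ i - z $ i) / s\<bar> \<le> lam + 1" using s by (simp add: field_simps)
      then show "\<bar>poly ((pderiv ^^ j) (lagrange p (\<beta> i))) ((x $ i - z $ i) / s)\<bar> \<le> B"
        using j len \<beta> by (intro B(2)) (auto simp: M_def intro!: image_eqI[of _ _ "(j, \<beta> i)"])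
    qed
    have Dq: "derivs is q x = (\<Sum>\<beta>\<in>M. q (z + \<tau> \<beta>) * derivs is (L \<beta> z) x)" for z
    proof -
      have LQ: "L \<beta> z \<in> Qpoly p" if "\<beta> \<in> M" for \<beta>
        using that s unfolding L_def M_def
        by (intro tpoly_Qpoly) (auto simp: degree_pcompose degree_lagrange)
      have "q = (\<lambda>x. \<Sum>\<beta>\<in>M. q (z + \<tau> \<beta>) * L \<beta> z x)"
      proof
        fix x
        have "z + \<tau> \<beta> = (\<chi> i. z $ i + s * node p (\<beta> i))" for \<beta>
          by (simp add: vec_eq_iff \<tau>_def)
        then show "q x = (\<Sum>\<beta>\<in>M. q (z + \<tau> \<beta>) * L \<beta> z x)"
          using Qpoly_lagrange[OF q s, of x z] by (simp add: L_def M_def)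
      qed
      then have "derivs is q = derivs is (\<lambda>x. \<Sum>\<beta>\<in>M. q (z + \<tau> \<beta>) * L \<beta> z x)" by metis
      also have "\<dots> = (\<lambda>x. \<Sum>\<beta>\<in>M. derivs is (\<lambda>x. q (z + \<tau> \<beta>) * L \<beta> z x) x)"
        by (rule derivs_sum[OF _ order_refl]) (auto intro: Ck_cmult[OF Qpoly_Ck[OF LQ]])
      also have "\<dots> = (\<lambda>x. \<Sum>\<beta>\<in>M. q (z + \<tau> \<beta>) * derivs is (L \<beta> z) x)"
        using derivs_cmult[OF Qpoly_Ck[OF LQ] order_refl] by (intro ext sum.cong) (auto simp: fun_eq_iff)
      finally show ?thesis by (simp add: fun_eq_iff)
    qed
    have pt: "\<bar>derivs is q x\<bar> \<le> (\<Sum>\<beta>\<in>M. E * \<bar>q (z + \<tau> \<beta>)\<bar>)" if z: "z \<in> cube y (s/2)" for z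
    proof -
      have "\<bar>derivs is q x\<bar> \<le> (\<Sum>\<beta>\<in>M. \<bar>q (z + \<tau> \<beta>) * derivs is (L \<beta> z) x\<bar>)"
        unfolding Dq[of z] by (rule sum_abs)
      also have "\<dots> \<le> (\<Sum>\<beta>\<in>M. E * \<bar>q (z + \<tau> \<beta>)\<bar>)"
      proof (rule sum_mono)
        fix \<beta> assume "\<beta> \<in> M"
        then have "\<bar>q (z + \<tau> \<beta>)\<bar> * \<bar>derivs is (L \<beta> z) x\<bar> \<le> \<bar>q (z + \<tau> \<beta>)\<bar> * E"
          by (intro mult_left_mono Lb[OF z]) auto
        then show "\<bar>q (z + \<tau> \<beta>) * derivs is (L \<beta> z) x\<bar> \<le> E * \<bar>q (z + \<tau> \<beta>)\<bar>"
          by (simp add: abs_mult mult.commute)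
      qed
      finally show ?thesis .
    qed
    have \<tau>b: "0 \<le> \<tau> \<beta> $ i" "\<tau> \<beta> $ i \<le> s/2" if "\<beta> \<in> M" for \<beta> i
      using that s node_bounds[of "\<beta> i" p] unfolding \<tau>_def M_def by auto
    note tr = integral_translate_cube_le[OF qc \<tau>b]
    have "(s/2) ^ CARD('n) * \<bar>derivs is q x\<bar> = (LINT z:cube y (s/2)|lborel. \<bar>derivs is q x\<bar>)"
      using s by (simp add: measure_cube set_lebesgue_integral_def)
    also have "\<dots> \<le> (LINT z:cube y (s/2)|lborel. (\<Sum>\<beta>\<in>M. E * \<bar>q (z + \<tau> \<beta>)\<bar>))"
      using pt tr(1) by (intro set_integral_mono set_integral_sum set_integrable_mult_right)
        (auto intro: continuous_cube_integrable)
    also have "\<dots> = (\<Sum>\<beta>\<in>M. (LINT z:cube y (s/2)|lborel. E * \<bar>q (z + \<tau> \<beta>)\<bar>))"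
      using tr(1) by (intro set_integral_sum set_integrable_mult_right) auto
    also have "\<dots> \<le> (\<Sum>\<beta>\<in>M. E * I)"
      using tr(2)[of _ y "s/2"] E by (intro sum_mono) (auto simp: I_def intro!: mult_left_mono)
    finally have "(s/2) ^ CARD('n) * \<bar>derivs is q x\<bar> \<le> card M * E * I" by simp
    then have "\<bar>derivs is q x\<bar> \<le> card M * E * I / (s/2) ^ CARD('n)"
      using s by (simp add: pos_le_divide_eq mult.commute)
    also have "\<dots> = C / s ^ (length is + CARD('n)) * I"
      using s by (simp add: C_def E_def power_divide power_add field_simps)
    finally show "\<bar>derivs is q x\<bar> \<le> C / s ^ (length is + CARD('n)) * (LINT z:cube y s|lborel. \<bar>q z\<bar>)"
      by (simp add: I_def)
  qed
qed

text \<open>Cauchy-Schwarz against the constant 1, obtained as nonnegativity of the variance of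
  \<open>\<bar>f\<bar>\<close>, whose mean is \<open>I/V\<close>.\<close>

lemma integral_abs_square_le:
  fixes f :: "real^'n \<Rightarrow> real"
  assumes "continuous_on (cube y s) f" "s > 0"
  shows "(LINT z:cube y s|lborel. \<bar>f z\<bar>)\<^sup>2 \<le> s ^ CARD('n) * (LINT z:cube y s|lborel. (f z)\<^sup>2)"
proof -
  define I where "I = (LINT z:cube y s|lborel. \<bar>f z\<bar>)"
  define V where "V = s ^ CARD('n)"
  have V: "V > 0" using assms(2) by (simp add: V_def)
  have i: "set_integrable lborel (cube y s) (\<lambda>z. \<bar>f z\<bar>)" "set_integrable lborel (cube y s) (\<lambda>z. (f z)\<^sup>2)"
    "set_integrable lborel (cube y s) (\<lambda>z. (I/V)\<^sup>2)"
    using assms(1) by (auto intro!: continuous_cube_integrable continuous_intros)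
  have "0 \<le> (LINT z:cube y s|lborel. (\<bar>f z\<bar> - I/V)\<^sup>2)"
    unfolding set_lebesgue_integral_def by (rule integral_nonneg_AE) simp
  also have "\<dots> = (LINT z:cube y s|lborel. ((f z)\<^sup>2 + (I/V)\<^sup>2) - 2 * (I/V) * \<bar>f z\<bar>)"
    by (simp add: power2_diff mult_ac)
  also have "\<dots> = (LINT z:cube y s|lborel. (f z)\<^sup>2) + (LINT z:cube y s|lborel. (I/V)\<^sup>2) - 2 * (I/V) * I"
    using i by (simp add: set_integral_diff set_integral_add set_integrable_mult_right I_def)
  also have "(LINT z:cube y s|lborel. (I/V)\<^sup>2) = V * (I/V)\<^sup>2"
    using assms(2) by (simp add: measure_cube set_lebesgue_integral_def V_def)
  finally have "0 \<le> (LINT z:cube y s|lborel. (f z)\<^sup>2) - I\<^sup>2 / V"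
    using V by (simp add: power2_eq_square)
  then show ?thesis using V by (simp add: I_def V_def field_simps)
qed

text \<open>The point \<open>x\<close> may lie outside the cube, at the price of a constant
  depending on \<open>lam\<close>. This is what controls the extension of a polynomial from a large
  element to a small one.\<close>

lemma inverse_estimate:
  assumes "lam \<ge> 0"
  obtains C where "C > 0"
    "\<And>(q::real^'n\<Rightarrow>real) y s is x. q \<in> Qpoly p \<Longrightarrow> s > 0 \<Longrightarrow> length is \<le> m \<Longrightarrow>
      (\<And>i. \<bar>x $ i - y $ i\<bar> \<le> lam * s) \<Longrightarrow>
      (derivs is q x)\<^sup>2 \<le> C / s ^ (2 * length is + CARD('n)) * (LINT z:cube y s|lborel. (q z)\<^sup>2)"
proof -
  obtain C where C: "C > 0"
    "\<And>(q::real^'n\<Rightarrow>real) y s is x. q \<in> Qpoly p \<Longrightarrow> s > 0 \<Longrightarrow> length is \<le> m \<Longrightarrow>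
      (\<And>i. \<bar>x $ i - y $ i\<bar> \<le> lam * s) \<Longrightarrow>
      \<bar>derivs is q x\<bar> \<le> C / s ^ (length is + CARD('n)) * (LINT z:cube y s|lborel. \<bar>q z\<bar>)"
    using inverse_estimate_L1[OF assms, where ?'n = 'n and p = p and m = m] by blast
  show ?thesis
  proof (rule that[of "C\<^sup>2"])
    fix q :: "real^'n \<Rightarrow> real" and y x :: "real^'n" and s and "is" :: "'n list"
    assume h: "q \<in> Qpoly p" "s > 0" "length is \<le> m" "\<And>i. \<bar>x $ i - y $ i\<bar> \<le> lam * s"
    have "(derivs is q x)\<^sup>2 = \<bar>derivs is q x\<bar>\<^sup>2" by simp
    also have "\<dots> \<le> (C / s ^ (length is + CARD('n)) * (LINT z:cube y s|lborel. \<bar>q z\<bar>))\<^sup>2"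
      by (rule power_mono[OF C(2)[OF h]]) auto
    also have "\<dots> = (C / s ^ (length is + CARD('n)))\<^sup>2 * (LINT z:cube y s|lborel. \<bar>q z\<bar>)\<^sup>2"
      by (rule power_mult_distrib)
    also have "\<dots> \<le> (C / s ^ (length is + CARD('n)))\<^sup>2 * (s ^ CARD('n) * (LINT z:cube y s|lborel. (q z)\<^sup>2))"
      by (intro mult_left_mono integral_abs_square_le Qpoly_continuous[OF h(1)] h) auto
    also have "\<dots> = C\<^sup>2 / s ^ (2 * length is + CARD('n)) * (LINT z:cube y s|lborel. (q z)\<^sup>2)"
      using h(2) by (simp add: power_divide power_add power_mult field_simps power2_eq_square)
    finally show "(derivs is q x)\<^sup>2 \<le> C\<^sup>2 / s ^ (2 * length is + CARD('n)) * (LINT z:cube y s|lborel. (q z)\<^sup>2)" .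
  qed (use C(1) in simp)
qed

lemma Qpoly_zero_on_cube:
  assumes "q \<in> Qpoly p" "s > 0" "\<And>x. x \<in> cube y s \<Longrightarrow> q x = 0"
  shows "q = (\<lambda>x. 0)"
proof
  fix x :: "real^'a"
  \<comment> \<open>Any \<open>x\<close> is within reach of the cube for a suitable
    \<open>lam\<close>; the size of the resulting constant does not matter as it multiplies
    zero.\<close>
  define lam where "lam = norm (x - y) / s"
  have lam: "lam \<ge> 0" using assms(2) by (simp add: lam_def)
  obtain C where "C > 0" and C: "\<And>(q::real^'a\<Rightarrow>real) y s is x. q \<in> Qpoly p \<Longrightarrow> s > 0 \<Longrightarrow> length is \<le> 0 \<Longrightarrow>
      (\<And>i. \<bar>x $ i - y $ i\<bar> \<le> lam * s) \<Longrightarrow>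
      (derivs is q x)\<^sup>2 \<le> C / s ^ (2 * length is + CARD('a)) * (LINT z:cube y s|lborel. (q z)\<^sup>2)"
    using inverse_estimate[OF lam, where ?'n = 'a and p = p and m = 0] by blast
  have "\<bar>x $ i - y $ i\<bar> \<le> lam * s" for i
    using component_le_norm_cart[of "x - y" i] assms(2) by (simp add: lam_def)
  from C[OF assms(1,2) _ this, of "[]"]
  have "(q x)\<^sup>2 \<le> C / s ^ CARD('a) * (LINT z:cube y s|lborel. (q z)\<^sup>2)" by simp
  also have "(LINT z:cube y s|lborel. (q z)\<^sup>2) = (LINT z:cube y s|lborel. 0)"
    by (rule set_lebesgue_integral_cong) (use assms(3) in auto)
  finally show "q x = 0" by (simp add: set_lebesgue_integral_def)
qed

section \<open>The mesh\<close>

lemma mesh_cube: "mesh h x0 = range (\<lambda>j :: 'n \<Rightarrow> int. cube (\<chi> i. (x0::real^'n) $ i + h * of_int (j i)) h)"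
  unfolding mesh_def cube_def by (intro image_cong refl arg_cong2[where f = cbox]) (auto simp: vec_eq_iff algebra_simps)

lemma meshE:
  assumes "T \<in> mesh h (x0::real^'n)"
  obtains j where "T = cube (\<chi> i. x0 $ i + h * of_int (j i)) h"
  using assms unfolding mesh_cube by blast

lemma interior_cube: "interior (cube a s) = {x. \<forall>i. a $ i < x $ i \<and> x $ i < a $ i + s}"
  by (auto simp: cube_def mem_box_cart)

lemma closure_interior_cube:
  assumes "s > 0"
  shows "closure (interior (cube a s)) = cube (a::real^'n) s"
proof -
  have "(\<chi> i. a $ i + s/2) \<in> interior (cube a s)" using assms by (auto simp: interior_cube)
  then have "box a (\<chi> i. a $ i + s) \<noteq> {}" unfolding cube_def by auto
  then show ?thesis unfolding cube_def by (simp add: closure_box)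
qed

lemma countable_mesh: "countable (mesh h x0)"
  unfolding mesh_def by (rule countable_image) simp

lemma mesh_interior_unique:
  assumes "h > 0" "T \<in> mesh h (x0::real^'n)" "T' \<in> mesh h x0" "x \<in> interior T" "x \<in> T'"
  shows "T' = T"
proof -
  obtain j where j: "T = cube (\<chi> i. x0 $ i + h * of_int (j i)) h" using assms(2) by (rule meshE)
  obtain j' where j': "T' = cube (\<chi> i. x0 $ i + h * of_int (j' i)) h" using assms(3) by (rule meshE)
  have "j i = j' i" for i
  proof -
    have "x0 $ i + h * of_int (j i) < x $ i" "x $ i < x0 $ i + h * of_int (j i) + h"
      using assms(4) unfolding j interior_cube by auto
    moreover have "x0 $ i + h * of_int (j' i) \<le> x $ i" "x $ i \<le> x0 $ i + h * of_int (j' i) + h"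
      using assms(5) unfolding j' mem_cube by auto
    ultimately have "h * of_int (j i) < h * (of_int (j' i) + 1)" "h * of_int (j' i) < h * (of_int (j i) + 1)"
      by (auto simp: algebra_simps)
    then have "real_of_int (j i) < of_int (j' i) + 1" "real_of_int (j' i) < of_int (j i) + 1"
      using assms(1) by (simp_all only: mult_less_cancel_left_pos)
    then show ?thesis by linarith
  qed
  then show ?thesis unfolding j j' by simp
qed

lemma mesh_covers:
  assumes "h > 0"
  obtains T where "T \<in> mesh h (x0::real^'n)" "x \<in> T"
proof
  let ?j = "\<lambda>i. \<lfloor>(x $ i - x0 $ i) / h\<rfloor>"
  show "cube (\<chi> i. x0 $ i + h * of_int (?j i)) h \<in> mesh h x0" unfolding mesh_cube
    by (rule range_eqI[where x = ?j]) simp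
  show "x \<in> cube (\<chi> i. x0 $ i + h * of_int (?j i)) h"
  proof -
    have "h * r \<le> t \<and> t \<le> h * r + h" if "r \<le> t / h" "t / h \<le> r + 1" for r t
      using that assms by (simp add: field_simps)
    moreover have "of_int (?j i) \<le> (x $ i - x0 $ i) / h" "(x $ i - x0 $ i) / h \<le> of_int (?j i) + 1" for i
      by linarith+
    ultimately have "h * of_int (?j i) \<le> x $ i - x0 $ i \<and> x $ i - x0 $ i \<le> h * of_int (?j i) + h" for i
      by blast
    then show ?thesis by (auto simp: mem_cube algebra_simps)
  qed
qed

text \<open>In each coordinate the index of a cell meeting the ball differs from
  \<open>\<lfloor>u i\<rfloor>\<close> by at most \<open>\<lceil>\<rho>\<rceil> + 1\<close>, which
  leaves \<open>2 * \<lceil>\<rho>\<rceil> + 3\<close> integers. For negative \<open>\<rho>\<close>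
  the ball is empty, and \<open>nat\<close> keeps the bound valid.\<close>

lemma mesh_near:
  fixes z :: "real^'n"
  assumes h: "h > 0"
  shows "finite {T \<in> mesh h x0. T \<inter> cball z (\<rho> * h) \<noteq> {}}"
    and "card {T \<in> mesh h x0. T \<inter> cball z (\<rho> * h) \<noteq> {}} \<le> (2 * nat \<lceil>\<rho>\<rceil> + 3) ^ CARD('n)"
proof -
  define m where "m = int (nat \<lceil>\<rho>\<rceil>)"
  define u where "u i = (z $ i - x0 $ i) / h" for i
  define P where "P = PiE UNIV (\<lambda>i. {\<lfloor>u i\<rfloor> - m - 1 .. \<lfloor>u i\<rfloor> + m + 1})"
  have finP: "finite P" unfolding P_def by (intro finite_PiE) auto
  have "card P = (\<Prod>i\<in>(UNIV::'n set). 2 * nat \<lceil>\<rho>\<rceil> + 3)"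
  proof -
    have "card {\<lfloor>u i\<rfloor> - m - 1 .. \<lfloor>u i\<rfloor> + m + 1} = 2 * nat \<lceil>\<rho>\<rceil> + 3" for i
    proof -
      have "card {\<lfloor>u i\<rfloor> - m - 1 .. \<lfloor>u i\<rfloor> + m + 1} = nat (2 * m + 3)"
        unfolding card_atLeastAtMost_int by (rule arg_cong[where f = nat]) simp
      also have "2 * m + 3 = int (2 * nat \<lceil>\<rho>\<rceil> + 3)" unfolding m_def by simp
      finally show ?thesis by (simp only: nat_int)
    qed
    then show ?thesis unfolding P_def by (subst card_PiE) auto
  qed
  then have cardP: "card P = (2 * nat \<lceil>\<rho>\<rceil> + 3) ^ CARD('n)" by simp
  have sub: "{T \<in> mesh h x0. T \<inter> cball z (\<rho> * h) \<noteq> {}} \<subseteq>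
      (\<lambda>j. cube (\<chi> i. x0 $ i + h * of_int (j i)) h) ` P"
  proof clarify
    fix T assume T: "T \<in> mesh h x0" "T \<inter> cball z (\<rho> * h) \<noteq> {}"
    then obtain x where x: "x \<in> T" "dist z x \<le> \<rho> * h" by auto
    obtain j where j: "T = cube (\<chi> i. x0 $ i + h * of_int (j i)) h" using T(1) by (rule meshE)
    have "j i \<in> {\<lfloor>u i\<rfloor> - m - 1 .. \<lfloor>u i\<rfloor> + m + 1}" for i
    proof -
      have "x0 $ i + h * of_int (j i) \<le> x $ i" "x $ i \<le> x0 $ i + h * of_int (j i) + h"
        using x(1) unfolding j mem_cube by auto
      then have 1: "of_int (j i) \<le> (x $ i - x0 $ i) / h" "(x $ i - x0 $ i) / h \<le> of_int (j i) + 1"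
        using h by (simp_all add: field_simps)
      have "\<bar>x $ i - z $ i\<bar> \<le> \<rho> * h"
        using component_le_norm_cart[of "x - z" i] x(2) by (simp add: dist_norm norm_minus_commute)
      then have "\<bar>(x $ i - x0 $ i) / h - u i\<bar> \<le> \<rho>"
        using h unfolding u_def by (simp add: diff_divide_distrib[symmetric] pos_divide_le_eq)
      moreover have "\<rho> \<le> of_int m" unfolding m_def by linarith
      ultimately have "of_int (j i) \<le> u i + of_int m" "u i - of_int m \<le> of_int (j i) + 1"
        using 1 by linarith+
      then show ?thesis by (simp add: le_floor_iff) linarith
    qed
    then have "j \<in> P" by (auto simp: P_def)
    then show "T \<in> (\<lambda>j. cube (\<chi> i. x0 $ i + h * of_int (j i)) h) ` P" using j by blast
  qed
  show "finite {T \<in> mesh h x0. T \<inter> cball z (\<rho> * h) \<noteq> {}}"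
    using finite_subset[OF sub] finP by blast
  show "card {T \<in> mesh h x0. T \<inter> cball z (\<rho> * h) \<noteq> {}} \<le> (2 * nat \<lceil>\<rho>\<rceil> + 3) ^ CARD('n)"
    using card_mono[OF finite_imageI[OF finP] sub] card_image_le[OF finP, of "\<lambda>j. cube (\<chi> i. x0 $ i + h * of_int (j i)) h"]
    unfolding cardP by linarith
qed

lemma cube_boundary_null: "emeasure lborel (cube a s - interior (cube a s)) = 0"
proof -
  have "cube a s - interior (cube a s) = frontier (cbox a (\<chi> i. a $ i + s))"
    by (simp add: cube_def frontier_def)
  moreover have "emeasure lborel (frontier (cbox a (\<chi> i. a $ i + s))) = 0"
    using negligible_frontier_interval[of a "\<chi> i. a $ i + s"]
    by (simp add: frontier_cbox negligible_iff_emeasure0 emeasure_completion)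
  ultimately show ?thesis by simp
qed

lemma AE_mesh_interior:
  "AE x in lborel. \<forall>T\<in>mesh h (x0::real^'n). x \<in> T \<longrightarrow> x \<in> interior T"
proof -
  have "AE x in lborel. x \<in> T \<longrightarrow> x \<in> interior T" if "T \<in> mesh h x0" for T
  proof -
    have "T - interior T \<in> null_sets lborel"
      using that cube_boundary_null by (elim meshE) (auto simp: null_sets_def)
    then have "AE x in lborel. x \<notin> T - interior T" by (rule AE_not_in)
    then show ?thesis by eventually_elim auto
  qed
  then show ?thesis using countable_mesh by (subst AE_ball_countable) auto
qed

lemma dist_cube_le:
  fixes x y :: "real^'n"
  assumes "\<And>i. \<bar>x $ i - y $ i\<bar> \<le> s"
  shows "dist x y \<le> real CARD('n) * s"
proof -
  have "dist x y \<le> (\<Sum>i\<in>UNIV. \<bar>(x - y) $ i\<bar>)" unfolding dist_norm by (rule norm_le_l1_cart)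
  also have "\<dots> \<le> (\<Sum>i\<in>(UNIV::'n set). s)" using assms by (intro sum_mono) simp
  finally show ?thesis by simp
qed

lemma mesh_dist_le:
  assumes "T \<in> mesh h (x0::real^'n)" "x \<in> T" "y \<in> T"
  shows "dist x y \<le> real CARD('n) * h"
  using assms by (elim meshE, intro dist_cube_le) (auto simp: mem_cube abs_le_iff; smt (verit))

lemma derivs_eq_on_cell:
  assumes "Ck k v" "length is \<le> k" "q \<in> Qpoly p" "\<And>x. x \<in> cube a h \<Longrightarrow> v x = q x" "h > 0" "x \<in> cube a h"
  shows "derivs is v x = derivs is q x"
proof -
  \<comment> \<open>In the interior both derivatives are local; continuity up to order
    \<open>k\<close> carries the identity to the faces.\<close>
  have "interior (cube a h) \<subseteq> {x. derivs is v x = derivs is q x}"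
    using derivs_cong_open[OF open_interior, of "cube a h" v q] assms(4) interior_subset by blast
  moreover have "closed {x. derivs is v x = derivs is q x}"
    using Ck_derivs_continuous[OF assms(1,2)] Ck_derivs_continuous[OF Qpoly_Ck[OF assms(3), of k] assms(2)]
    by (intro closed_Collect_eq)
  ultimately have "closure (interior (cube a h)) \<subseteq> {x. derivs is v x = derivs is q x}"
    by (rule closure_minimal)
  then show ?thesis using closure_interior_cube[OF assms(5), of a] assms(6) by auto
qed

lemma subcube:
  fixes x :: "real^'n"
  assumes "x \<in> cube a h" "0 < s" "s \<le> h / 2"
  obtains b where "x \<in> cube b s" "cube b s \<subseteq> cube a h"
proof
  \<comment> \<open>\<open>x\<close> becomes a vertex of the subcube, which in each coordinate
    extends from \<open>x\<close> towards the farther face; \<open>s \<le> h / 2\<close> makes it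
    fit.\<close>
  define b where "b = (\<chi> i. if x $ i \<le> a $ i + h / 2 then x $ i else x $ i - s)"
  show "x \<in> cube b s" using assms(2) by (auto simp: mem_cube b_def)
  show "cube b s \<subseteq> cube a h"
  proof
    fix y assume y: "y \<in> cube b s"
    show "y \<in> cube a h" unfolding mem_cube
    proof
      fix i
      have "b $ i \<le> y $ i" "y $ i \<le> b $ i + s" using y by (auto simp: mem_cube)
      moreover have "a $ i \<le> x $ i" "x $ i \<le> a $ i + h" using assms(1) by (auto simp: mem_cube)
      ultimately show "a $ i \<le> y $ i \<and> y $ i \<le> a $ i + h"
        using assms(2,3) unfolding b_def by (auto split: if_splits)
    qed
  qed
qed

text \<open>On a cell containing \<open>x\<close> the derivative is itself a polynomial in
  \<open>Qpoly p\<close>, so the inverse estimate of order 0 applies to it on a subcube at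
  \<open>x\<close>. The subcube lies in any prescribed ball of radius \<open>c * h\<close>, so it
  lies in \<open>\<Omega>\<close> whenever that ball does.\<close>

lemma deep_bound:
  assumes "c > 0"
  obtains C where "C > 0" "\<And>h (x0::real^'n) k v x is. h > 0 \<Longrightarrow> Ck k v \<Longrightarrow> (\<forall>T\<in>mesh h x0. v \<in> Qpoly_on p T) \<Longrightarrow>
    length is \<le> k \<Longrightarrow> \<exists>b s. cube b s \<subseteq> ball x (c * h) \<and> 
      (derivs is v x)\<^sup>2 \<le> C / h ^ CARD('n) * (LINT z:cube b s|lborel. (derivs is v z)\<^sup>2)"
proof -
  obtain C where C: "C > 0"
    "\<And>(q::real^'n\<Rightarrow>real) y s is x. q \<in> Qpoly p \<Longrightarrow> s > 0 \<Longrightarrow> length is \<le> 0 \<Longrightarrow>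
      (\<And>i. \<bar>x $ i - y $ i\<bar> \<le> 1 * s) \<Longrightarrow>
      (derivs is q x)\<^sup>2 \<le> C / s ^ (2 * length is + CARD('n)) * (LINT z:cube y s|lborel. (q z)\<^sup>2)"
    using inverse_estimate[OF zero_le_one, where ?'n = 'n and p = p and m = 0] by blast
  \<comment> \<open>\<open>1/2\<close> lets the subcube fit into the cell, the other term keeps its
    diameter below \<open>c * h\<close>.\<close>
  define \<sigma> where "\<sigma> = min (1/2) (c / (2 * real CARD('n)))"
  have \<sigma>: "\<sigma> > 0" "\<sigma> \<le> 1/2" using assms by (auto simp: \<sigma>_def)
  have \<sigma>2: "real CARD('n) * \<sigma> < c"
  proof -
    have "real CARD('n) * \<sigma> \<le> real CARD('n) * (c / (2 * real CARD('n)))"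
      by (intro mult_left_mono) (auto simp: \<sigma>_def)
    also have "\<dots> = c / 2" by simp
    finally show ?thesis using assms by simp
  qed
  show ?thesis
  proof (rule that[of "C / \<sigma> ^ CARD('n)"])
    show "C / \<sigma> ^ CARD('n) > 0" using C(1) \<sigma>(1) by simp
  next
    fix h k and x0 x :: "real^'n" and v and "is" :: "'n list"
    assume h: "h > 0" and Ck: "Ck k v" and Q: "\<forall>T\<in>mesh h x0. v \<in> Qpoly_on p T" and l: "length is \<le> k"
    obtain T where T: "T \<in> mesh h x0" "x \<in> T" using mesh_covers[OF h] by blast
    obtain j where j: "T = cube (\<chi> i. x0 $ i + h * of_int (j i)) h" using T(1) by (rule meshE)
    obtain q where q: "q \<in> Qpoly p" "\<And>x. x \<in> T \<Longrightarrow> v x = q x"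
      using Q T(1) unfolding Qpoly_on_def by auto
    define s where "s = \<sigma> * h"
    have s: "s > 0" "s \<le> h / 2" using \<sigma> h by (auto simp: s_def)
    obtain b where b: "x \<in> cube b s" "cube b s \<subseteq> T"
      using subcube[OF T(2)[unfolded j] s] unfolding j by blast
    have Dq: "derivs is v y = derivs is q y" if "y \<in> T" for y
      using derivs_eq_on_cell[OF Ck l q(1), of _ h y] q(2) that h unfolding j by blast
    have "cube b s \<subseteq> ball x (c * h)"
    proof
      fix y assume y: "y \<in> cube b s"
      have "dist x y \<le> real CARD('n) * s"
      proof (rule dist_cube_le)
        fix i
        have "b $ i \<le> y $ i" "y $ i \<le> b $ i + s" "b $ i \<le> x $ i" "x $ i \<le> b $ i + s"
          using y b(1) by (auto simp: mem_cube)
        then show "\<bar>x $ i - y $ i\<bar> \<le> s" by linarith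
      qed
      also have "\<dots> = (real CARD('n) * \<sigma>) * h" by (simp add: s_def)
      also have "\<dots> < c * h" using \<sigma>2 h by simp
      finally show "y \<in> ball x (c * h)" by simp
    qed
    moreover have "(derivs is v x)\<^sup>2 \<le> C / \<sigma> ^ CARD('n) / h ^ CARD('n) * (LINT z:cube b s|lborel. (derivs is v z)\<^sup>2)"
    proof -
      have "\<bar>x $ i - b $ i\<bar> \<le> 1 * s" for i
      proof -
        have "b $ i \<le> x $ i" "x $ i \<le> b $ i + s" using b(1) by (auto simp: mem_cube)
        then show ?thesis by linarith
      qed
      from C(2)[OF Qpoly_derivs[OF q(1), of "is"] s(1) _ this, of "[]"]
      have "(derivs is q x)\<^sup>2 \<le> C / s ^ CARD('n) * (LINT z:cube b s|lborel. (derivs is q z)\<^sup>2)" by simp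
      also have "(LINT z:cube b s|lborel. (derivs is q z)\<^sup>2) = (LINT z:cube b s|lborel. (derivs is v z)\<^sup>2)"
        using Dq b(2) by (intro set_lebesgue_integral_cong) auto
      finally show ?thesis using Dq[OF T(2)] by (simp add: s_def power_mult_distrib)
    qed
    ultimately show "\<exists>b s. cube b s \<subseteq> ball x (c * h) \<and> 
      (derivs is v x)\<^sup>2 \<le> C / \<sigma> ^ CARD('n) / h ^ CARD('n) * (LINT z:cube b s|lborel. (derivs is v z)\<^sup>2)" by blast
  qed
qed

section \<open>Chains of segments\<close>

text \<open>A relation, so that chains of \<open>n\<close> segments are the relational power
  \<open>link \<Omega> c l ^^ n\<close>; \<open>c\<close> is the clearance from the complement of
  \<open>\<Omega>\<close>.\<close>

definition link :: "(real^'n) set \<Rightarrow> real \<Rightarrow> real \<Rightarrow> ((real^'n) \<times> (real^'n)) set" where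
  "link \<Omega> c l = {(a, b). dist a b \<le> l \<and> (\<forall>x\<in>closed_segment a b. ball x c \<subseteq> \<Omega>)}"

text \<open>Descending induction on the order of the derivative: the value at \<open>a\<close> plus
  the mean value inequality with the bound for one order more. Each order costs a factor
  \<open>1 + L * CARD('n)\<close>, the cardinality coming from the passage from partial derivatives
  to the operator norm; at most \<open>m\<close> orders are passed.\<close>

lemma segment_step:
  fixes w :: "real^'n \<Rightarrow> real"
  assumes Ck: "Ck k w" and "m \<le> k" and M: "M \<ge> 0" and K: "K \<ge> 1" and L: "L \<ge> 0" and h: "h > 0"
    and top: "\<And>is x. length is = m \<Longrightarrow> x \<in> closed_segment a b \<Longrightarrow> \<bar>derivs is w x\<bar> \<le> M"
    and a: "\<And>is. length is \<le> m \<Longrightarrow> \<bar>derivs is w a\<bar> \<le> K * h ^ (m - length is) * M"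
    and ab: "dist a b \<le> L * h"
    and l: "length is \<le> m" and x: "x \<in> closed_segment a b"
  shows "\<bar>derivs is w x\<bar> \<le> K * (1 + L * real CARD('n)) ^ m * h ^ (m - length is) * M"
proof -
  define d where "d = real CARD('n)"
  have d: "d \<ge> 0" by (simp add: d_def)
  have main: "\<bar>derivs is w x\<bar> \<le> K * (1 + L * d) ^ j * h ^ j * M"
    if "length is = m - j" "j \<le> m" "x \<in> closed_segment a b" for j "is" x
    using that
  proof (induction j arbitrary: "is" x)
    case 0
    have "\<bar>derivs is w x\<bar> \<le> 1 * M" using top[of "is" x] 0 by simp
    also have "\<dots> \<le> K * M" using K M by (intro mult_right_mono)
    finally show ?case by simp
  next
    case (Suc j)
    define B where "B = K * (1 + L * d) ^ j * h ^ j * M"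
    have B: "B \<ge> 0" unfolding B_def using K M L h d by simp
    have part: "\<bar>partial i (derivs is w) y\<bar> \<le> B" if "y \<in> closed_segment a b" for i y
      using Suc.IH[of "i # is" y] Suc.prems that by (simp add: B_def)
    have dif: "(derivs is w has_derivative (\<lambda>h. \<Sum>i\<in>UNIV. h $ i * partial i (derivs is w) y)) (at y)" for y
      using Suc.prems \<open>m \<le> k\<close> by (intro differentiableD Ck_derivs_differentiable[OF Ck]) auto
    have "norm (derivs is w x - derivs is w a) \<le> (d * B) * norm (x - a)"
    proof (rule differentiable_bound[OF convex_closed_segment[of a b]])
      show "x \<in> closed_segment a b" "a \<in> closed_segment a b" using Suc.prems by auto
      fix y assume y: "y \<in> closed_segment a b"
      show "(derivs is w has_derivative (\<lambda>h. \<Sum>i\<in>UNIV. h $ i * partial i (derivs is w) y)) (at y within closed_segment a b)"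
        using dif by (rule has_derivative_at_withinI)
      show "onorm (\<lambda>h. \<Sum>i\<in>UNIV. h $ i * partial i (derivs is w) y) \<le> d * B"
      proof (rule onorm_bound)
        show "0 \<le> d * B" using d B by simp
        fix z :: "real^'n"
        have "norm (\<Sum>i\<in>UNIV. z $ i * partial i (derivs is w) y) \<le> (\<Sum>i\<in>(UNIV::'n set). norm z * B)"
        proof (rule sum_norm_le)
          fix i
          show "norm (z $ i * partial i (derivs is w) y) \<le> norm z * B"
            using part[OF y, of i] component_le_norm_cart[of z i] B
            by (simp add: abs_mult mult_mono)
        qed
        then show "norm (\<Sum>i\<in>UNIV. z $ i * partial i (derivs is w) y) \<le> d * B * norm z"
          by (simp add: d_def mult_ac)
      qed
    qed
    also have "\<dots> \<le> (d * B) * (L * h)"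
    proof (rule mult_left_mono)
      have "norm (x - a) \<le> dist a b"
        using dist_in_closed_segment[OF Suc.prems(3)] by (simp add: dist_norm norm_minus_commute)
      then show "norm (x - a) \<le> L * h" using ab by simp
    qed (use d B in simp)
    finally have "\<bar>derivs is w x\<bar> \<le> \<bar>derivs is w a\<bar> + (d * B) * (L * h)" by simp
    also have "\<bar>derivs is w a\<bar> \<le> K * h ^ Suc j * M"
      using a[of "is"] Suc.prems by simp
    also have "K * h ^ Suc j * M + (d * B) * (L * h) \<le> K * (1 + L * d) ^ j * h ^ Suc j * M + (d * B) * (L * h)"
    proof -
      have "1 \<le> (1 + L * d) ^ j" using L d by (intro one_le_power) simp
      then have "K * h ^ Suc j * M * 1 \<le> K * h ^ Suc j * M * (1 + L * d) ^ j"
        using K h M by (intro mult_left_mono) auto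
      then show ?thesis by (simp add: mult_ac)
    qed
    also have "\<dots> = K * (1 + L * d) ^ Suc j * h ^ Suc j * M"
      by (simp add: B_def algebra_simps)
    finally show ?case by simp
  qed
  have "\<bar>derivs is w x\<bar> \<le> K * (1 + L * d) ^ (m - length is) * h ^ (m - length is) * M"
    using l x by (intro main) auto
  also have "\<dots> \<le> K * (1 + L * d) ^ m * h ^ (m - length is) * M"
    using K L d h M by (intro mult_right_mono mult_left_mono power_increasing) auto
  finally show ?thesis by (simp add: d_def)
qed

lemma chain_bound:
  fixes w :: "real^'n \<Rightarrow> real"
  assumes Ck: "Ck k w" and "m \<le> k" and M: "M \<ge> 0" and L: "L \<ge> 0" and h: "h > 0"
    and top: "\<And>is x. length is = m \<Longrightarrow> ball x c \<subseteq> \<Omega> \<Longrightarrow> dist a x \<le> real n * L * h \<Longrightarrow> \<bar>derivs is w x\<bar> \<le> M"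
    and a: "\<And>is. length is < m \<Longrightarrow> derivs is w a = 0"
    and deep: "ball a c \<subseteq> \<Omega>"
    and chain: "(a, b) \<in> link \<Omega> c (L * h) ^^ n"
    and l: "length is \<le> m"
  shows "\<bar>derivs is w b\<bar> \<le> (1 + L * real CARD('n)) ^ (m * n) * h ^ (m - length is) * M"
proof -
  \<comment> \<open>The distance is carried along because \<open>top\<close> is available only near
    \<open>a\<close>; this later confines all integrals to one ball, so that they have finite
    overlap.\<close>
  have "dist a b \<le> real n * L * h \<and>
    (\<forall>is. length is \<le> m \<longrightarrow> \<bar>derivs is w b\<bar> \<le> (1 + L * real CARD('n)) ^ (m * n) * h ^ (m - length is) * M)"
    using chain top
  proof (induction n arbitrary: b)
    case 0
    then have [simp]: "b = a" by simp
    have "\<bar>derivs is w a\<bar> \<le> h ^ (m - length is) * M" if "length is \<le> m" for "is"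
    proof (cases "length is = m")
      case True
      then show ?thesis using 0(2)[of "is" a] deep by simp
    next
      case False
      then show ?thesis using a[of "is"] that M h by simp
    qed
    then show ?case by simp
  next
    case (Suc n)
    from Suc.prems(1) obtain z where z: "(a, z) \<in> link \<Omega> c (L * h) ^^ n" "(z, b) \<in> link \<Omega> c (L * h)"
      by auto
    have step: "real n * L * h \<le> real (Suc n) * L * h"
      using L h by (intro mult_right_mono) auto
    have IH: "dist a z \<le> real n * L * h"
      "\<And>is. length is \<le> m \<Longrightarrow> \<bar>derivs is w z\<bar> \<le> (1 + L * real CARD('n)) ^ (m * n) * h ^ (m - length is) * M"
      using Suc.IH[OF z(1)] Suc.prems(2) step by (meson order_trans)+
    have zb: "dist z b \<le> L * h" "\<And>x. x \<in> closed_segment z b \<Longrightarrow> ball x c \<subseteq> \<Omega>"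
      using z(2) by (auto simp: link_def)
    have near: "dist a x \<le> real (Suc n) * L * h" if "x \<in> closed_segment z b" for x
    proof -
      have "dist z x \<le> dist z b" using dist_in_closed_segment[OF that] by (simp add: dist_commute)
      with dist_triangle[of a x z] IH(1) zb(1) show ?thesis by (simp add: algebra_simps)
    qed
    have "\<bar>derivs is w b\<bar> \<le> (1 + L * real CARD('n)) ^ (m * n) * (1 + L * real CARD('n)) ^ m * h ^ (m - length is) * M"
      if "length is \<le> m" for "is"
    proof (rule segment_step[OF Ck \<open>m \<le> k\<close> M _ L h _ IH(2) zb(1) that])
      show "1 \<le> (1 + L * real CARD('n)) ^ (m * n)" using L by (intro one_le_power) simp
      show "\<And>is x. length is = m \<Longrightarrow> x \<in> closed_segment z b \<Longrightarrow> \<bar>derivs is w x\<bar> \<le> M"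
        using Suc.prems(2) zb(2) near by blast
    qed auto
    then show ?case using near[of b] by (simp add: power_add mult_ac)
  qed
  then show ?thesis using l by blast
qed

section \<open>Deep points of large elements\<close>

lemma measure_translate:
  fixes S :: "(real^'n) set"
  assumes "S \<in> sets borel"
  shows "measure lborel ((+) c -` S) = measure lborel S"
proof -
  have "measure lborel S = measure (distr lborel borel ((+) c)) S" by (simp add: lborel_distr_plus)
  also have "\<dots> = measure lborel ((+) c -` S \<inter> space lborel)"
    by (rule measure_distr) (use assms in auto)
  finally show ?thesis by simp
qed

lemma norm_proj_le:
  fixes u n :: "'a::real_inner"
  assumes "norm n = 1"
  shows "norm (u - (u \<bullet> n) *\<^sub>R n) \<le> norm u"
proof (rule power2_le_imp_le)
  have "n \<bullet> n = 1" using assms by (simp add: norm_eq_sqrt_inner)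
  then have "(u - (u \<bullet> n) *\<^sub>R n) \<bullet> (u - (u \<bullet> n) *\<^sub>R n) = u \<bullet> u - (u \<bullet> n)\<^sup>2"
    by (simp add: inner_diff_left inner_diff_right inner_commute power2_eq_square)
  then have "(norm (u - (u \<bullet> n) *\<^sub>R n))\<^sup>2 = (norm u)\<^sup>2 - (u \<bullet> n)\<^sup>2"
    unfolding power2_norm_eq_inner .
  then show "(norm (u - (u \<bullet> n) *\<^sub>R n))\<^sup>2 \<le> (norm u)\<^sup>2" by simp
qed simp

text \<open>For a unit vector \<open>n\<close>, the orthogonal projection onto the hyperplane
  orthogonal to \<open>n\<close>; \<open>lipschitz_boundary\<close> evaluates the graph function at
  this point.\<close>

definition proj :: "real^'n \<Rightarrow> real^'n \<Rightarrow> real^'n" where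
  "proj n x = x - (x \<bullet> n) *\<^sub>R n"

lemma proj_lipschitz:
  assumes "norm n = 1" "L-lipschitz_on UNIV g"
  shows "\<bar>g (proj n x) - g (proj n y)\<bar> \<le> \<bar>L\<bar> * dist x y"
proof -
  have "\<bar>g (proj n x) - g (proj n y)\<bar> \<le> L * dist (proj n x) (proj n y)"
    using lipschitz_onD[OF assms(2), of "proj n x" "proj n y"] by (simp add: dist_real_def)
  also have "\<dots> \<le> \<bar>L\<bar> * dist (proj n x) (proj n y)" by (intro mult_right_mono) auto
  also have "dist (proj n x) (proj n y) = norm ((x - y) - ((x - y) \<bullet> n) *\<^sub>R n)"
    by (simp add: dist_norm proj_def inner_diff_left scaleR_diff_left algebra_simps)
  also have "\<bar>L\<bar> * \<dots> \<le> \<bar>L\<bar> * dist x y"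
    unfolding dist_norm by (intro mult_left_mono norm_proj_le assms) auto
  finally show ?thesis .
qed

lemma proj_translate: "norm n = 1 \<Longrightarrow> proj n (x + t *\<^sub>R n) = proj n x"
  by (simp add: proj_def inner_add_left norm_eq_1 algebra_simps)

text \<open>The translates of the slab in the direction \<open>n\<close> are disjoint, which bounds its measure
  without integration along \<open>n\<close>.\<close>

lemma slab_measure:
  fixes n a :: "real^'n"
  assumes n: "norm n = 1" and S: "S \<in> sets borel" "S \<subseteq> cube a h"
    and slab: "\<And>x. x \<in> S \<Longrightarrow> 0 < x \<bullet> n - g (proj n x) \<and> x \<bullet> n - g (proj n x) \<le> \<tau>"
    and \<tau>: "\<tau> > 0" "real J * \<tau> \<le> h" and h: "h > 0"
  shows "real J * measure lborel S \<le> 3 ^ CARD('n) * h ^ CARD('n)"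
proof -
  define S' where "S' j = (+) (- (real j * \<tau>) *\<^sub>R n) -` S" for j
  have S'm: "S' j \<in> sets lborel" for j
    unfolding S'_def using measurable_sets[of "(+) (- (real j * \<tau>) *\<^sub>R n)" borel borel S] S(1) by simp
  \<comment> \<open>The shifts have length at most \<open>real J * \<tau> \<le> h\<close>, so all
    translates lie in the cube enlarged by \<open>h\<close> on every side; hence the factor
    \<open>3 ^ CARD('n)\<close>.\<close>
  define b where "b = (\<chi> i. a $ i - h)"
  have sub: "S' j \<subseteq> cube b (3 * h)" if "j < J" for j
  proof
    fix x assume "x \<in> S' j"
    then have "x - (real j * \<tau>) *\<^sub>R n \<in> cube a h" using S(2) unfolding S'_def by auto
    moreover have "\<bar>(real j * \<tau>) * n $ i\<bar> \<le> h" for i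
    proof -
      have "\<bar>(real j * \<tau>) * n $ i\<bar> = (real j * \<tau>) * \<bar>n $ i\<bar>" using \<tau>(1) by (simp add: abs_mult)
      also have "\<dots> \<le> (real J * \<tau>) * 1"
        using \<tau>(1) that component_le_norm_cart[of n i] n by (intro mult_mono) auto
      finally show ?thesis using \<tau>(2) by simp
    qed
    ultimately show "x \<in> cube b (3 * h)"
      unfolding mem_cube b_def by (simp add: abs_le_iff) (smt (verit))
  qed
  have disj: "disjoint_family_on S' {..<J}"
  proof -
    have False if "x \<in> S' i" "x \<in> S' j" "i < j" for x i j
    proof -
      \<comment> \<open>Thus the height of a point of \<open>S' k\<close> above the graph lies in
        the half-open interval from \<open>k * \<tau>\<close>, excluded, to
        \<open>(k + 1) * \<tau>\<close>; these intervals are disjoint.\<close>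
      have "0 < (x \<bullet> n - real k * \<tau>) - g (proj n x) \<and> (x \<bullet> n - real k * \<tau>) - g (proj n x) \<le> \<tau>"
        if "x \<in> S' k" for k
      proof -
        have "x + (- (real k * \<tau>)) *\<^sub>R n \<in> S" using that by (simp add: S'_def)
        from slab[OF this] show ?thesis
          using n by (simp only: proj_translate inner_add_left) (simp add: norm_eq_1)
      qed
      from this[OF that(1)] this[OF that(2)]
      have "real j * \<tau> < real i * \<tau> + \<tau>" by linarith
      then have "real j * \<tau> < (real i + 1) * \<tau>" by (simp add: algebra_simps)
      then have "real j < real i + 1" using \<tau>(1) by simp
      then show False using \<open>i < j\<close> by simp
    qed
    then show ?thesis unfolding disjoint_family_on_def by (metis disjoint_iff linorder_neqE_nat)
  qed
  have fin: "emeasure lborel (cube b (3 * h)) < \<infinity>"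
    unfolding cube_def by (simp add: emeasure_lborel_cbox_eq)
  have "real J * measure lborel S = (\<Sum>j<J. measure lborel (S' j))"
    unfolding S'_def by (simp add: measure_translate[OF S(1)])
  also have "\<dots> = measure lborel (\<Union>j<J. S' j)"
  proof (rule measure_finite_Union[symmetric])
    show "emeasure lborel (S' j) \<noteq> \<infinity>" if "j \<in> {..<J}" for j
      using emeasure_mono[OF sub[of j], of lborel] fin that by (auto simp: top_unique less_top)
  qed (use S'm disj in auto)
  also have "\<dots> \<le> measure lborel (cube b (3 * h))"
    using fin S'm sub by (intro measure_mono_fmeasurable fmeasurableI) auto
  also have "\<dots> = 3 ^ CARD('n) * h ^ CARD('n)" using h by (simp add: measure_cube power_mult_distrib)
  finally show ?thesis .
qed

text \<open>If every point of \<open>T\<close> had a point outside \<open>\<Omega>\<close> at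
  distance less than \<open>c * h\<close>, all of \<open>T \<inter> \<Omega>\<close> would lie in a
  thin layer above the graph, and \<open>slab_measure\<close> would contradict the lower bound for
  its volume.\<close>

lemma deep_point_small:
  fixes \<Omega> :: "(real^'n) set"
  assumes \<Omega>: "open \<Omega>" and r: "r > 0" and \<gamma>: "\<gamma> > 0"
    and lip: "\<forall>z\<in>frontier \<Omega>. \<exists>n g. norm n = 1 \<and> L-lipschitz_on UNIV g \<and>
     (\<forall>x\<in>ball z r. x \<in> \<Omega> \<longleftrightarrow> g (x - (x \<bullet> n) *\<^sub>R n) < x \<bullet> n)"
  obtains c h1 where "c > 0" "h1 > 0" "\<And>h x0 T. 0 < h \<Longrightarrow> h \<le> h1 \<Longrightarrow> T \<in> mesh h x0 \<Longrightarrow>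
    \<gamma> * h ^ CARD('n) \<le> measure lborel (T \<inter> \<Omega>) \<Longrightarrow> \<exists>y\<in>T. ball y (c * h) \<subseteq> \<Omega>"
proof -
  define d where "d = real CARD('n)"
  \<comment> \<open>\<open>J\<close> disjoint copies of a set of measure
    \<open>\<gamma> * h ^ CARD('n)\<close> exceed the volume of the cube of side
    \<open>3 * h\<close>. The constant \<open>c\<close> below makes the layer so thin that
    \<open>J\<close> copies need a total shift of only \<open>h\<close>.\<close>
  obtain J :: nat where J: "real J > 3 ^ CARD('n) / \<gamma> + 1"
    using reals_Archimedean2 by blast
  have J1: "real J \<ge> 1" and J2: "3 ^ CARD('n) < real J * \<gamma>"
  proof -
    show "real J \<ge> 1" using J \<gamma> by (smt (verit) divide_nonneg_pos zero_le_power)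
    have "3 ^ CARD('n) / \<gamma> < real J" using J by linarith
    then show "3 ^ CARD('n) < real J * \<gamma>" using \<gamma> by (simp add: pos_divide_less_eq)
  qed
  define c where "c = 1 / (real J * (1 + \<bar>L\<bar>))"
  have c: "c > 0" unfolding c_def using J1 by simp
  have c1: "c \<le> 1"
  proof -
    have "1 * 1 \<le> real J * (1 + \<bar>L\<bar>)" using J1 by (intro mult_mono) auto
    then show ?thesis unfolding c_def by simp
  qed
  show ?thesis
  proof (rule that[OF c])
    \<comment> \<open>From the boundary point \<open>z\<close> to a point of \<open>T\<close> near
      it, across \<open>T\<close>, and out to a point outside \<open>\<Omega>\<close> the distance
      is less than \<open>(d + 2) * h\<close>; all of this must lie in one chart.\<close>
    show "r / (d + 3) > 0" using r by (simp add: d_def add_pos_pos)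
  next
    fix h x0 T assume h: "0 < h" "h \<le> r / (d + 3)" and T: "T \<in> mesh h x0"
      and large: "\<gamma> * h ^ CARD('n) \<le> measure lborel (T \<inter> \<Omega>)"
    have hr: "(d + 3) * h \<le> r" using h by (simp add: d_def pos_le_divide_eq mult.commute)
    show "\<exists>y\<in>T. ball y (c * h) \<subseteq> \<Omega>"
    proof (rule ccontr)
      assume "\<not> ?thesis"
      then have shallow: "\<exists>y'. dist y y' < c * h \<and> y' \<notin> \<Omega>" if "y \<in> T" for y
        using that unfolding subset_eq Ball_def mem_ball by blast
      have ch: "c * h \<le> h" using c1 h(1) by simp
      have "T \<inter> \<Omega> \<noteq> {}" using large \<gamma> h(1) by (metis measure_empty mult_pos_pos not_less zero_less_power)
      then obtain x1 where x1: "x1 \<in> T" "x1 \<in> \<Omega>" by auto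
      have "ball x1 (c * h) \<inter> frontier \<Omega> \<noteq> {}"
      proof (intro connected_Int_frontier)
        have "x1 \<in> ball x1 (c * h)" using c h(1) by simp
        then show "ball x1 (c * h) \<inter> \<Omega> \<noteq> {}" using x1(2) by blast
      qed (use shallow[OF x1(1)] in auto)
      then obtain z where z: "z \<in> frontier \<Omega>" "dist x1 z < c * h" by auto
      then obtain n g where n: "norm n = 1" and g: "L-lipschitz_on UNIV g"
        and ng: "\<And>x. dist z x < r \<Longrightarrow> x \<in> \<Omega> \<longleftrightarrow> g (proj n x) < x \<bullet> n"
        using lip unfolding proj_def by (metis mem_ball)
      obtain j where j: "T = cube (\<chi> i. x0 $ i + h * of_int (j i)) h" using T by (rule meshE)
      \<comment> \<open>Moving by less than \<open>c * h\<close> changes the height by less than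
        \<open>c * h\<close> and the graph by at most \<open>\<bar>L\<bar>\<close> times that, so a
        point of \<open>\<Omega>\<close> this close to the complement has height at most
        \<open>\<tau>\<close>.\<close>
      define \<tau> where "\<tau> = (1 + \<bar>L\<bar>) * (c * h)"
      have "real J * measure lborel (T \<inter> \<Omega>) \<le> 3 ^ CARD('n) * h ^ CARD('n)"
      proof (rule slab_measure[OF n, where g = g and \<tau> = \<tau>])
        show "T \<inter> \<Omega> \<in> sets borel" using \<Omega> unfolding j by auto
        show "T \<inter> \<Omega> \<subseteq> cube (\<chi> i. x0 $ i + h * of_int (j i)) h" unfolding j by auto
        show "\<tau> > 0" using c h by (simp add: \<tau>_def add_pos_nonneg)
        have "real J * \<tau> = h * ((real J * (1 + \<bar>L\<bar>)) * c)" by (simp add: \<tau>_def)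
        also have "(real J * (1 + \<bar>L\<bar>)) * c = 1" using J1 unfolding c_def by (simp add: add_pos_nonneg)
        finally show "real J * \<tau> \<le> h" by simp
        show "h > 0" by (rule h)
        fix x assume x: "x \<in> T \<inter> \<Omega>"
        then obtain x' where x': "dist x x' < c * h" "x' \<notin> \<Omega>" using shallow by blast
        have "dist x1 x \<le> d * h" unfolding d_def using mesh_dist_le[OF T x1(1)] x by auto
        then have "dist z x \<le> c * h + d * h" using z(2) dist_triangle[of z x x1] by (simp add: dist_commute)
        then have zx: "dist z x < r" "dist z x' < r"
          using hr[unfolded distrib_right] ch x'(1) h(1) dist_triangle[of z x' x] by linarith+
        have "g (proj n x) < x \<bullet> n" "x' \<bullet> n \<le> g (proj n x')"
          using ng[OF zx(1)] ng[OF zx(2)] x x'(2) by auto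
        moreover have "\<bar>g (proj n x) - g (proj n x')\<bar> \<le> \<bar>L\<bar> * dist x x'"
          by (rule proj_lipschitz[OF n g])
        moreover have "\<bar>L\<bar> * dist x x' \<le> \<bar>L\<bar> * (c * h)" using x'(1) by (intro mult_left_mono) auto
        moreover have "x \<bullet> n - x' \<bullet> n \<le> dist x x'"
          using Cauchy_Schwarz_ineq2[of "x - x'" n] n by (simp add: inner_diff_left dist_norm)
        ultimately show "0 < x \<bullet> n - g (proj n x) \<and> x \<bullet> n - g (proj n x) \<le> \<tau>"
          using x'(1) unfolding \<tau>_def by (simp add: algebra_simps)
      qed
      moreover have "real J * (\<gamma> * h ^ CARD('n)) \<le> real J * measure lborel (T \<inter> \<Omega>)"
        using large by (intro mult_left_mono) auto
      moreover have "3 ^ CARD('n) * h ^ CARD('n) < (real J * \<gamma>) * h ^ CARD('n)"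
        using J2 h(1) by (intro mult_strict_right_mono) auto
      ultimately show False by (simp add: mult.assoc)
    qed
  qed
qed

section \<open>Chains between deep points on fine meshes\<close>

lemma link_refl: "ball a c \<subseteq> \<Omega> \<Longrightarrow> l \<ge> 0 \<Longrightarrow> (a, a) \<in> link \<Omega> c l"
  by (auto simp: link_def)

lemma link_mono: "c' \<le> c \<Longrightarrow> l \<le> l' \<Longrightarrow> link \<Omega> c l \<subseteq> link \<Omega> c' l'"
  unfolding link_def using subset_ball by fastforce

lemma link_sym: "(a, b) \<in> link \<Omega> c l \<Longrightarrow> (b, a) \<in> link \<Omega> c l"
  by (auto simp: link_def dist_commute closed_segment_commute)

lemma relpow_mono_mem:
  fixes R :: "('a \<times> 'a) set"
  assumes "(a, b) \<in> R ^^ n" "R \<subseteq> S"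
  shows "(a, b) \<in> S ^^ n"
  using assms(1)
proof (induction n arbitrary: b)
  case (Suc n)
  then obtain y where "(a, y) \<in> R ^^ n" "(y, b) \<in> R" by auto
  then show ?case using Suc.IH[of y] assms(2) by auto
qed simp

text \<open>Trivial links at the end point lengthen a chain, so that one number of links can serve
  all pairs of points.\<close>

lemma relpow_pad: "(a, b) \<in> R ^^ n \<Longrightarrow> (b, b) \<in> R \<Longrightarrow> n \<le> k \<Longrightarrow> (a, b) \<in> R ^^ k"
proof (induction k)
  case (Suc k)
  then show ?case by (cases "n = Suc k") auto
qed auto

lemma link_within_ball: "ball a (l + c) \<subseteq> \<Omega> \<Longrightarrow> dist a b \<le> l \<Longrightarrow> (a, b) \<in> link \<Omega> c l"
proof -
  assume a: "ball a (l + c) \<subseteq> \<Omega>" "dist a b \<le> l"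
  have "ball x c \<subseteq> \<Omega>" if "x \<in> closed_segment a b" for x
  proof
    fix y assume "y \<in> ball x c"
    moreover have "dist a x \<le> l" using dist_in_closed_segment[OF that] a(2) by (simp add: dist_commute)
    ultimately have "dist a y < l + c" using dist_triangle[of a y x] by simp
    then show "y \<in> \<Omega>" using a(1) by auto
  qed
  then show ?thesis using a(2) by (auto simp: link_def)
qed

lemma connect_small:
  fixes \<Omega> :: "(real^'n) set"
  assumes r: "r > 0" and c: "c > 0" and A: "A \<ge> 0"
    and lip: "\<forall>z\<in>frontier \<Omega>. \<exists>n g. norm n = 1 \<and> L-lipschitz_on UNIV g \<and>
     (\<forall>x\<in>ball z r. x \<in> \<Omega> \<longleftrightarrow> g (x - (x \<bullet> n) *\<^sub>R n) < x \<bullet> n)"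
  obtains l h1 where "l \<ge> 0" "h1 > 0" "\<And>h a b. 0 < h \<Longrightarrow> h \<le> h1 \<Longrightarrow> ball a (c * h) \<subseteq> \<Omega> \<Longrightarrow>
    ball b (c * h) \<subseteq> \<Omega> \<Longrightarrow> dist a b \<le> A * h \<Longrightarrow> (a, b) \<in> link \<Omega> (c * h) (l * h) ^^ 3"
proof -
  \<comment> \<open>Within distance \<open>(A + c) * h\<close> of a point above the graph, the
    height over the graph can drop below zero by at most \<open>\<kappa> * h\<close>. Raising
    everything by this amount clears the graph.\<close>
  define \<kappa> where "\<kappa> = (1 + \<bar>L\<bar>) * (A + c)"
  have \<kappa>: "\<kappa> > 0" unfolding \<kappa>_def using A c by (intro mult_pos_pos) auto
  \<comment> \<open>The detour stays within \<open>H * h\<close> of the boundary point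
    \<open>z\<close>: \<open>A + c\<close> from \<open>z\<close> to \<open>a\<close>, again
    \<open>A + c\<close> to the points around the segment, and \<open>\<kappa>\<close> for the rise.
    The bound on \<open>h\<close> puts it into one chart.\<close>
  define H where "H = 2 * (A + c) + \<kappa>"
  have H: "H > 0" unfolding H_def using A c \<kappa> by simp
  show ?thesis
  proof (rule that[of "A + \<kappa>" "r / H"])
    show "A + \<kappa> \<ge> 0" "r / H > 0" using A \<kappa> r H by auto
    fix h a b assume h: "0 < h" "h \<le> r / H" and a: "ball a (c * h) \<subseteq> \<Omega>" and b: "ball b (c * h) \<subseteq> \<Omega>"
      and ab: "dist a b \<le> A * h"
    have hr: "H * h \<le> r" using h H by (simp add: pos_le_divide_eq mult.commute)
    let ?R = "link \<Omega> (c * h) ((A + \<kappa>) * h)"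
    have l: "A * h \<le> (A + \<kappa>) * h" "\<kappa> * h \<le> (A + \<kappa>) * h" "0 \<le> (A + \<kappa>) * h"
      using A \<kappa> h(1) by (auto intro!: mult_right_mono)
    show "(a, b) \<in> ?R ^^ 3"
    \<comment> \<open>Either the straight segment is deep, or the boundary is so close that one
      chart contains the whole detour.\<close>
    proof (cases "ball a (A * h + c * h) \<subseteq> \<Omega>")
      case True
      have "(a, b) \<in> ?R" using link_within_ball[OF True ab] link_mono[OF order_refl l(1)] by blast
      then have "(a, b) \<in> ?R ^^ 1" by simp
      then show ?thesis by (rule relpow_pad) (use link_refl[OF b] l in auto)
    next
      case False
      have "a \<in> \<Omega>" using a c h(1) by auto
      then have "ball a (A * h + c * h) \<inter> frontier \<Omega> \<noteq> {}"
      proof (intro connected_Int_frontier)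
        have "a \<in> ball a (A * h + c * h)" using c h(1) A by (simp add: add_nonneg_pos)
        then show "ball a (A * h + c * h) \<inter> \<Omega> \<noteq> {}" using \<open>a \<in> \<Omega>\<close> by blast
      qed (use False in auto)
      then obtain z where z: "z \<in> frontier \<Omega>" "dist a z < A * h + c * h" by auto
      then obtain n g where n: "norm n = 1" and g: "L-lipschitz_on UNIV g"
        and ng: "\<And>x. dist z x < r \<Longrightarrow> x \<in> \<Omega> \<longleftrightarrow> g (proj n x) < x \<bullet> n"
        using lip unfolding proj_def by (metis mem_ball)
      have nn: "n \<bullet> n = 1" using n by (simp add: norm_eq_1)
      have H': "H * h = (A * h + c * h) + A * h + c * h + \<kappa> * h" by (simp add: H_def algebra_simps)
      \<comment> \<open>Raising a point leaves its projection fixed and increases its height, so a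
        ball above the graph stays above it.\<close>
      have up: "(e, e + (\<kappa> * h) *\<^sub>R n) \<in> ?R" if e: "ball e (c * h) \<subseteq> \<Omega>" "dist a e \<le> A * h" for e
      proof -
        have "ball x (c * h) \<subseteq> \<Omega>" if x: "x \<in> closed_segment e (e + (\<kappa> * h) *\<^sub>R n)" for x
        proof
          fix y assume y: "y \<in> ball x (c * h)"
          obtain u where u: "0 \<le> u" "u \<le> 1" "x = (1 - u) *\<^sub>R e + u *\<^sub>R (e + (\<kappa> * h) *\<^sub>R n)"
            using x by (auto simp: in_segment)
          define t where "t = u * (\<kappa> * h)"
          have t: "0 \<le> t" "t \<le> \<kappa> * h" using u \<kappa> h(1) by (auto simp: t_def intro: mult_left_le_one_le)
          have xt: "x = e + t *\<^sub>R n" unfolding u(3) t_def by (simp add: algebra_simps)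
          define y' where "y' = y - t *\<^sub>R n"
          have yy': "y = y' + t *\<^sub>R n" by (simp add: y'_def)
          have ey': "dist e y' < c * h" using y unfolding xt y'_def by (simp add: dist_norm algebra_simps)
          then have y'\<Omega>: "y' \<in> \<Omega>" using e(1) by auto
          have "dist z y' < (A * h + c * h) + A * h + c * h"
            using z(2) e(2) ey' dist_triangle[of z y' a] dist_triangle[of a y' e] by (simp add: dist_commute)
          moreover have "dist y' y \<le> \<kappa> * h" using t n by (simp add: yy' dist_norm)
          ultimately have "dist z y' < r" "dist z y < r"
            using hr H' \<kappa> h(1) mult_pos_pos[OF \<kappa> h(1)] dist_triangle[of z y y'] by linarith+
          moreover have "proj n y = proj n y'" unfolding yy' using n by (rule proj_translate)
          moreover have "y \<bullet> n = y' \<bullet> n + t" unfolding yy' by (simp add: inner_add_left nn)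
          ultimately show "y \<in> \<Omega>" using ng[of y] ng[of y'] y'\<Omega> t by simp
        qed
        moreover have "dist e (e + (\<kappa> * h) *\<^sub>R n) = \<kappa> * h" using n \<kappa> h(1) by (simp add: dist_norm)
        ultimately show ?thesis using l by (auto simp: link_def)
      qed
      have across: "(a + (\<kappa> * h) *\<^sub>R n, b + (\<kappa> * h) *\<^sub>R n) \<in> ?R"
      proof -
        have "ball x (c * h) \<subseteq> \<Omega>" if x: "x \<in> closed_segment (a + (\<kappa> * h) *\<^sub>R n) (b + (\<kappa> * h) *\<^sub>R n)" for x
        proof
          fix y assume y: "y \<in> ball x (c * h)"
          obtain u where u: "0 \<le> u" "u \<le> 1"
            "x = (1 - u) *\<^sub>R (a + (\<kappa> * h) *\<^sub>R n) + u *\<^sub>R (b + (\<kappa> * h) *\<^sub>R n)"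
            using x by (auto simp: in_segment)
          define e where "e = (1 - u) *\<^sub>R a + u *\<^sub>R b"
          have "e \<in> closed_segment a b" using u by (auto simp: in_segment e_def)
          then have ae: "dist a e \<le> A * h" using dist_in_closed_segment[of e a b] ab by (simp add: dist_commute)
          have xe: "x = e + (\<kappa> * h) *\<^sub>R n" unfolding u(3) e_def by (simp add: algebra_simps)
          define y' where "y' = y - (\<kappa> * h) *\<^sub>R n"
          have yy': "y = y' + (\<kappa> * h) *\<^sub>R n" by (simp add: y'_def)
          have ey': "dist e y' < c * h" using y unfolding xe y'_def by (simp add: dist_norm algebra_simps)
          have ay': "dist a y' < A * h + c * h" using ae ey' dist_triangle[of a y' e] by simp
          have "dist y' y = \<kappa> * h" using \<kappa> h(1) n by (simp add: yy' dist_norm)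
          then have zy: "dist z y < r" and za: "dist z a < r"
            using ay' z(2) hr H' mult_pos_pos[OF \<kappa> h(1)] mult_pos_pos[OF c h(1)] mult_nonneg_nonneg[OF A less_imp_le[OF h(1)]]
              dist_triangle[of z y a] dist_triangle[of a y y'] by (simp_all add: dist_commute)
          have "g (proj n a) < a \<bullet> n" using ng[OF za] \<open>a \<in> \<Omega>\<close> by simp
          moreover have "\<bar>g (proj n y') - g (proj n a)\<bar> \<le> \<bar>L\<bar> * dist y' a"
            by (rule proj_lipschitz[OF n g])
          moreover have "\<bar>L\<bar> * dist y' a \<le> \<bar>L\<bar> * (A * h + c * h)"
            using ay' by (intro mult_left_mono) (auto simp: dist_commute)
          moreover have "a \<bullet> n - y' \<bullet> n \<le> dist a y'"
            using Cauchy_Schwarz_ineq2[of "a - y'" n] n by (simp add: inner_diff_left dist_norm)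
          moreover have "g (proj n y) = g (proj n y')" unfolding yy' using n by (simp only: proj_translate)
          moreover have "y \<bullet> n = y' \<bullet> n + \<kappa> * h" unfolding yy' by (simp add: inner_add_left nn)
          moreover have "\<kappa> * h = (A * h + c * h) + \<bar>L\<bar> * (A * h + c * h)" by (simp add: \<kappa>_def algebra_simps)
          ultimately have "g (proj n y) < y \<bullet> n" using ay' by linarith
          then show "y \<in> \<Omega>" using ng[OF zy] by simp
        qed
        moreover have "dist (a + (\<kappa> * h) *\<^sub>R n) (b + (\<kappa> * h) *\<^sub>R n) \<le> A * h" using ab by simp
        ultimately show ?thesis using l by (auto simp: link_def)
      qed
      have "(a, a + (\<kappa> * h) *\<^sub>R n) \<in> ?R" using up[OF a] A h(1) by simp
      moreover have "(b + (\<kappa> * h) *\<^sub>R n, b) \<in> ?R" using up[OF b ab] by (rule link_sym)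
      ultimately show ?thesis using across by (auto simp: numeral_3_eq_3)
    qed
  qed
qed

section \<open>Deep points and chains in bounded domains\<close>

lemma closed_deep: "closed {x :: 'a::metric_space. ball x \<delta> \<subseteq> \<Omega>}"
proof -
  have "{x. ball x \<delta> \<subseteq> \<Omega>} = (\<Inter>y\<in>-\<Omega>. {x. \<delta> \<le> dist x y})"
    unfolding subset_eq mem_ball by (auto simp: not_less) (meson ComplI not_less)
  then show ?thesis by (auto intro!: closed_INT closed_Collect_le continuous_intros)
qed

text \<open>Being joined by a chain of some positive clearance is an equivalence relation with open
  classes, so connectedness leaves a single class. The points of depth \<open>\<delta>\<close> form
  a compact set; a finite cover of it needs finitely many chains from one hub \<open>e\<close>, and
  these have a common clearance and a common length.\<close>

lemma connect_bounded:
  fixes \<Omega> :: "(real^'n) set"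
  assumes \<Omega>: "open \<Omega>" "connected \<Omega>" "bounded \<Omega>" and \<delta>: "\<delta> > 0"
  obtains \<delta>' n where "\<delta>' > 0" "\<And>a b. ball a \<delta> \<subseteq> \<Omega> \<Longrightarrow> ball b \<delta> \<subseteq> \<Omega> \<Longrightarrow>
    (a, b) \<in> link \<Omega> \<delta>' (diameter \<Omega>) ^^ n"
proof -
  let ?D = "diameter \<Omega>"
  have Dm: "dist a b \<le> ?D" if "a \<in> \<Omega>" "b \<in> \<Omega>" for a b
    using diameter_bounded_bound[OF \<Omega>(3)] that by blast
  have D0: "?D \<ge> 0" by (rule diameter_ge_0[OF \<Omega>(3)])
  have near: "(a, b) \<in> link \<Omega> (\<epsilon>/2) ?D" if "ball a \<epsilon> \<subseteq> \<Omega>" "dist a b < \<epsilon>/2" for a b \<epsilon>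
  proof -
    have "(a, b) \<in> link \<Omega> (\<epsilon>/2) (\<epsilon>/2)"
      using that by (intro link_within_ball) auto
    moreover have "0 < \<epsilon>" using that(2) zero_le_dist[of a b] by linarith
    then have "a \<in> \<Omega>" "b \<in> \<Omega>" using that by (auto simp: subset_eq)
    ultimately show ?thesis using Dm by (auto simp: link_def)
  qed
  \<comment> \<open>Clearance and number of links still depend on the pair; they become uniform only
    after passing to a finite cover.\<close>
  define Rc where "Rc a b \<longleftrightarrow> (\<exists>\<epsilon>>0. (a, b) \<in> (link \<Omega> \<epsilon> ?D)\<^sup>*)" for a b
  have conn: "Rc a b" if "a \<in> \<Omega>" "b \<in> \<Omega>" for a b
  proof (rule connected_equivalence_relation[OF \<Omega>(2) that])
    fix x y assume "Rc x y"
    moreover have "sym ((link \<Omega> \<epsilon> ?D)\<^sup>*)" for \<epsilon>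
      by (intro sym_rtrancl symI) (rule link_sym)
    ultimately show "Rc y x" unfolding Rc_def by (meson symD)
  next
    fix x y z assume "Rc x y" "Rc y z"
    then obtain e1 e2 where e: "e1 > 0" "(x, y) \<in> (link \<Omega> e1 ?D)\<^sup>*" "e2 > 0" "(y, z) \<in> (link \<Omega> e2 ?D)\<^sup>*"
      unfolding Rc_def by auto
    have "(x, y) \<in> (link \<Omega> (min e1 e2) ?D)\<^sup>*" "(y, z) \<in> (link \<Omega> (min e1 e2) ?D)\<^sup>*"
      using e rtrancl_mono[OF link_mono[of "min e1 e2" e1 ?D ?D \<Omega>]]
        rtrancl_mono[OF link_mono[of "min e1 e2" e2 ?D ?D \<Omega>]] by auto
    then show "Rc x z" unfolding Rc_def using e by (intro exI[of _ "min e1 e2"]) auto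
  next
    fix x assume x: "x \<in> \<Omega>"
    then obtain \<epsilon> where \<epsilon>: "\<epsilon> > 0" "ball x \<epsilon> \<subseteq> \<Omega>" using \<Omega>(1) open_contains_ball by blast
    show "\<exists>T. openin (top_of_set \<Omega>) T \<and> x \<in> T \<and> (\<forall>y\<in>T. Rc x y)"
    proof (intro exI conjI ballI)
      have "ball x (\<epsilon>/2) \<subseteq> \<Omega>" using \<epsilon> by (auto simp: subset_eq)
      then show "openin (top_of_set \<Omega>) (ball x (\<epsilon>/2))" by (simp add: open_subset)
      show "x \<in> ball x (\<epsilon>/2)" using \<epsilon> by simp
      fix y assume "y \<in> ball x (\<epsilon>/2)"
      then have "(x, y) \<in> link \<Omega> (\<epsilon>/2) ?D" using near[OF \<epsilon>(2)] by simp
      then show "Rc x y" unfolding Rc_def using \<epsilon> by (intro exI[of _ "\<epsilon>/2"]) auto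
    qed
  qed
  define K where "K = {x. ball x \<delta> \<subseteq> \<Omega>}"
  have K\<Omega>: "K \<subseteq> \<Omega>" using \<delta> by (auto simp: K_def)
  have "closed K" unfolding K_def by (rule closed_deep)
  then have K: "compact K" using bounded_subset[OF \<Omega>(3) K\<Omega>] by (simp add: compact_eq_bounded_closed)
  show ?thesis
  proof (cases "K = {}")
    case True
    then show ?thesis using that[of 1 0] by (auto simp: K_def)
  next
    case False
    then obtain e where e: "e \<in> K" by auto
    have "K \<subseteq> (\<Union>x\<in>K. ball x (\<delta>/2))" using \<delta> by auto
    then obtain F where F: "F \<subseteq> K" "finite F" "K \<subseteq> (\<Union>x\<in>F. ball x (\<delta>/2))"
      using compactE_image[OF K, of K "\<lambda>x. ball x (\<delta>/2)"] by auto
    have "\<exists>\<epsilon> n. \<epsilon> > 0 \<and> (e, x) \<in> link \<Omega> \<epsilon> ?D ^^ n" if "x \<in> F" for x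
      using conn[of e x] e F(1) K\<Omega> that unfolding Rc_def rtrancl_power by blast
    then obtain \<epsilon> n where \<epsilon>n: "\<And>x. x \<in> F \<Longrightarrow> \<epsilon> x > 0 \<and> (e, x) \<in> link \<Omega> (\<epsilon> x) ?D ^^ n x" by metis
    \<comment> \<open>\<open>\<delta>/2\<close> serves the last link, from a centre of the cover to
      a nearby point of \<open>K\<close>. The sum \<open>N\<close> dominates every chain length, and
      shorter chains are padded.\<close>
    define \<delta>' where "\<delta>' = Min (insert (\<delta>/2) (\<epsilon> ` F))"
    define N where "N = (\<Sum>x\<in>F. n x)"
    have fin: "finite (insert (\<delta>/2) (\<epsilon> ` F))" using F(2) by simp
    have \<delta>': "\<delta>' > 0" "\<delta>' \<le> \<delta>/2" "\<And>x. x \<in> F \<Longrightarrow> \<delta>' \<le> \<epsilon> x"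
    proof -
      show "\<delta>' > 0" unfolding \<delta>'_def using fin \<epsilon>n \<delta> by (subst Min_gr_iff) auto
      show "\<delta>' \<le> \<delta>/2" "\<And>x. x \<in> F \<Longrightarrow> \<delta>' \<le> \<epsilon> x"
        unfolding \<delta>'_def by (rule Min_le[OF fin], simp)+
    qed
    let ?R = "link \<Omega> \<delta>' ?D"
    have eF: "(e, x) \<in> ?R ^^ N" if "x \<in> F" for x
    proof (rule relpow_pad)
      show "(e, x) \<in> ?R ^^ n x"
        using \<epsilon>n[OF that] \<delta>'(3)[OF that] link_mono[OF _ order_refl] relpow_mono_mem by metis
      have "ball x \<delta>' \<subseteq> ball x \<delta>" using \<delta>' \<delta> by (intro subset_ball) simp
      then show "(x, x) \<in> ?R" using that F(1) D0 by (intro link_refl) (auto simp: K_def)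
      show "n x \<le> N" unfolding N_def using that F(2) by (intro member_le_sum) auto
    qed
    have eK: "(e, a) \<in> ?R ^^ (N + 1)" if aK: "a \<in> K" for a
    proof -
      obtain x where x: "x \<in> F" "dist x a < \<delta>/2" using F(3) aK by auto
      have "(x, a) \<in> link \<Omega> (\<delta>/2) ?D" using near[of x \<delta> a] x F(1) by (auto simp: K_def)
      then have "(x, a) \<in> ?R" using link_mono[OF \<delta>'(2) order_refl] by blast
      then show ?thesis using eF[OF x(1)] by auto
    qed
    have inv: "(b, a) \<in> ?R ^^ k" if "(a, b) \<in> ?R ^^ k" for a b k
      using that
    proof (induction k arbitrary: b)
      case (Suc k)
      then obtain y where "(a, y) \<in> ?R ^^ k" "(y, b) \<in> ?R" by auto
      then show ?case using Suc.IH link_sym relpow_Suc_I2 by metis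
    qed auto
    show ?thesis
    proof (rule that[OF \<delta>'(1)])
      fix a b assume "ball a \<delta> \<subseteq> \<Omega>" "ball b \<delta> \<subseteq> \<Omega>"
      then have "a \<in> K" "b \<in> K" by (simp_all add: K_def)
      then have "(a, e) \<in> ?R ^^ (N + 1)" "(e, b) \<in> ?R ^^ (N + 1)" using eK inv by blast+
      then show "(a, b) \<in> ?R ^^ ((N + 1) + (N + 1))" by (subst relpow_add) blast
    qed
  qed
qed

text \<open>Continuity of the measure from above: the sets \<open>N k\<close> of points of depth
  less than \<open>1 / Suc k\<close> decrease to the empty set because \<open>\<Omega>\<close> is
  open, and have finite measure because it is bounded. A set of measure at least \<open>e\<close>
  cannot fit into a late one.\<close>

lemma deep_set_measure:
  fixes \<Omega> :: "(real^'n) set"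
  assumes \<Omega>: "open \<Omega>" "bounded \<Omega>" and e: "e > 0"
  obtains \<delta> where "\<delta> > 0" "\<And>S. S \<subseteq> \<Omega> \<Longrightarrow> S \<in> sets borel \<Longrightarrow> e \<le> measure lborel S \<Longrightarrow> \<exists>y\<in>S. ball y \<delta> \<subseteq> \<Omega>"
proof -
  define N where "N k = \<Omega> - {x. ball x (1 / Suc k) \<subseteq> \<Omega>}" for k :: nat

  have fin: "emeasure lborel \<Omega> < \<infinity>"
    using emeasure_bounded_finite[OF \<Omega>(2)] by simp
  have Nm: "N k \<in> sets lborel" for k unfolding N_def using \<Omega>(1) closed_deep
    by (simp only: sets_lborel) (intro sets.Diff borel_open borel_closed)
  have Nf: "emeasure lborel (N k) < \<infinity>" for k
    by (rule le_less_trans[OF emeasure_mono fin]) (use \<Omega>(1) in \<open>auto simp: N_def\<close>)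
  have dec: "decseq N" unfolding decseq_Suc_iff
  proof
    fix k
    have "ball x (1 / real (Suc (Suc k))) \<subseteq> ball x (1 / real (Suc k))" for x :: "real^'n"
      by (intro subset_ball) (auto simp: field_simps)
    then show "N (Suc k) \<subseteq> N k" unfolding N_def by blast
  qed
  have "(\<Inter>k. N k) = {}"
  proof -
    have "\<exists>k. x \<notin> N k" for x
    proof (cases "x \<in> \<Omega>")
      case True
      then obtain \<epsilon> where \<epsilon>: "\<epsilon> > 0" "ball x \<epsilon> \<subseteq> \<Omega>" using \<Omega>(1) open_contains_ball by blast
      obtain k where "1 / real (Suc k) < \<epsilon>" using \<epsilon>(1) nat_approx_posE by blast
      then have "ball x (1 / Suc k) \<subseteq> \<Omega>" using \<epsilon>(2) subset_ball[of "1 / Suc k" \<epsilon> x] by auto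
      then show ?thesis unfolding N_def by blast
    qed (simp add: N_def)
    then show ?thesis by blast
  qed
  moreover have "(\<lambda>k. measure lborel (N k)) \<longlonglongrightarrow> measure lborel (\<Inter>k. N k)"
    by (rule Lim_measure_decseq) (use Nm dec Nf in \<open>auto simp: less_top\<close>)
  ultimately have "(\<lambda>k. measure lborel (N k)) \<longlonglongrightarrow> 0" by simp
  then have "eventually (\<lambda>k. measure lborel (N k) < e) sequentially"
    using e by (rule order_tendstoD)
  then obtain k where k: "measure lborel (N k) < e" by (auto simp: eventually_sequentially)
  show ?thesis
  proof (rule that[of "1 / Suc k"])
    fix S assume S: "S \<subseteq> \<Omega>" "S \<in> sets borel" "e \<le> measure lborel S"
    show "\<exists>y\<in>S. ball y (1 / Suc k) \<subseteq> \<Omega>"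
    proof (rule ccontr)
      assume "\<not> ?thesis"
      then have "S \<subseteq> N k" using S(1) by (auto simp: N_def)
      then have "measure lborel S \<le> measure lborel (N k)"
        using S(2) Nm[of k] Nf[of k] by (intro measure_mono_fmeasurable fmeasurableI) auto
      then show False using k S(3) by simp
    qed
  qed simp
qed

text \<open>\<open>H\<close> is a set of mesh sizes for which the constants are uniform; fine meshes
  and meshes of size bounded below are both brought into this form. The deep points lie in the
  interior of \<open>T\<close>, where \<open>v\<close> is one polynomial in a whole neighbourhood.
  Chains may have less clearance (\<open>c'\<close>) than their end points
  (\<open>c\<close>).\<close>

definition well_connected :: "(real^'n) set \<Rightarrow> real \<Rightarrow> real \<Rightarrow> real set \<Rightarrow> bool" where
  "well_connected \<Omega> \<gamma> A H \<longleftrightarrow> (\<exists>c c' L n. 0 < c' \<and> c' \<le> c \<and> 0 \<le> L \<and> (\<forall>h\<in>H. \<forall>x0.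
     (\<forall>T\<in>large_elems \<gamma> h x0 \<Omega>. \<exists>y\<in>interior T. ball y (c * h) \<subseteq> \<Omega>) \<and>
     (\<forall>a b. ball a (c * h) \<subseteq> \<Omega> \<longrightarrow> ball b (c * h) \<subseteq> \<Omega> \<longrightarrow> dist a b \<le> A * h \<longrightarrow>
        (a, b) \<in> link \<Omega> (c' * h) (L * h) ^^ n)))"

text \<open>A point of the closed cell is approximated from its interior; half the radius pays for
  the move.\<close>

lemma interior_deep_point:
  assumes "T \<in> mesh h (x0::real^'n)" "y \<in> T" "ball y (2 * s) \<subseteq> \<Omega>" "s > 0" "h > 0"
  obtains y' where "y' \<in> interior T" "ball y' s \<subseteq> \<Omega>"
proof -
  obtain j where j: "T = cube (\<chi> i. x0 $ i + h * of_int (j i)) h" using assms(1) by (rule meshE)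
  have "y \<in> closure (interior T)" using assms(2,5) unfolding j by (simp add: closure_interior_cube)
  then obtain y' where y': "y' \<in> interior T" "dist y' y < s" using assms(4) closure_approachable by blast
  have "ball y' s \<subseteq> ball y (2 * s)"
  proof
    fix x assume "x \<in> ball y' s"
    then show "x \<in> ball y (2 * s)" using y'(2) dist_triangle[of y x y'] by (simp add: dist_commute)
  qed
  then show ?thesis using that y'(1) assms(3) by blast
qed

lemma well_connected_small:
  fixes \<Omega> :: "(real^'n) set"
  assumes "open \<Omega>" "lipschitz_boundary \<Omega>" "\<gamma> > 0" "A \<ge> 0"
  obtains h1 where "h1 > 0" "well_connected \<Omega> \<gamma> A {0<..h1}"
proof -
  obtain r L where r: "r > 0" and lip: "\<forall>z\<in>frontier \<Omega>. \<exists>n g. norm n = 1 \<and> L-lipschitz_on UNIV g \<and>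
     (\<forall>x\<in>ball z r. x \<in> \<Omega> \<longleftrightarrow> g (x - (x \<bullet> n) *\<^sub>R n) < x \<bullet> n)"
    using assms(2) unfolding lipschitz_boundary_def by auto
  obtain c h1 where c: "c > 0" "h1 > 0" and deep: "\<And>h x0 T. 0 < h \<Longrightarrow> h \<le> h1 \<Longrightarrow> T \<in> mesh h x0 \<Longrightarrow>
    \<gamma> * h ^ CARD('n) \<le> measure lborel (T \<inter> \<Omega>) \<Longrightarrow> \<exists>y\<in>T. ball y (c * h) \<subseteq> \<Omega>"
    using deep_point_small[OF assms(1) r assms(3) lip] by blast
  have c2: "c/2 > 0" using c by simp
  obtain l h2 where l: "l \<ge> 0" "h2 > 0" and con: "\<And>h a b. 0 < h \<Longrightarrow> h \<le> h2 \<Longrightarrow> ball a (c/2 * h) \<subseteq> \<Omega> \<Longrightarrow>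
    ball b (c/2 * h) \<subseteq> \<Omega> \<Longrightarrow> dist a b \<le> A * h \<Longrightarrow> (a, b) \<in> link \<Omega> (c/2 * h) (l * h) ^^ 3"
    using connect_small[OF r c2 assms(4) lip] by blast
  have "\<exists>y\<in>interior T. ball y (c/2 * h) \<subseteq> \<Omega>"
    if h: "h \<in> {0<..min h1 h2}" and "T \<in> large_elems \<gamma> h x0 \<Omega>" for h x0 T
  proof -
    have T: "T \<in> mesh h x0" "\<gamma> * h ^ CARD('n) \<le> measure lborel (T \<inter> \<Omega>)"
      using that(2) by (auto simp: large_elems_def active_mesh_def)
    have "0 < h" "h \<le> h1" using h by auto
    from deep[OF this T] obtain y where y: "y \<in> T" "ball y (c * h) \<subseteq> \<Omega>" by blast
    have "ball y (2 * (c/2 * h)) \<subseteq> \<Omega>" "0 < c/2 * h" using y(2) c \<open>0 < h\<close> by simp_all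
    from interior_deep_point[OF T(1) y(1) this \<open>0 < h\<close>] show ?thesis by metis
  qed
  note large = this
  have "well_connected \<Omega> \<gamma> A {0<..min h1 h2}"
    unfolding well_connected_def
  proof (rule exI[of _ "c/2"], rule exI[of _ "c/2"], rule exI[of _ l], rule exI[of _ 3], intro conjI ballI allI impI)
    fix h a b assume h: "h \<in> {0<..min h1 h2}"
      and ab: "ball a (c/2 * h) \<subseteq> \<Omega>" "ball b (c/2 * h) \<subseteq> \<Omega>" "dist a b \<le> A * h"
    from h have "0 < h" "h \<le> h2" by auto
    from con[OF this ab] show "(a, b) \<in> link \<Omega> (c/2 * h) (l * h) ^^ 3" .
  qed (use c2 l large in auto)
  then show ?thesis using that[of "min h1 h2"] c l by simp
qed

lemma well_connected_bounded:
  fixes \<Omega> :: "(real^'n) set"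
  assumes "open \<Omega>" "connected \<Omega>" "bounded \<Omega>" "\<gamma> > 0" "h1 > 0"
  shows "well_connected \<Omega> \<gamma> A {h1<..h0}"
proof (cases "h1 < h0")
  case False
  then have "{h1<..h0} = {}" by auto
  then show ?thesis unfolding well_connected_def
    by (metis empty_iff order_refl zero_less_one)
next
  case True
  then have h0: "h0 > 0" using assms by simp
  have "\<gamma> * h1 ^ CARD('n) > 0" using assms by simp
  then obtain \<delta> where \<delta>: "\<delta> > 0" and deep: "\<And>S. S \<subseteq> \<Omega> \<Longrightarrow> S \<in> sets borel \<Longrightarrow>
      \<gamma> * h1 ^ CARD('n) \<le> measure lborel S \<Longrightarrow> \<exists>y\<in>S. ball y \<delta> \<subseteq> \<Omega>"
    using deep_set_measure[OF assms(1,3)] by blast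
  \<comment> \<open>For \<open>h \<le> h0\<close> this gives
    \<open>2 * (c * h) \<le> \<delta>\<close>, with the factor 2 consumed by
    \<open>interior_deep_point\<close>. For \<open>h > h1\<close>, balls of radius
    \<open>c * h\<close> contain those of radius \<open>c * h1\<close>, to which the chains are
    tuned.\<close>
  define c where "c = \<delta> / (2 * h0)"
  have c: "c > 0" using \<delta> h0 by (simp add: c_def)
  have "c * h1 > 0" using c assms by simp
  then obtain \<delta>' n where \<delta>': "\<delta>' > 0" and con: "\<And>a b. ball a (c * h1) \<subseteq> \<Omega> \<Longrightarrow> ball b (c * h1) \<subseteq> \<Omega> \<Longrightarrow>
    (a, b) \<in> link \<Omega> \<delta>' (diameter \<Omega>) ^^ n"
    using connect_bounded[OF assms(1-3)] by blast
  \<comment> \<open>On \<open>h1 < h \<le> h0\<close> the fixed clearance \<open>\<delta>'\<close>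
    is at least \<open>c' * h\<close> and the fixed length \<open>diameter \<Omega>\<close> is at
    most \<open>L * h\<close>.\<close>
  define c' where "c' = min c (\<delta>' / h0)"
  define L where "L = diameter \<Omega> / h1"
  show ?thesis unfolding well_connected_def
  proof (rule exI[of _ c], rule exI[of _ c'], rule exI[of _ L], rule exI[of _ n], intro conjI ballI allI impI)
    show "0 < c'" "c' \<le> c" using c \<delta>' h0 by (auto simp: c'_def)
    show "0 \<le> L" using diameter_ge_0[OF assms(3)] assms(5) by (simp add: L_def)
  next
    fix h x0 T assume h: "h \<in> {h1<..h0}" and T: "T \<in> large_elems \<gamma> h x0 \<Omega>"
    have T': "T \<in> mesh h x0" "\<gamma> * h ^ CARD('n) \<le> measure lborel (T \<inter> \<Omega>)"
      using T by (auto simp: large_elems_def active_mesh_def)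
    have "\<gamma> * h1 ^ CARD('n) \<le> \<gamma> * h ^ CARD('n)"
      using h assms by (intro mult_left_mono power_mono) auto
    moreover have "T \<inter> \<Omega> \<in> sets borel" using T'(1) assms(1) by (elim meshE) auto
    ultimately obtain y where y: "y \<in> T" "ball y \<delta> \<subseteq> \<Omega>"
      using deep[of "T \<inter> \<Omega>"] T'(2) by auto
    have "2 * (c * h) \<le> \<delta>" using h h0 \<delta> by (simp add: c_def pos_divide_le_eq)
    then have "ball y (2 * (c * h)) \<subseteq> \<Omega>" using y(2) subset_ball by blast
    then show "\<exists>y\<in>interior T. ball y (c * h) \<subseteq> \<Omega>"
      using interior_deep_point[OF T'(1) y(1)] c h assms(5) by (metis greaterThanAtMost_iff less_trans mult_pos_pos)
  next
    fix h a b assume h: "h \<in> {h1<..h0}" and ab: "ball a (c * h) \<subseteq> \<Omega>" "ball b (c * h) \<subseteq> \<Omega>"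
      and "dist a b \<le> A * h"
    have "c * h1 \<le> c * h" using h c by simp
    then have "ball a (c * h1) \<subseteq> \<Omega>" "ball b (c * h1) \<subseteq> \<Omega>" using ab subset_ball by blast+
    then have "(a, b) \<in> link \<Omega> \<delta>' (diameter \<Omega>) ^^ n" by (rule con)
    moreover have "c' * h \<le> \<delta>'"
    proof -
      have "c' * h \<le> (\<delta>' / h0) * h0" using h c h0 \<delta>' assms(5) by (intro mult_mono) (auto simp: c'_def)
      then show ?thesis using h0 by simp
    qed
    moreover have "diameter \<Omega> \<le> L * h"
    proof -
      have "diameter \<Omega> * 1 \<le> diameter \<Omega> * (h / h1)"
        using h assms(5) diameter_ge_0[OF assms(3)] by (intro mult_left_mono) (auto simp: field_simps)
      then show ?thesis by (simp add: L_def)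
    qed
    ultimately show "(a, b) \<in> link \<Omega> (c' * h) (L * h) ^^ n"
      using relpow_mono_mem link_mono by metis
  qed
qed

section \<open>Poincare estimate on large elements\<close>

lemma grad_norm_square: "(grad_norm m f x)\<^sup>2 = (\<Sum>is | length is = m. (derivs is f x)\<^sup>2)"
  by (simp add: grad_norm_def L2_set_def sum_nonneg)

lemma finite_multi_index: "finite {is :: 'n::finite list. length is = m}"
  using finite_lists_length_eq[of "UNIV :: 'n set" m] by simp

lemma card_multi_index: "card {is :: 'n::finite list. length is = m} = CARD('n) ^ m"
  using card_lists_length_eq[of "UNIV :: 'n set" m] by simp

lemma derivs_square_le_grad_norm:
  assumes "length is = m"
  shows "(derivs is f x)\<^sup>2 \<le> (grad_norm m f x)\<^sup>2"
  unfolding grad_norm_square using assms finite_multi_index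
  by (intro member_le_sum[of "is" _ "\<lambda>is. (derivs is f x)\<^sup>2"]) auto

lemma set_integral_square_mono:
  fixes f g :: "real^'n \<Rightarrow> real"
  assumes "continuous_on UNIV f" "set_integrable lborel \<Omega> (\<lambda>x. (g x)\<^sup>2)" "open \<Omega>"
    and "cube b s \<subseteq> \<Omega> \<inter> ball y r" "\<And>x. (f x)\<^sup>2 \<le> (g x)\<^sup>2"
  shows "(LINT z:cube b s|lborel. (f z)\<^sup>2) \<le> (LINT z:\<Omega> \<inter> ball y r|lborel. (g z)\<^sup>2)"
  unfolding set_lebesgue_integral_def
proof (rule integral_mono)
  show "integrable lborel (\<lambda>x. indicat_real (cube b s) x *\<^sub>R (f x)\<^sup>2)"
    using continuous_cube_integrable[of b s "\<lambda>x. (f x)\<^sup>2"] assms(1) continuous_on_subset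
    unfolding set_integrable_def by (auto intro!: continuous_on_power)
  have "set_integrable lborel (\<Omega> \<inter> ball y r) (\<lambda>x. (g x)\<^sup>2)"
    by (rule set_integrable_subset[OF assms(2)]) (use assms(3) in auto)
  then show "integrable lborel (\<lambda>x. indicat_real (\<Omega> \<inter> ball y r) x *\<^sub>R (g x)\<^sup>2)"
    unfolding set_integrable_def .
  fix x
  show "indicat_real (cube b s) x *\<^sub>R (f x)\<^sup>2 \<le> indicat_real (\<Omega> \<inter> ball y r) x *\<^sub>R (g x)\<^sup>2"
    using assms(4) assms(5)[of x] by (auto simp: indicator_def)
qed

lemma set_integral_square_le:
  fixes f :: "real^'n \<Rightarrow> real"
  assumes "continuous_on UNIV f" "\<And>x. x \<in> cube b s \<Longrightarrow> (f x)\<^sup>2 \<le> E" "s > 0"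
  shows "(LINT z:cube b s|lborel. (f z)\<^sup>2) \<le> s ^ CARD('n) * E"
proof -
  have "(LINT z:cube b s|lborel. (f z)\<^sup>2) \<le> (LINT z:cube b s|lborel. E)"
    using assms(2) continuous_on_subset[OF assms(1)]
    by (intro set_integral_mono continuous_cube_integrable continuous_intros) auto
  also have "\<dots> = s ^ CARD('n) * E"
    using assms(3) by (simp add: measure_cube set_lebesgue_integral_def)
  finally show ?thesis .
qed

text \<open>The polynomial \<open>t\<close> depends on \<open>T0\<close> only and serves all large
  elements \<open>T1\<close> nearby. The polynomial \<open>q\<close> of \<open>v\<close> on
  \<open>T1\<close> is compared with \<open>t\<close> at a point \<open>x\<close> that may lie
  outside \<open>T1\<close>: \<open>A\<close> measures the distance of the elements,
  \<open>B\<close> the extrapolation. The additional \<open>2 * CARD('n)\<close> in the assumption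
  leads from \<open>a\<close> and \<open>b\<close> to the deep points of their elements.\<close>

lemma poincare_large:
  fixes \<Omega> :: "(real^'n) set"
  assumes wc: "well_connected \<Omega> \<gamma> (A + 2 * real CARD('n)) H" and H: "H \<subseteq> {0<..}" and \<Omega>: "open \<Omega>"
    and "m \<le> k" and B: "B \<ge> 0"
  obtains C R where "C > 0" "R \<ge> 0"
    "\<And>h x0 v T0. h \<in> H \<Longrightarrow> Ck k v \<Longrightarrow> \<forall>T\<in>mesh h x0. v \<in> Qpoly_on p T \<Longrightarrow>
      set_integrable lborel \<Omega> (\<lambda>x. (grad_norm m v x)\<^sup>2) \<Longrightarrow> T0 \<in> large_elems \<gamma> h x0 \<Omega> \<Longrightarrow>
      \<exists>y t. y \<in> T0 \<and> t \<in> Qpoly p \<and> (\<forall>is. length is = m \<longrightarrow> derivs is t = (\<lambda>x. 0)) \<and>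
        (\<forall>T1\<in>large_elems \<gamma> h x0 \<Omega>. \<forall>q\<in>Qpoly p. \<forall>x a b. (\<forall>x\<in>T1. v x = q x) \<longrightarrow>
           a \<in> T0 \<longrightarrow> b \<in> T1 \<longrightarrow> dist a b \<le> A * h \<longrightarrow> dist x b \<le> B * h \<longrightarrow>
           (q x - t x)\<^sup>2 \<le> C * h ^ (2 * m) / h ^ CARD('n) *
              (LINT z:\<Omega> \<inter> ball y (R * h)|lborel. (grad_norm m v z)\<^sup>2))"
proof -
  define d where "d = real CARD('n)"
  obtain c c' L n where c: "0 < c'" "c' \<le> c" and L: "0 \<le> L"
    and deep: "\<And>h x0 T. h \<in> H \<Longrightarrow> T \<in> large_elems \<gamma> h x0 \<Omega> \<Longrightarrow> \<exists>y\<in>interior T. ball y (c * h) \<subseteq> \<Omega>"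
    and conn: "\<And>h a b. h \<in> H \<Longrightarrow> ball a (c * h) \<subseteq> \<Omega> \<Longrightarrow> ball b (c * h) \<subseteq> \<Omega> \<Longrightarrow>
        dist a b \<le> (A + 2 * d) * h \<Longrightarrow> (a, b) \<in> link \<Omega> (c' * h) (L * h) ^^ n"
    using wc unfolding well_connected_def d_def by blast
  \<comment> \<open>With \<open>e\<close> half of \<open>c'\<close>, a ball of radius
    \<open>2 * e * h\<close> around the deep point \<open>y1\<close> of \<open>T1\<close> lies in
    \<open>\<Omega>\<close>. Every point within \<open>e * h\<close> of \<open>y1\<close> is then
    one more link away, a link whose length \<open>L1\<close> admits.\<close>
  define L1 where "L1 = max L c'"
  define e where "e = c' / 2"
  have e: "e > 0" using c by (simp add: e_def)
  have L1: "L1 \<ge> 0" "L \<le> L1" "e \<le> L1" using L c by (auto simp: L1_def e_def)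
  obtain Cd where Cd: "Cd > 0" and deepb: "\<And>h (x0::real^'n) k v x is. h > 0 \<Longrightarrow> Ck k v \<Longrightarrow>
    (\<forall>T\<in>mesh h x0. v \<in> Qpoly_on p T) \<Longrightarrow> length is \<le> k \<Longrightarrow> \<exists>b s. cube b s \<subseteq> ball x (e * h) \<and> 
      (derivs is v x)\<^sup>2 \<le> Cd / h ^ CARD('n) * (LINT z:cube b s|lborel. (derivs is v z)\<^sup>2)"
    using deep_bound[OF e, where ?'n = 'n and p = p] by blast
  \<comment> \<open>A subcube of \<open>T1\<close> at \<open>y1\<close> with side
    \<open>\<sigma> * h\<close> stays within \<open>e * h\<close> of \<open>y1\<close>, where
    \<open>w\<close> will be bounded.\<close>
  define \<sigma> where "\<sigma> = min (1/2) (e / (2 * d))"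
  have d1: "d \<ge> 1" by (simp add: d_def Suc_le_eq)
  have \<sigma>: "\<sigma> > 0" "\<sigma> \<le> 1/2" using e d1 by (auto simp: \<sigma>_def)
  have \<sigma>2: "d * \<sigma> < e"
  proof -
    have "d * \<sigma> \<le> d * (e / (2 * d))" using d1 by (intro mult_left_mono) (auto simp: \<sigma>_def)
    then show ?thesis using d1 e by simp
  qed
  \<comment> \<open>The distance from \<open>x\<close> to the corner of that subcube is at most
    \<open>(B + d) * h\<close>, expressed in units of its side \<open>\<sigma> * h\<close>.\<close>
  define lam where "lam = (B + d) / \<sigma>"
  have lam: "lam \<ge> 0" using B d1 \<sigma> by (simp add: lam_def)
  obtain Ci where Ci: "Ci > 0" "\<And>(q::real^'n\<Rightarrow>real) y s is x. q \<in> Qpoly p \<Longrightarrow> s > 0 \<Longrightarrow> length is \<le> 0 \<Longrightarrow>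
      (\<And>i. \<bar>x $ i - y $ i\<bar> \<le> lam * s) \<Longrightarrow>
      (derivs is q x)\<^sup>2 \<le> Ci / s ^ (2 * length is + CARD('n)) * (LINT z:cube y s|lborel. (q z)\<^sup>2)"
    using inverse_estimate[OF lam, where ?'n = 'n and p = p and m = 0] by blast
  \<comment> \<open>\<open>Suc n\<close> counts the \<open>n\<close> links from \<open>y\<close> to
    \<open>y1\<close> and the last one to a point near \<open>y1\<close>. In \<open>R\<close> the
    radius \<open>e\<close> is added for the cubes supplied by \<open>deep_bound\<close>.\<close>
  define K where "K = (1 + L1 * d) ^ (m * Suc n)"
  define R where "R = real (Suc n) * L1 + e"
  have "K > 0" unfolding K_def using L1 d1 by (intro zero_less_power add_pos_nonneg) auto
  show ?thesis
  proof (rule that[of "Ci * K\<^sup>2 * Cd" R])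
    show "Ci * K\<^sup>2 * Cd > 0" using Ci(1) \<open>K > 0\<close> Cd by simp
    show "R \<ge> 0" unfolding R_def using L1 e by simp
  next
    fix h x0 v T0 assume hH: "h \<in> H" and Ck: "Ck k v" and Q: "\<forall>T\<in>mesh h x0. v \<in> Qpoly_on p T"
      and int: "set_integrable lborel \<Omega> (\<lambda>x. (grad_norm m v x)\<^sup>2)" and T0: "T0 \<in> large_elems \<gamma> h x0 \<Omega>"
    have h: "h > 0" using hH H by auto
    have meshI: "T \<in> mesh h x0" if "T \<in> large_elems \<gamma> h x0 \<Omega>" for T
      using that by (auto simp: large_elems_def active_mesh_def)
    obtain y where y: "y \<in> interior T0" "ball y (c * h) \<subseteq> \<Omega>" using deep[OF hH T0] by blast
    obtain q0 where q0: "q0 \<in> Qpoly p" "\<And>x. x \<in> T0 \<Longrightarrow> v x = q0 x"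
      using Q meshI[OF T0] unfolding Qpoly_on_def by auto
    obtain t where t: "t \<in> Qpoly p" "\<And>is. length is = m \<Longrightarrow> derivs is t = (\<lambda>x. 0)"
      "\<And>is. length is < m \<Longrightarrow> derivs is (\<lambda>x. q0 x - t x) y = 0"
      using Qpoly_taylor[OF q0(1)] by blast
    define w where "w x = v x - t x" for x
    have Ckw: "Ck k w" unfolding w_def using Ck_diff[OF Ck Qpoly_Ck[OF t(1)]] .
    \<comment> \<open>\<open>t\<close> has no derivatives of order \<open>m\<close>, so the top
      order data of \<open>w\<close> are those of \<open>v\<close>.\<close>
    have wm: "derivs is w = derivs is v" if "length is = m" for "is"
      using derivs_diff[OF Ck Qpoly_Ck[OF t(1)], of "is"] t(2) that \<open>m \<le> k\<close> unfolding w_def by simp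
    \<comment> \<open>As \<open>y\<close> is interior to \<open>T0\<close>, \<open>w\<close> agrees
      with \<open>q0 - t\<close> near \<open>y\<close>, and its lower order derivatives vanish
      there.\<close>
    have w0: "derivs is w y = 0" if "length is < m" for "is"
      using derivs_cong_open[OF open_interior, of T0 w "\<lambda>x. q0 x - t x" y "is"] q0(2) interior_subset[of T0] y(1) t(3)[OF that]
      by (auto simp: w_def)
    define G where "G = (LINT z:\<Omega> \<inter> ball y (R * h)|lborel. (grad_norm m v z)\<^sup>2)"
    have G: "G \<ge> 0" unfolding G_def set_lebesgue_integral_def by (rule integral_nonneg_AE) simp
    define M where "M = sqrt (Cd / h ^ CARD('n) * G)"
    have M: "M \<ge> 0" "M\<^sup>2 = Cd / h ^ CARD('n) * G" using G Cd h by (auto simp: M_def)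
    have top: "\<bar>derivs is w x\<bar> \<le> M"
      if l: "length is = m" and x: "ball x (e * h) \<subseteq> \<Omega>" "dist y x \<le> real (Suc n) * L1 * h" for "is" x
    proof -
      obtain b s where bs: "cube b s \<subseteq> ball x (e * h)"
        "(derivs is v x)\<^sup>2 \<le> Cd / h ^ CARD('n) * (LINT z:cube b s|lborel. (derivs is v z)\<^sup>2)"
        using deepb[OF h Ck Q, of "is" x] l \<open>m \<le> k\<close> by auto
      have "ball x (e * h) \<subseteq> ball y (R * h)"
      proof
        fix z assume "z \<in> ball x (e * h)"
        then have "dist y z < real (Suc n) * L1 * h + e * h" using x(2) dist_triangle[of y z x] by simp
        then show "z \<in> ball y (R * h)" by (simp add: R_def algebra_simps)
      qed
      then have sub: "cube b s \<subseteq> \<Omega> \<inter> ball y (R * h)" using bs(1) x(1) by blast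
      have "(LINT z:cube b s|lborel. (derivs is v z)\<^sup>2) \<le> G"
        unfolding G_def using Ck_derivs_continuous[OF Ck] l \<open>m \<le> k\<close>
        by (intro set_integral_square_mono[OF _ int \<Omega> sub] derivs_square_le_grad_norm) auto
      then have "Cd / h ^ CARD('n) * (LINT z:cube b s|lborel. (derivs is v z)\<^sup>2) \<le> M\<^sup>2"
        unfolding M(2) using Cd h by (intro mult_left_mono) auto
      with bs(2) have "(derivs is v x)\<^sup>2 \<le> M\<^sup>2" by linarith
      then show ?thesis using M(1) wm[OF l] by (simp add: abs_le_square_iff[symmetric])
    qed
    have "(q x - t x)\<^sup>2 \<le> Ci * K\<^sup>2 * Cd * h ^ (2 * m) / h ^ CARD('n) * G"
      if T1: "T1 \<in> large_elems \<gamma> h x0 \<Omega>" and q: "q \<in> Qpoly p" "\<forall>x\<in>T1. v x = q x"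
        and ab: "a \<in> T0" "b \<in> T1" "dist a b \<le> A * h" and xb: "dist x b \<le> B * h" for T1 q x a b
    proof -
      obtain y1 where y1: "y1 \<in> interior T1" "ball y1 (c * h) \<subseteq> \<Omega>" using deep[OF hH T1] by blast
      have y1T: "y1 \<in> T1" "y \<in> T0" using y1(1) y(1) interior_subset by auto
      have "dist y y1 \<le> dist y a + dist a b + dist b y1"
        using dist_triangle[of y y1 a] dist_triangle[of a y1 b] by simp
      also have "\<dots> \<le> d * h + A * h + d * h"
        using mesh_dist_le[OF meshI[OF T0] y1T(2) ab(1)] mesh_dist_le[OF meshI[OF T1] ab(2) y1T(1)] ab(3)
        unfolding d_def by linarith
      finally have "dist y y1 \<le> (A + 2 * d) * h" by (simp add: algebra_simps)
      then have "(y, y1) \<in> link \<Omega> (c' * h) (L * h) ^^ n" by (rule conn[OF hH y(2) y1(2)])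
      moreover have "link \<Omega> (c' * h) (L * h) \<subseteq> link \<Omega> (e * h) (L1 * h)"
        using h c L1 by (intro link_mono mult_right_mono) (auto simp: e_def)
      ultimately have ch: "(y, y1) \<in> link \<Omega> (e * h) (L1 * h) ^^ n" by (rule relpow_mono_mem)
      have ye: "ball y (e * h) \<subseteq> \<Omega>"
      proof -
        have "e * h \<le> c * h" using c h by (simp add: e_def)
        then show ?thesis using y(2) subset_ball[of "e * h" "c * h" y] by blast
      qed
      have wb: "\<bar>w z\<bar> \<le> K * h ^ m * M" if z: "dist y1 z \<le> e * h" for z
      proof -
        have "ball y1 (e * h + e * h) \<subseteq> \<Omega>"
        proof -
          have "e * h + e * h \<le> c * h" using c h by (simp add: e_def algebra_simps)
          then show ?thesis using y1(2) subset_ball[of "e * h + e * h" "c * h" y1] by blast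
        qed
        then have "(y1, z) \<in> link \<Omega> (e * h) (e * h)" using z by (rule link_within_ball)
        moreover have "e * h \<le> L1 * h" using L1 h by simp
        ultimately have "(y1, z) \<in> link \<Omega> (e * h) (L1 * h)" using link_mono[OF order_refl] by blast
        then have "(y, z) \<in> link \<Omega> (e * h) (L1 * h) ^^ Suc n" using ch by auto
        from chain_bound[OF Ckw \<open>m \<le> k\<close> M(1) L1(1) h top w0 ye this, of "[]"]
        show ?thesis by (simp add: K_def d_def)
      qed
      define s where "s = \<sigma> * h"
      have s: "s > 0" "s \<le> h / 2" using \<sigma> h by (auto simp: s_def)
      obtain j where j: "T1 = cube (\<chi> i. x0 $ i + h * of_int (j i)) h" using meshI[OF T1] by (rule meshE)
      obtain b' where b': "y1 \<in> cube b' s" "cube b' s \<subseteq> T1"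
        using subcube[OF y1T(1)[unfolded j] s] unfolding j by blast
      have qw: "(q z - t z)\<^sup>2 \<le> (K * h ^ m * M)\<^sup>2" if z: "z \<in> cube b' s" for z
      proof -
        have "dist y1 z \<le> d * s" unfolding d_def
        proof (rule dist_cube_le)
          fix i
          have "b' $ i \<le> z $ i" "z $ i \<le> b' $ i + s" "b' $ i \<le> y1 $ i" "y1 $ i \<le> b' $ i + s"
            using z b'(1) by (auto simp: mem_cube)
          then show "\<bar>y1 $ i - z $ i\<bar> \<le> s" by linarith
        qed
        also have "\<dots> = (d * \<sigma>) * h" by (simp add: s_def)
        also have "\<dots> \<le> e * h" using \<sigma>2 h by simp
        finally have "\<bar>w z\<bar> \<le> K * h ^ m * M" by (rule wb)
        moreover have "w z = q z - t z" using q(2) b'(2) z by (auto simp: w_def)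
        ultimately have "\<bar>q z - t z\<bar> \<le> \<bar>K * h ^ m * M\<bar>" by simp
        then show ?thesis by (simp only: abs_le_square_iff)
      qed
      have b'T: "b' \<in> T1" using b'(2) s(1) by (auto simp: mem_cube subset_eq)
      have xb': "\<bar>x $ i - b' $ i\<bar> \<le> lam * s" for i
      proof -
        have "\<bar>x $ i - b' $ i\<bar> \<le> dist x b'"
          using component_le_norm_cart[of "x - b'" i] by (simp add: dist_norm)
        also have "\<dots> \<le> B * h + d * h"
          using xb mesh_dist_le[OF meshI[OF T1] ab(2) b'T] dist_triangle[of x b' b] by (simp add: d_def)
        also have "\<dots> = lam * s" using \<sigma>(1) by (simp add: lam_def s_def field_simps)
        finally show ?thesis .
      qed
      have qt: "(\<lambda>x. q x - t x) \<in> Qpoly p" using q(1) t(1) by (rule Qpoly_diff)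
      from Ci(2)[OF qt s(1) _ xb', of "[]"]
      have "(q x - t x)\<^sup>2 \<le> Ci / s ^ CARD('n) * (LINT z:cube b' s|lborel. (q z - t z)\<^sup>2)" by simp
      also have "\<dots> \<le> Ci / s ^ CARD('n) * (s ^ CARD('n) * (K * h ^ m * M)\<^sup>2)"
        using Ci(1) s(1) qw
        by (intro mult_left_mono set_integral_square_le[where f = "\<lambda>z. q z - t z"] Qpoly_continuous[OF qt]) auto
      also have "\<dots> = Ci * K\<^sup>2 * h ^ (2 * m) * M\<^sup>2"
        using s(1) by (simp add: power_mult_distrib power_mult mult.commute[of 2 m])
      also have "\<dots> = Ci * K\<^sup>2 * Cd * h ^ (2 * m) / h ^ CARD('n) * G"
        unfolding M(2) by (simp add: mult_ac)
      finally show ?thesis .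
    qed
    then show "\<exists>y t. y \<in> T0 \<and> t \<in> Qpoly p \<and> (\<forall>is. length is = m \<longrightarrow> derivs is t = (\<lambda>x. 0)) \<and>
        (\<forall>T1\<in>large_elems \<gamma> h x0 \<Omega>. \<forall>q\<in>Qpoly p. \<forall>x a b. (\<forall>x\<in>T1. v x = q x) \<longrightarrow>
           a \<in> T0 \<longrightarrow> b \<in> T1 \<longrightarrow> dist a b \<le> A * h \<longrightarrow> dist x b \<le> B * h \<longrightarrow>
           (q x - t x)\<^sup>2 \<le> Ci * K\<^sup>2 * Cd * h ^ (2 * m) / h ^ CARD('n) *
              (LINT z:\<Omega> \<inter> ball y (R * h)|lborel. (grad_norm m v z)\<^sup>2))"
      using y(1) interior_subset[of T0] t(1,2) unfolding G_def by blast
  qed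
qed

section \<open>The interpolation operator on an element\<close>

text \<open>A polynomial that vanishes near one point of the cell vanishes on a small cube, hence
  identically. Consequently the basis functions that are nonzero somewhere on a cell are among those
  whose support contains the cell, and pointwise sums become sums over one finite set per
  cell.\<close>

lemma supp_cell:
  assumes h: "h > 0" and T: "T \<in> mesh h (x0::real^'n)" and f: "f \<in> Qpoly_on p T" and x: "x \<in> T" "f x \<noteq> 0"
  shows "T \<subseteq> supp f"
proof
  fix y assume y: "y \<in> T"
  obtain j where j: "T = cube (\<chi> i. x0 $ i + h * of_int (j i)) h" using T by (rule meshE)
  obtain q where q: "q \<in> Qpoly p" "\<And>x. x \<in> T \<Longrightarrow> f x = q x" using f unfolding Qpoly_on_def by auto
  show "y \<in> supp f"
  proof (rule ccontr)
    assume "y \<notin> supp f"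
    then obtain e where e: "e > 0" "ball y e \<subseteq> - supp f"
      using open_contains_ball[of "- supp f"] by (auto simp: supp_def)
    define s where "s = min (h/2) (e / (2 * real CARD('n)))"
    have s: "s > 0" "s \<le> h/2" using h e by (auto simp: s_def)
    have "real CARD('n) * s \<le> real CARD('n) * (e / (2 * real CARD('n)))"
      by (intro mult_left_mono) (auto simp: s_def)
    then have s2: "real CARD('n) * s < e" using e by simp
    obtain b where b: "y \<in> cube b s" "cube b s \<subseteq> T" using subcube[OF y[unfolded j] s] unfolding j by blast
    have "q z = 0" if z: "z \<in> cube b s" for z
    proof -
      have "dist y z \<le> real CARD('n) * s"
      proof (rule dist_cube_le)
        fix i
        have "b $ i \<le> z $ i" "z $ i \<le> b $ i + s" "b $ i \<le> y $ i" "y $ i \<le> b $ i + s"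
          using z b(1) by (auto simp: mem_cube)
        then show "\<bar>y $ i - z $ i\<bar> \<le> s" by linarith
      qed
      then have "z \<in> ball y e" using s2 by simp
      then have "z \<notin> supp f" using e(2) by blast
      then have "f z = 0" unfolding supp_def using closure_subset[of "{x. f x \<noteq> 0}"] by blast
      then show ?thesis using q(2)[of z] b(2) z by auto
    qed
    then have "q = (\<lambda>x. 0)" by (rule Qpoly_zero_on_cube[OF q(1) s(1)])
    then show False using q(2)[OF x(1)] x(2) by simp
  qed
qed

lemma Qpoly_eq_on_mesh:
  assumes "h > 0" "T \<in> mesh h (x0::real^'n)" "q \<in> Qpoly p" "r \<in> Qpoly p" "\<And>x. x \<in> T \<Longrightarrow> q x = r x"
  shows "q = r"
proof -
  obtain j where j: "T = cube (\<chi> i. x0 $ i + h * of_int (j i)) h" using assms(2) by (rule meshE)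
  have "(\<lambda>x. q x - r x) = (\<lambda>x. 0)"
    by (rule Qpoly_zero_on_cube[OF Qpoly_diff[OF assms(3,4)] assms(1)]) (use assms(5) j in auto)
  then show ?thesis by (simp add: fun_eq_iff)
qed

lemma poly_ext_eq:
  assumes "h > 0" "T \<in> mesh h (x0::real^'n)" "q \<in> Qpoly p" "\<And>x. x \<in> T \<Longrightarrow> v x = q x"
  shows "poly_ext p T v = q"
  unfolding poly_ext_def
proof (rule the_equality)
  fix r assume "r \<in> Qpoly p \<and> (\<forall>x\<in>T. v x = r x)"
  then show "r = q" using assms by (intro Qpoly_eq_on_mesh[OF assms(1,2)]) auto
qed (use assms in auto)

lemma Qpoly_square_integral_zero:
  assumes "q \<in> Qpoly p" "s > 0" "(LINT x:cube y s|lborel. (q x)\<^sup>2) = 0"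
  shows "q = (\<lambda>x. 0)"
proof -
  obtain C where "C > 0" and C: "\<And>(q::real^'a\<Rightarrow>real) y s is x. q \<in> Qpoly p \<Longrightarrow> s > 0 \<Longrightarrow> length is \<le> 0 \<Longrightarrow>
      (\<And>i. \<bar>x $ i - y $ i\<bar> \<le> 1 * s) \<Longrightarrow>
      (derivs is q x)\<^sup>2 \<le> C / s ^ (2 * length is + CARD('a)) * (LINT z:cube y s|lborel. (q z)\<^sup>2)"
    using inverse_estimate[OF zero_le_one, where ?'n = 'a and p = p and m = 0] by blast
  have "q x = 0" if "x \<in> cube y s" for x
  proof -
    have "\<bar>x $ i - y $ i\<bar> \<le> 1 * s" for i
    proof -
      have "y $ i \<le> x $ i" "x $ i \<le> y $ i + s" using that by (auto simp: mem_cube)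
      then show ?thesis by linarith
    qed
    from C[OF assms(1,2) _ this, of "[]"] show ?thesis using assms(3) by simp
  qed
  then show ?thesis by (rule Qpoly_zero_on_cube[OF assms(1,2)])
qed

text \<open>Without a condition on the faces \<open>f\<close> need not be Borel measurable, and the integrals in
  \<open>L2proj\<close> would be junk.\<close>

lemma L2proj_eq:
  assumes s: "s > 0" and q: "q \<in> Qpoly p"
    and f: "\<And>x. x \<in> interior (cube a s) \<Longrightarrow> f x = q x"
      "\<And>x. x \<in> cube a s \<Longrightarrow> x \<notin> interior (cube a s) \<Longrightarrow> f x = 0"
  shows "L2proj p (cube a s) f = q"
proof -
  let ?K = "cube a s"
  have AE: "AE x in lborel. x \<in> ?K \<longrightarrow> x \<in> interior ?K"
  proof -
    have "?K - interior ?K \<in> null_sets lborel"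
      using cube_boundary_null by (auto simp: null_sets_def)
    then have "AE x in lborel. x \<notin> ?K - interior ?K" by (rule AE_not_in)
    then show ?thesis by eventually_elim auto
  qed
  have meas: "r \<in> borel_measurable borel" if "r \<in> Qpoly p" for r :: "real^'a \<Rightarrow> real"
    using Qpoly_continuous[OF that] by (rule borel_measurable_continuous_onI)
  have eq: "(LINT x:?K|lborel. (f x - u x) * r x) = (LINT x:?K|lborel. (q x - u x) * r x)"
    if u: "u \<in> Qpoly p" and r: "r \<in> Qpoly p" for u r
    unfolding set_lebesgue_integral_def
  proof (rule integral_cong_AE)
    have "(\<lambda>x. indicat_real ?K x *\<^sub>R ((f x - u x) * r x)) =
      (\<lambda>x. (indicat_real (interior ?K) x * q x - indicat_real ?K x * u x) * r x)"
      using f interior_subset[of ?K] by (auto simp: fun_eq_iff indicator_def)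
    then show "(\<lambda>x. indicat_real ?K x *\<^sub>R ((f x - u x) * r x)) \<in> borel_measurable lborel"
      using meas[OF u] meas[OF r] meas[OF q] by simp
    show "(\<lambda>x. indicat_real ?K x *\<^sub>R ((q x - u x) * r x)) \<in> borel_measurable lborel"
      using meas[OF u] meas[OF r] meas[OF q] by simp
    show "AE x in lborel. indicat_real ?K x *\<^sub>R ((f x - u x) * r x) = indicat_real ?K x *\<^sub>R ((q x - u x) * r x)"
      using AE by eventually_elim (auto simp: indicator_def f(1))
  qed
  show ?thesis unfolding L2proj_def
  proof (rule the_equality)
    show "q \<in> Qpoly p \<and> (\<forall>r\<in>Qpoly p. (LINT x:?K|lborel. (f x - q x) * r x) = 0)"
      using q eq[OF q] by (simp add: set_lebesgue_integral_def)
  next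
    fix u assume u: "u \<in> Qpoly p \<and> (\<forall>r\<in>Qpoly p. (LINT x:?K|lborel. (f x - u x) * r x) = 0)"
    have qu: "(\<lambda>x. q x - u x) \<in> Qpoly p" using q u by (intro Qpoly_diff) auto
    then have "(LINT x:?K|lborel. (q x - u x)\<^sup>2) = 0"
      using eq[of u "\<lambda>x. q x - u x"] u by (simp add: power2_eq_square)
    then have "(\<lambda>x. q x - u x) = (\<lambda>x. 0)" by (rule Qpoly_square_integral_zero[OF qu s])
    then show "u = q" by (simp add: fun_eq_iff)
  qed
qed

lemma L2norm_square: "(L2norm S f)\<^sup>2 = (LINT x:S|lborel. (f x)\<^sup>2)"
  unfolding L2norm_def set_lebesgue_integral_def
  by (rule real_sqrt_pow2) (rule integral_nonneg_AE, simp)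

text \<open>This gives meaning to the \<open>THE\<close> in \<open>local_coeff\<close>; setting the
  coefficients to 0 outside \<open>F\<close> makes the function unique.\<close>

lemma basis_unique_coeff:
  assumes b: "basis_on T W F \<phi>" and F: "finite F" and u: "u \<in> W" and T: "\<And>x. x \<in> T \<Longrightarrow> P x = u x"
  shows "\<exists>!c. (\<forall>i. i \<notin> F \<longrightarrow> c i = 0) \<and> (\<forall>x\<in>T. P x = (\<Sum>i\<in>F. c i * \<phi> i x))"
proof -
  have lin: "lincomb F \<phi> c x = (\<Sum>i\<in>F. c i * \<phi> i x)" for c x
    unfolding lincomb_def by (rule sum.mono_neutral_left) (use F in auto)
  obtain c where c: "\<forall>x\<in>T. u x = (\<Sum>i\<in>F. c i * \<phi> i x)"
    using b u unfolding basis_on_def lin by blast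
  show ?thesis
  proof (rule ex1I[of _ "\<lambda>i. if i \<in> F then c i else 0"])
    show "(\<forall>i. i \<notin> F \<longrightarrow> (if i \<in> F then c i else 0) = 0) \<and>
        (\<forall>x\<in>T. P x = (\<Sum>i\<in>F. (if i \<in> F then c i else 0) * \<phi> i x))"
      using c T by simp
  next
    fix e assume e: "(\<forall>i. i \<notin> F \<longrightarrow> e i = 0) \<and> (\<forall>x\<in>T. P x = (\<Sum>i\<in>F. e i * \<phi> i x))"
    have "\<forall>x\<in>T. lincomb F \<phi> (\<lambda>i. e i - c i) x = 0"
      using c e T unfolding lin by (auto simp: left_diff_distrib sum_subtractf)
    then have "\<forall>i\<in>F. e i - c i = 0"
      using b unfolding basis_on_def by blast
    then show "e = (\<lambda>i. if i \<in> F then c i else 0)" using e by (auto simp: fun_eq_iff)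
  qed
qed

text \<open>Jensen's inequality for the square, from nonnegativity of the weighted variance around
  the mean \<open>s\<close>; afterwards the weights are bounded by 1.\<close>

lemma weighted_mean_square_le:
  fixes \<kappa> a :: "'t \<Rightarrow> real"
  assumes "\<And>T. T \<in> F \<Longrightarrow> 0 \<le> \<kappa> T \<and> \<kappa> T \<le> 1" "sum \<kappa> F = 1"
  shows "(\<Sum>T\<in>F. \<kappa> T * a T)\<^sup>2 \<le> (\<Sum>T\<in>F. (a T)\<^sup>2)"
proof -
  define s where "s = (\<Sum>T\<in>F. \<kappa> T * a T)"
  have "0 \<le> (\<Sum>T\<in>F. \<kappa> T * (a T - s)\<^sup>2)" using assms(1) by (intro sum_nonneg) auto
  also have "\<dots> = (\<Sum>T\<in>F. \<kappa> T * (a T)\<^sup>2) - 2 * s * (\<Sum>T\<in>F. \<kappa> T * a T) + s\<^sup>2 * sum \<kappa> F"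
    by (simp add: sum_distrib_left sum_subtractf[symmetric] sum.distrib[symmetric])
      (intro sum.cong, auto simp: power2_eq_square algebra_simps)
  also have "\<dots> = (\<Sum>T\<in>F. \<kappa> T * (a T)\<^sup>2) - s\<^sup>2"
    using assms(2) by (simp add: s_def power2_eq_square)
  finally have "s\<^sup>2 \<le> (\<Sum>T\<in>F. \<kappa> T * (a T)\<^sup>2)" by simp
  also have "\<dots> \<le> (\<Sum>T\<in>F. (a T)\<^sup>2)"
    using assms(1) by (intro sum_mono) (simp add: mult_left_le_one_le)
  finally show ?thesis by (simp add: s_def)
qed

text \<open>Because the weights sum to 1, each coefficient of the interpolant differs from that of
  \<open>t\<close> by a weighted mean of the local deviations. Stability of the basis bounds the
  local deviations by those of the functions, and on \<open>T\<close> turns coefficients back into a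
  function; each use contributes one factor \<open>max A2 0\<close>.\<close>

lemma interp_local:
  fixes \<phi> :: "'i \<Rightarrow> real^'n \<Rightarrow> real"
  assumes h: "h > 0" and basis: "spline_basis N A1 A2 p k h x0 J \<phi>"
    and wts: "weights (active_mesh h x0 \<Omega>) (active_idx h x0 \<Omega> J \<phi>) \<phi> \<kappa>"
    and T: "T \<in> active_mesh h x0 \<Omega>" and t: "t \<in> Qpoly p"
    and u: "\<And>T'. T' \<in> active_mesh h x0 \<Omega> \<Longrightarrow> T' \<inter> cball z (A1 * h) \<noteq> {} \<Longrightarrow>
        u T' \<in> Qpoly p \<and> L2proj p T' f = u T' \<and> (\<forall>x\<in>T'. (u T' x - t x)\<^sup>2 \<le> e)"
    and z: "z \<in> T" and e: "e \<ge> 0"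
  obtains r where "r \<in> Qpoly p"
    "\<And>x. x \<in> T \<Longrightarrow> interp p (active_mesh h x0 \<Omega>) (active_idx h x0 \<Omega> J \<phi>) \<phi> \<kappa> f x = r x + t x"
    "(LINT x:T|lborel. (r x)\<^sup>2) \<le> (max A2 0)\<^sup>2 * real ((2 * nat \<lceil>A1\<rceil> + 3) ^ CARD('n)) * h ^ CARD('n) * e"
proof -
  let ?\<T> = "active_mesh h x0 \<Omega>" and ?I = "active_idx h x0 \<Omega> J \<phi>"
  define JT where "JT T = {i \<in> J. T \<subseteq> supp (\<phi> i)}" for T
  \<comment> \<open>\<open>A2\<close> may be any real number; its positive part keeps the estimates
    monotone.\<close>
  define B where "B = max A2 0"
  have act: "T' \<in> mesh h x0" if "T' \<in> ?\<T>" for T' using that by (auto simp: active_mesh_def)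
  have bU: "basis_on UNIV (spline_space p k h x0) J \<phi>" using basis by (simp add: spline_basis_def)
  have \<phi>Q: "\<phi> i \<in> Qpoly_on p T'" if "i \<in> J" "T' \<in> mesh h x0" for i T'
    using bU that by (auto simp: basis_on_def spline_space_def)
  have loc: "finite (JT T')" "basis_on T' (Qpoly_on p T') (JT T') \<phi>"
    "h ^ CARD('n) * (\<Sum>i\<in>JT T'. (c i)\<^sup>2) \<le> A2 * (L2norm T' (lincomb (JT T') \<phi> c))\<^sup>2"
    "(L2norm T' (lincomb (JT T') \<phi> c))\<^sup>2 \<le> A2 * (h ^ CARD('n) * (\<Sum>i\<in>JT T'. (c i)\<^sup>2))"
    if "T' \<in> mesh h x0" for T' c
    using basis that unfolding spline_basis_def JT_def Let_def by blast+
  have lin: "lincomb (JT T') \<phi> c x = (\<Sum>i\<in>JT T'. c i * \<phi> i x)" if "T' \<in> mesh h x0" for T' c x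
    unfolding lincomb_def by (rule sum.mono_neutral_left) (use loc(1)[OF that] in auto)
  have lin2: "lincomb J' \<phi> c x = (\<Sum>i\<in>JT T'. c i * \<phi> i x)"
    if T': "T' \<in> mesh h x0" and x: "x \<in> T'" and J': "JT T' \<subseteq> J'" "J' \<subseteq> J" for T' J' c x
  proof -
    have "{i \<in> J'. \<phi> i x \<noteq> 0} \<subseteq> JT T'"
      using supp_cell[OF h T' \<phi>Q[OF _ T'] x] J' by (auto simp: JT_def)
    then show ?thesis unfolding lincomb_def
      using J' by (intro sum.mono_neutral_left loc(1)[OF T']) auto
  qed
  have IT: "{i \<in> ?I. T' \<subseteq> supp (\<phi> i)} = JT T'" if "T' \<in> ?\<T>" for T'
    using that by (auto simp: active_idx_def JT_def)
  \<comment> \<open>As a global polynomial \<open>t\<close> is a spline, so it has the same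
    coefficients \<open>\<tau>\<close> on every element. This is what makes the averaging reproduce
    it.\<close>
  have "t \<in> spline_space p k h x0"
    using t Qpoly_Ck[OF t] by (auto simp: spline_space_def Qpoly_on_def)
  then obtain \<tau> where \<tau>: "\<And>x. t x = lincomb J \<phi> \<tau> x" using bU unfolding basis_on_def by blast
  define cf where "cf T' = local_coeff p ?I \<phi> T' f" for T'
  \<comment> \<open>Supports have diameter at most \<open>A1 * h\<close>, so every element that
    influences the interpolant on \<open>T\<close> meets this ball.\<close>
  define U where "U = {T' \<in> mesh h x0. T' \<inter> cball z (A1 * h) \<noteq> {}}"
  have finU: "finite U" and cardU: "card U \<le> (2 * nat \<lceil>A1\<rceil> + 3) ^ CARD('n)"
    unfolding U_def using mesh_near[OF h] by auto
  have coef: "(\<Sum>i\<in>JT T'. (cf T' i - \<tau> i)\<^sup>2) \<le> B * e" if T': "T' \<in> ?\<T>" "T' \<in> U" for T'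
  proof -
    note T'm = act[OF T'(1)]
    have uT: "u T' \<in> Qpoly p" "L2proj p T' f = u T'" "\<And>x. x \<in> T' \<Longrightarrow> (u T' x - t x)\<^sup>2 \<le> e"
      using u[OF T'(1)] T'(2) by (auto simp: U_def)
    have "\<exists>!c. (\<forall>i. i \<notin> JT T' \<longrightarrow> c i = 0) \<and> (\<forall>x\<in>T'. L2proj p T' f x = (\<Sum>i\<in>JT T'. c i * \<phi> i x))"
      by (rule basis_unique_coeff[OF loc(2)[OF T'm] loc(1)[OF T'm], of "u T'"])
        (use uT in \<open>auto simp: Qpoly_on_def\<close>)
    from theI'[OF this] have cfT: "\<And>x. x \<in> T' \<Longrightarrow> u T' x = (\<Sum>i\<in>JT T'. cf T' i * \<phi> i x)"
      unfolding cf_def local_coeff_def Let_def IT[OF T'(1)] uT(2) by blast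
    have eq: "lincomb (JT T') \<phi> (\<lambda>i. cf T' i - \<tau> i) x = u T' x - t x" if x: "x \<in> T'" for x
    proof -
      have "t x = (\<Sum>i\<in>JT T'. \<tau> i * \<phi> i x)"
        unfolding \<tau> by (rule lin2[OF T'm x]) (auto simp: JT_def)
      then show ?thesis
        unfolding lin[OF T'm] cfT[OF x] by (simp add: left_diff_distrib sum_subtractf)
    qed
    obtain j where j: "T' = cube (\<chi> i. x0 $ i + h * of_int (j i)) h" using T'm by (rule meshE)
    have "(L2norm T' (lincomb (JT T') \<phi> (\<lambda>i. cf T' i - \<tau> i)))\<^sup>2 = (LINT x:T'|lborel. (u T' x - t x)\<^sup>2)"
      unfolding L2norm_square by (rule set_lebesgue_integral_cong) (use eq j in auto)
    also have "\<dots> \<le> h ^ CARD('n) * e"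
      using uT(3) h unfolding j
      by (intro set_integral_square_le Qpoly_continuous[OF Qpoly_diff[OF uT(1)[unfolded j] t]]) auto
    finally have n: "(L2norm T' (lincomb (JT T') \<phi> (\<lambda>i. cf T' i - \<tau> i)))\<^sup>2 \<le> h ^ CARD('n) * e" .
    have "h ^ CARD('n) * (\<Sum>i\<in>JT T'. (cf T' i - \<tau> i)\<^sup>2) \<le> A2 * (L2norm T' (lincomb (JT T') \<phi> (\<lambda>i. cf T' i - \<tau> i)))\<^sup>2"
      by (rule loc(3)[OF T'm])
    also have "\<dots> \<le> B * (L2norm T' (lincomb (JT T') \<phi> (\<lambda>i. cf T' i - \<tau> i)))\<^sup>2"
      by (intro mult_right_mono) (auto simp: B_def)
    also have "\<dots> \<le> B * (h ^ CARD('n) * e)" using n by (intro mult_left_mono) (auto simp: B_def)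
    finally have "h ^ CARD('n) * (\<Sum>i\<in>JT T'. (cf T' i - \<tau> i)\<^sup>2) \<le> h ^ CARD('n) * (B * e)" by (simp add: mult_ac)
    then show ?thesis using h by simp
  qed
  define \<T>i where "\<T>i i = {T' \<in> ?\<T>. T' \<subseteq> supp (\<phi> i)}" for i
  define E where "E i = (\<Sum>T'\<in>\<T>i i. \<kappa> T' i * cf T' i)" for i
  note Tm = act[OF T]
  have \<T>iU: "\<T>i i \<subseteq> U" if i: "i \<in> JT T" for i
  proof
    fix T' assume T': "T' \<in> \<T>i i"
    then have T'm: "T' \<in> mesh h x0" "T' \<subseteq> supp (\<phi> i)" using act by (auto simp: \<T>i_def)
    obtain j where j: "T' = cube (\<chi> i. x0 $ i + h * of_int (j i)) h" using T'm(1) by (rule meshE)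
    define w where "w = (\<chi> i. x0 $ i + h * of_int (j i))"
    have w: "w \<in> T'" using h unfolding j w_def by (simp add: mem_cube)
    have "bounded (supp (\<phi> i))" "diameter (supp (\<phi> i)) \<le> A1 * h"
      using basis i unfolding spline_basis_def JT_def by auto
    moreover have "z \<in> supp (\<phi> i)" "w \<in> supp (\<phi> i)" using z i w T'm(2) by (auto simp: JT_def)
    ultimately have "dist z w \<le> A1 * h" using diameter_bounded_bound by (metis order_trans)
    then show "T' \<in> U" using w T'm(1) by (auto simp: U_def)
  qed
  have fin\<T>i: "finite (\<T>i i)" if "i \<in> JT T" for i using finite_subset[OF \<T>iU[OF that] finU] .
  have dev: "(E i - \<tau> i)\<^sup>2 \<le> (\<Sum>T'\<in>\<T>i i. (cf T' i - \<tau> i)\<^sup>2)" if i: "i \<in> JT T" for i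
  proof -
    have "i \<in> ?I" using i IT[OF T] by auto
    then have k: "\<And>T'. T' \<in> \<T>i i \<Longrightarrow> 0 \<le> \<kappa> T' i \<and> \<kappa> T' i \<le> 1" "(\<Sum>T'\<in>\<T>i i. \<kappa> T' i) = 1"
      using wts unfolding weights_def Let_def \<T>i_def by auto
    have "E i - \<tau> i = (\<Sum>T'\<in>\<T>i i. \<kappa> T' i * cf T' i) - \<tau> i * (\<Sum>T'\<in>\<T>i i. \<kappa> T' i)"
      using k(2) by (simp add: E_def)
    also have "\<dots> = (\<Sum>T'\<in>\<T>i i. \<kappa> T' i * (cf T' i - \<tau> i))"
      by (simp add: sum_distrib_left sum_subtractf[symmetric] algebra_simps)
    finally have eq: "E i - \<tau> i = (\<Sum>T'\<in>\<T>i i. \<kappa> T' i * (cf T' i - \<tau> i))" .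
    show ?thesis unfolding eq by (rule weighted_mean_square_le) (use k in auto)
  qed
  have sumdev: "(\<Sum>i\<in>JT T. (E i - \<tau> i)\<^sup>2) \<le> real (card U) * (B * e)"
  proof -
    have "(\<Sum>i\<in>JT T. (E i - \<tau> i)\<^sup>2) \<le> (\<Sum>i\<in>JT T. \<Sum>T'\<in>\<T>i i. (cf T' i - \<tau> i)\<^sup>2)"
      by (intro sum_mono dev)
    also have "\<dots> = (\<Sum>i\<in>JT T. \<Sum>T'\<in>U. if T' \<in> \<T>i i then (cf T' i - \<tau> i)\<^sup>2 else 0)"
    proof (rule sum.cong[OF refl])
      fix i assume "i \<in> JT T"
      then have "U \<inter> {T'. T' \<in> \<T>i i} = \<T>i i" using \<T>iU by auto
      then show "(\<Sum>T'\<in>\<T>i i. (cf T' i - \<tau> i)\<^sup>2) = (\<Sum>T'\<in>U. if T' \<in> \<T>i i then (cf T' i - \<tau> i)\<^sup>2 else 0)"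
        using finU by (simp add: sum.If_cases)
    qed
    \<comment> \<open>Element by element the inner sum is covered by \<open>coef\<close>, so only
      the number of elements enters, not that of basis functions.\<close>
    also have "\<dots> = (\<Sum>T'\<in>U. \<Sum>i\<in>JT T. if T' \<in> \<T>i i then (cf T' i - \<tau> i)\<^sup>2 else 0)"
      by (rule sum.swap)
    also have "\<dots> \<le> (\<Sum>T'\<in>U. B * e)"
    proof (rule sum_mono)
      fix T' assume T': "T' \<in> U"
      show "(\<Sum>i\<in>JT T. if T' \<in> \<T>i i then (cf T' i - \<tau> i)\<^sup>2 else 0) \<le> B * e"
      proof (cases "T' \<in> ?\<T>")
        case True
        have "(\<Sum>i\<in>JT T. if T' \<in> \<T>i i then (cf T' i - \<tau> i)\<^sup>2 else 0) =
            (\<Sum>i\<in>JT T \<inter> {i. T' \<in> \<T>i i}. (cf T' i - \<tau> i)\<^sup>2)"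
          using loc(1)[OF Tm] by (simp add: sum.If_cases)
        also have "\<dots> \<le> (\<Sum>i\<in>JT T'. (cf T' i - \<tau> i)\<^sup>2)"
          by (intro sum_mono2 loc(1)[OF act[OF True]]) (auto simp: JT_def \<T>i_def)
        finally show ?thesis using coef[OF True T'] by simp
      next
        case False
        then have "(\<Sum>i\<in>JT T. if T' \<in> \<T>i i then (cf T' i - \<tau> i)\<^sup>2 else 0) = 0"
          by (intro sum.neutral) (auto simp: \<T>i_def)
        then show ?thesis using e by (simp add: B_def)
      qed
    qed
    finally show ?thesis by simp
  qed
  have "\<forall>i\<in>JT T. \<exists>q. q \<in> Qpoly p \<and> (\<forall>x\<in>T. \<phi> i x = q x)"
    using \<phi>Q[OF _ Tm] unfolding JT_def Qpoly_on_def by blast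
  then obtain Q where Q: "\<And>i. i \<in> JT T \<Longrightarrow> Q i \<in> Qpoly p" "\<And>i x. i \<in> JT T \<Longrightarrow> x \<in> T \<Longrightarrow> \<phi> i x = Q i x"
    by metis
  define r where "r x = (\<Sum>i\<in>JT T. (E i - \<tau> i) * Q i x)" for x
  have r_eq: "r x = lincomb (JT T) \<phi> (\<lambda>i. E i - \<tau> i) x" if "x \<in> T" for x
    unfolding lin[OF Tm] r_def using Q(2) that by (intro sum.cong) auto
  show ?thesis
  proof (rule that)
    show "r \<in> Qpoly p" unfolding r_def by (intro Qpoly_sum Qpoly_cmult Q(1))
  next
    fix x assume x: "x \<in> T"
    have "JT T \<subseteq> ?I" "?I \<subseteq> J" using IT[OF T] by (auto simp: active_idx_def)
    then have "interp p ?\<T> ?I \<phi> \<kappa> f x = (\<Sum>i\<in>JT T. E i * \<phi> i x)"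
      unfolding interp_def cf_def[symmetric] \<T>i_def[symmetric] E_def[symmetric] by (rule lin2[OF Tm x])
    moreover have "t x = (\<Sum>i\<in>JT T. \<tau> i * \<phi> i x)"
      unfolding \<tau> by (rule lin2[OF Tm x]) (auto simp: JT_def)
    ultimately show "interp p ?\<T> ?I \<phi> \<kappa> f x = r x + t x"
      unfolding r_eq[OF x] lin[OF Tm] by (simp add: left_diff_distrib sum_subtractf)
  next
    have "(LINT x:T|lborel. (r x)\<^sup>2) = (L2norm T (lincomb (JT T) \<phi> (\<lambda>i. E i - \<tau> i)))\<^sup>2"
      unfolding L2norm_square using Tm by (intro set_lebesgue_integral_cong) (auto simp: r_eq elim!: meshE)
    also have "\<dots> \<le> A2 * (h ^ CARD('n) * (\<Sum>i\<in>JT T. (E i - \<tau> i)\<^sup>2))" by (rule loc(4)[OF Tm])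
    also have "\<dots> \<le> B * (h ^ CARD('n) * (\<Sum>i\<in>JT T. (E i - \<tau> i)\<^sup>2))"
      using h by (intro mult_right_mono) (auto simp: B_def sum_nonneg)
    also have "\<dots> \<le> B * (h ^ CARD('n) * (real ((2 * nat \<lceil>A1\<rceil> + 3) ^ CARD('n)) * (B * e)))"
    proof -
      have "real (card U) * (B * e) \<le> real ((2 * nat \<lceil>A1\<rceil> + 3) ^ CARD('n)) * (B * e)"
        using cardU e by (intro mult_right_mono) (auto simp: B_def simp del: of_nat_power)
      then show ?thesis using sumdev h by (intro mult_left_mono) (auto simp: B_def)
    qed
    finally show "(LINT x:T|lborel. (r x)\<^sup>2) \<le> (max A2 0)\<^sup>2 * real ((2 * nat \<lceil>A1\<rceil> + 3) ^ CARD('n)) * h ^ CARD('n) * e"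
      by (simp add: B_def power2_eq_square mult_ac)
  qed
qed

section \<open>The extended interpolant\<close>

text \<open>\<open>T1\<close> is the element whose polynomial is used on \<open>T\<close>. The two
  conclusions are the two conditions on \<open>f\<close> in \<open>L2proj_eq\<close>.\<close>

lemma Bh_on_cell:
  assumes h: "h > 0" and T: "T \<in> active_mesh h (x0::real^'n) \<Omega>"
    and T1: "T1 = (if T \<in> large_elems \<gamma> h x0 \<Omega> then T else S T)" "T1 \<in> mesh h x0"
    and q: "q \<in> Qpoly p" "\<And>x. x \<in> T1 \<Longrightarrow> v x = q x"
  shows "x \<in> interior T \<Longrightarrow> Bh p \<gamma> h x0 \<Omega> S v x = q x"
    and "x \<in> T \<Longrightarrow> x \<notin> interior T \<Longrightarrow> Bh p \<gamma> h x0 \<Omega> S v x = 0"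
proof -
  have act: "T' \<in> mesh h x0" if "T' \<in> active_mesh h x0 \<Omega>" for T'
    using that by (auto simp: active_mesh_def)
  have uniq: "T' = T" if "T' \<in> active_mesh h x0 \<Omega>" "x \<in> interior T'" "x \<in> T" for T' x
    using mesh_interior_unique[OF h act[OF that(1)] act[OF T] that(2,3)] by simp
  show "Bh p \<gamma> h x0 \<Omega> S v x = q x" if x: "x \<in> interior T"
  proof -
    have xT: "x \<in> T" using x interior_subset by auto
    have the: "(THE T. T \<in> active_mesh h x0 \<Omega> \<and> x \<in> interior T) = T"
      by (rule the_equality) (use T x uniq xT in auto)
    have ex: "\<exists>T\<in>active_mesh h x0 \<Omega>. x \<in> interior T" using T x by blast
    show ?thesis
    proof (cases "T \<in> large_elems \<gamma> h x0 \<Omega>")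
      case True
      then show ?thesis unfolding Bh_def the Let_def using ex T1 q(2) xT by simp
    next
      case False
      then have "poly_ext p (S T) v = q" using T1 q by (intro poly_ext_eq[OF h]) auto
      then show ?thesis unfolding Bh_def the Let_def using ex False by simp
    qed
  qed
  show "Bh p \<gamma> h x0 \<Omega> S v x = 0" if x: "x \<in> T" "x \<notin> interior T"
  proof -
    have "\<not> (\<exists>T\<in>active_mesh h x0 \<Omega>. x \<in> interior T)" using uniq x by blast
    then show ?thesis by (simp add: Bh_def)
  qed
qed

text \<open>The last conclusion, bounded support, provides integrability and finiteness of the
  relevant set of elements when \<open>\<Omega>\<close> is unbounded.\<close>

lemma active_span_spline:
  assumes basis: "spline_basis N A1 A2 p k h x0 J \<phi>" and v: "v \<in> active_span h x0 \<Omega> J \<phi>"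
  shows "Ck k v" and "\<forall>T\<in>mesh h x0. v \<in> Qpoly_on p T" and "\<exists>\<rho>. \<forall>x. norm x > \<rho> \<longrightarrow> v x = 0"
proof -
  obtain F c where F: "finite F" "F \<subseteq> active_idx h x0 \<Omega> J \<phi>" "v = (\<lambda>x. \<Sum>i\<in>F. c i * \<phi> i x)"
    using v unfolding active_span_def by auto
  have FJ: "i \<in> J" if "i \<in> F" for i using F(2) that by (auto simp: active_idx_def)
  have sp: "\<phi> i \<in> spline_space p k h x0" if "i \<in> F" for i
    using basis FJ[OF that] unfolding spline_basis_def basis_on_def by auto
  show "Ck k v" unfolding F(3) using sp by (intro Ck_sum Ck_cmult) (auto simp: spline_space_def)
  show "\<forall>T\<in>mesh h x0. v \<in> Qpoly_on p T"
  proof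
    fix T assume T: "T \<in> mesh h x0"
    have "\<forall>i\<in>F. \<exists>q. q \<in> Qpoly p \<and> (\<forall>x\<in>T. \<phi> i x = q x)"
      using sp T unfolding spline_space_def Qpoly_on_def by blast
    then obtain Q where Q: "\<And>i. i \<in> F \<Longrightarrow> Q i \<in> Qpoly p" "\<And>i x. i \<in> F \<Longrightarrow> x \<in> T \<Longrightarrow> \<phi> i x = Q i x"
      by metis
    have "(\<lambda>x. \<Sum>i\<in>F. c i * Q i x) \<in> Qpoly p" by (intro Qpoly_sum Qpoly_cmult Q(1))
    then show "v \<in> Qpoly_on p T" unfolding Qpoly_on_def F(3) using Q(2)
      by (auto intro!: bexI[of _ "\<lambda>x. \<Sum>i\<in>F. c i * Q i x"] sum.cong)
  qed
  have "bounded (\<Union>i\<in>F. supp (\<phi> i))"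
    using F(1) FJ basis unfolding spline_basis_def by (intro bounded_UN) auto
  then obtain \<rho> where \<rho>: "\<And>x. x \<in> (\<Union>i\<in>F. supp (\<phi> i)) \<Longrightarrow> norm x \<le> \<rho>" unfolding bounded_iff by blast
  have "v x = 0" if "norm x > \<rho>" for x
  proof -
    have "\<phi> i x = 0" if "i \<in> F" for i
    proof (rule ccontr)
      assume "\<phi> i x \<noteq> 0"
      then have "x \<in> supp (\<phi> i)" unfolding supp_def using closure_subset[of "{x. \<phi> i x \<noteq> 0}"] by blast
      then show False using \<rho>[of x] that \<open>norm x > \<rho>\<close> by auto
    qed
    then show ?thesis by (simp add: F(3))
  qed
  then show "\<exists>\<rho>. \<forall>x. norm x > \<rho> \<longrightarrow> v x = 0" by blast
qed

lemma grad_norm_bounded_support: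
  assumes "\<forall>x. norm x > \<rho> \<longrightarrow> v x = 0" "norm (x::real^'n) > \<rho>"
  shows "(grad_norm m v x)\<^sup>2 = 0"
proof -
  have "derivs is v x = derivs is (\<lambda>x. 0) x" for "is"
    by (rule derivs_cong_open[of "- cball 0 \<rho>"]) (use assms in auto)
  then show ?thesis unfolding grad_norm_square by simp
qed

lemma grad_norm_integrable:
  fixes v :: "real^'n \<Rightarrow> real"
  assumes "Ck k v" "m \<le> k" "\<forall>x. norm x > \<rho> \<longrightarrow> v x = 0" "open \<Omega>"
  shows "set_integrable lborel \<Omega> (\<lambda>x. (grad_norm m v x)\<^sup>2)"
proof -
  have "continuous_on UNIV (\<lambda>x. (grad_norm m v x)\<^sup>2)"
    unfolding grad_norm_square using Ck_derivs_continuous[OF assms(1)] assms(2)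
    by (intro continuous_on_sum continuous_on_power) auto
  then have "set_integrable lborel (cball 0 \<rho>) (\<lambda>x. (grad_norm m v x)\<^sup>2)"
    unfolding set_integrable_def using continuous_on_subset by (intro borel_integrable_compact) auto
  then have "set_integrable lborel (\<Omega> \<inter> cball 0 \<rho>) (\<lambda>x. (grad_norm m v x)\<^sup>2)"
    by (rule set_integrable_subset) (use assms(4) in auto)
  moreover have "(\<lambda>x. indicat_real (\<Omega> \<inter> cball 0 \<rho>) x *\<^sub>R (grad_norm m v x)\<^sup>2) =
      (\<lambda>x. indicat_real \<Omega> x *\<^sub>R (grad_norm m v x)\<^sup>2)"
    using grad_norm_bounded_support[OF assms(3), of _ m] by (auto simp: indicator_def fun_eq_iff)
  ultimately show ?thesis unfolding set_integrable_def by (simp only:)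
qed

text \<open>The length in the assumption adds up a path: from the representative of \<open>T\<close>
  to \<open>T\<close>, across a support to another element, on to its representative, plus the
  \<open>2 * CARD('n)\<close> that \<open>poincare_large\<close> asks for.\<close>

lemma local_estimate:
  fixes \<Omega> :: "(real^'n) set"
  assumes wc: "well_connected \<Omega> \<gamma> (2 * (max A3 0 + real CARD('n)) + max A1 0 + 2 * real CARD('n)) H"
    and H: "H \<subseteq> {0<..}" and \<Omega>: "open \<Omega>" and "m \<le> k"
  obtains C R where "C > 0" "R \<ge> 0"
    "\<And>h x0 (J :: 'i set) \<phi> \<kappa> S v T. h \<in> H \<Longrightarrow> spline_basis N A1 A2 p k h x0 J \<phi> \<Longrightarrow>
       weights (active_mesh h x0 \<Omega>) (active_idx h x0 \<Omega> J \<phi>) \<phi> \<kappa> \<Longrightarrow> elem_map A3 \<gamma> h x0 \<Omega> S \<Longrightarrow>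
       v \<in> active_span h x0 \<Omega> J \<phi> \<Longrightarrow> T \<in> active_mesh h x0 \<Omega> \<Longrightarrow>
       \<exists>y. (\<forall>x\<in>T. dist x y \<le> R * h) \<and> (\<forall>x\<in>interior T. (grad_norm m (Eh p \<gamma> h x0 \<Omega> J \<phi> \<kappa> S v) x)\<^sup>2
          \<le> C / h ^ CARD('n) * (LINT z:\<Omega> \<inter> ball y (R * h)|lborel. (grad_norm m v z)\<^sup>2))"
proof -
  define d where "d = real CARD('n)"
  \<comment> \<open>Bounds, in units of \<open>h\<close>, the distance from any point of an element
    to any point of its representative: \<open>d\<close> if the element represents itself,
    \<open>A3\<close> if it is small.\<close>
  define a3 where "a3 = max A3 0 + d"
  have d1: "d \<ge> 1" by (simp add: d_def Suc_le_eq)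
  have a3: "a3 \<ge> 0" "A3 \<le> a3" "d \<le> a3" using d1 by (auto simp: a3_def)
  obtain Cp R where Cp: "Cp > 0" "R \<ge> 0" and poin:
    "\<And>h x0 v T0. h \<in> H \<Longrightarrow> Ck k v \<Longrightarrow> \<forall>T\<in>mesh h x0. v \<in> Qpoly_on p T \<Longrightarrow>
      set_integrable lborel \<Omega> (\<lambda>x. (grad_norm m v x)\<^sup>2) \<Longrightarrow> T0 \<in> large_elems \<gamma> h x0 \<Omega> \<Longrightarrow>
      \<exists>y t. y \<in> T0 \<and> t \<in> Qpoly p \<and> (\<forall>is. length is = m \<longrightarrow> derivs is t = (\<lambda>x. 0)) \<and>
        (\<forall>T1\<in>large_elems \<gamma> h x0 \<Omega>. \<forall>q\<in>Qpoly p. \<forall>x a b. (\<forall>x\<in>T1. v x = q x) \<longrightarrow>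
           a \<in> T0 \<longrightarrow> b \<in> T1 \<longrightarrow> dist a b \<le> (2 * a3 + max A1 0) * h \<longrightarrow> dist x b \<le> a3 * h \<longrightarrow>
           (q x - t x)\<^sup>2 \<le> Cp * h ^ (2 * m) / h ^ CARD('n) *
              (LINT z:\<Omega> \<inter> ball y (R * h)|lborel. (grad_norm m v z)\<^sup>2))"
    using poincare_large[OF wc[folded d_def, folded a3_def, unfolded d_def] H \<Omega> \<open>m \<le> k\<close> a3(1), where p = p] by blast
  obtain Ci where Ci: "Ci > 0" "\<And>(q::real^'n\<Rightarrow>real) y s is x. q \<in> Qpoly p \<Longrightarrow> s > 0 \<Longrightarrow> length is \<le> m \<Longrightarrow>
      (\<And>i. \<bar>x $ i - y $ i\<bar> \<le> 1 * s) \<Longrightarrow>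
      (derivs is q x)\<^sup>2 \<le> Ci / s ^ (2 * length is + CARD('n)) * (LINT z:cube y s|lborel. (q z)\<^sup>2)"
    using inverse_estimate[OF zero_le_one, where ?'n = 'n and p = p and m = m] by blast
  define Kc where "Kc = (max A2 0)\<^sup>2 * real ((2 * nat \<lceil>A1\<rceil> + 3) ^ CARD('n))"
  have Kc: "Kc \<ge> 0" unfolding Kc_def by simp
  define C where "C = real (CARD('n) ^ m) * (Ci * Kc * Cp)"
  have C0: "C \<ge> 0" unfolding C_def using Ci Kc Cp by simp
  show ?thesis
  \<comment> \<open>\<open>C\<close> can be 0, for instance if \<open>A2 \<le> 0\<close>. The radius
    grows by \<open>a3\<close> because \<open>y\<close> lies in the representative of
    \<open>T\<close>, not necessarily in \<open>T\<close>.\<close>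
  proof (rule that[of "C + 1" "R + a3"])
    show "C + 1 > 0" "R + a3 \<ge> 0" using C0 Cp a3 by auto
  next
    fix h x0 \<kappa> S v T and J :: "'i set" and \<phi>
    assume hH: "h \<in> H" and basis: "spline_basis N A1 A2 p k h x0 J \<phi>"
      and wts: "weights (active_mesh h x0 \<Omega>) (active_idx h x0 \<Omega> J \<phi>) \<phi> \<kappa>"
      and S: "elem_map A3 \<gamma> h x0 \<Omega> S" and v: "v \<in> active_span h x0 \<Omega> J \<phi>" and T: "T \<in> active_mesh h x0 \<Omega>"
    have h: "h > 0" using hH H by auto
    let ?L = "large_elems \<gamma> h x0 \<Omega>" and ?E = "Eh p \<gamma> h x0 \<Omega> J \<phi> \<kappa> S v"
    have act: "T' \<in> mesh h x0" if "T' \<in> active_mesh h x0 \<Omega>" for T'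
      using that by (auto simp: active_mesh_def)
    have Lact: "T' \<in> active_mesh h x0 \<Omega>" if "T' \<in> ?L" for T' using that by (auto simp: large_elems_def)
    define rep where "rep T' = (if T' \<in> ?L then T' else S T')" for T'
    have repL: "rep T' \<in> ?L" if "T' \<in> active_mesh h x0 \<Omega>" for T'
      using S that unfolding elem_map_def rep_def small_elems_def by auto
    have repd: "dist x b \<le> a3 * h" if T': "T' \<in> active_mesh h x0 \<Omega>" and x: "x \<in> T'" and b: "b \<in> rep T'" for T' x b
    proof (cases "T' \<in> ?L")
      case True
      have "dist x b \<le> d * h" using mesh_dist_le[OF act[OF T'] x] b True by (simp add: rep_def d_def)
      also have "\<dots> \<le> a3 * h" using a3 h by simp
      finally show ?thesis .
    next
      case False
      then have ST: "S T' \<in> ?L" "diameter (S T' \<union> T') \<le> A3 * h" "b \<in> S T'"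
        using S T' b unfolding elem_map_def small_elems_def rep_def by auto
      have bd: "bounded T''" if "T'' \<in> mesh h x0" for T''
        using that by (elim meshE) (auto intro: compact_imp_bounded)
      have "dist x b \<le> diameter (S T' \<union> T')"
        using ST(3) x bd act[OF T'] act[OF Lact[OF ST(1)]] by (intro diameter_bounded_bound) auto
      also have "\<dots> \<le> A3 * h" by (rule ST(2))
      also have "\<dots> \<le> a3 * h" using a3 h by simp
      finally show ?thesis .
    qed
    note vspl = active_span_spline[OF basis v]
    obtain \<rho> where \<rho>: "\<forall>x. norm x > \<rho> \<longrightarrow> v x = 0" using vspl(3) by blast
    note vint = grad_norm_integrable[OF vspl(1) \<open>m \<le> k\<close> \<rho> \<Omega>]
    have "\<forall>T'\<in>mesh h x0. \<exists>q. q \<in> Qpoly p \<and> (\<forall>x\<in>T'. v x = q x)"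
      using vspl(2) unfolding Qpoly_on_def by blast
    then obtain Q where Q: "\<And>T'. T' \<in> mesh h x0 \<Longrightarrow> Q T' \<in> Qpoly p"
      "\<And>T' x. T' \<in> mesh h x0 \<Longrightarrow> x \<in> T' \<Longrightarrow> v x = Q T' x"
      by metis
    obtain y t where y: "y \<in> rep T" and t: "t \<in> Qpoly p" "\<And>is. length is = m \<Longrightarrow> derivs is t = (\<lambda>x. 0)"
      and yt: "\<forall>T1\<in>?L. \<forall>q\<in>Qpoly p. \<forall>x a b. (\<forall>x\<in>T1. v x = q x) \<longrightarrow>
           a \<in> rep T \<longrightarrow> b \<in> T1 \<longrightarrow> dist a b \<le> (2 * a3 + max A1 0) * h \<longrightarrow> dist x b \<le> a3 * h \<longrightarrow>
           (q x - t x)\<^sup>2 \<le> Cp * h ^ (2 * m) / h ^ CARD('n) *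
              (LINT z:\<Omega> \<inter> ball y (R * h)|lborel. (grad_norm m v z)\<^sup>2)"
      using poin[OF hH vspl(1,2) vint repL[OF T]] by (elim exE conjE) (rule that; simp)
    define G where "G = (LINT z:\<Omega> \<inter> ball y (R * h)|lborel. (grad_norm m v z)\<^sup>2)"
    define e where "e = Cp * h ^ (2 * m) / h ^ CARD('n) * G"
    have G: "G \<ge> 0" unfolding G_def set_lebesgue_integral_def by (rule integral_nonneg_AE) simp
    have e: "e \<ge> 0" unfolding e_def using G Cp h by simp
    obtain z where z: "z \<in> T" using T by (auto simp: active_mesh_def)
    have u: "Q (rep T') \<in> Qpoly p \<and> L2proj p T' (Bh p \<gamma> h x0 \<Omega> S v) = Q (rep T') \<and>
        (\<forall>x\<in>T'. (Q (rep T') x - t x)\<^sup>2 \<le> e)"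
      if T': "T' \<in> active_mesh h x0 \<Omega>" "T' \<inter> cball z (A1 * h) \<noteq> {}" for T'
    proof (intro conjI ballI)
      note rm = act[OF Lact[OF repL[OF T'(1)]]]
      show "Q (rep T') \<in> Qpoly p" by (rule Q(1)[OF rm])
      obtain j where j: "T' = cube (\<chi> i. x0 $ i + h * of_int (j i)) h" using act[OF T'(1)] by (rule meshE)
      have B: "x \<in> interior T' \<Longrightarrow> Bh p \<gamma> h x0 \<Omega> S v x = Q (rep T') x"
        "x \<in> T' \<Longrightarrow> x \<notin> interior T' \<Longrightarrow> Bh p \<gamma> h x0 \<Omega> S v x = 0" for x
        using Bh_on_cell[OF h T'(1), where ?T1.0 = "rep T'" and q = "Q (rep T')" and S = S and v = v and \<gamma> = \<gamma> and p = p]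
          rep_def[of T'] rm Q(1)[OF rm] Q(2)[OF rm] by auto
      show "L2proj p T' (Bh p \<gamma> h x0 \<Omega> S v) = Q (rep T')"
        unfolding j by (rule L2proj_eq[OF h]) (use B Q(1)[OF rm] in \<open>auto simp flip: j\<close>)
      fix x assume x: "x \<in> T'"
      obtain w where w: "w \<in> T'" "dist z w \<le> A1 * h" using T'(2) by auto
      obtain b where b: "b \<in> rep T'" using repL[OF T'(1)] by (auto simp: large_elems_def active_mesh_def)
      have "dist y b \<le> dist y z + dist z w + dist w b"
        using dist_triangle[of y b z] dist_triangle[of z b w] by simp
      also have "\<dots> \<le> a3 * h + A1 * h + a3 * h"
        using repd[OF T z y] w(2) repd[OF T'(1) w(1) b] by (simp add: dist_commute)
      also have "\<dots> \<le> a3 * h + max A1 0 * h + a3 * h" using h by (simp add: mult_right_mono)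
      finally have "dist y b \<le> (2 * a3 + max A1 0) * h" by (simp add: algebra_simps)
      then show "(Q (rep T') x - t x)\<^sup>2 \<le> e"
        unfolding e_def G_def using Q(2)[OF rm] y b repd[OF T'(1) x b]
        by (intro yt[rule_format, OF repL[OF T'(1)] Q(1)[OF rm]]) auto
    qed
    obtain r where r: "r \<in> Qpoly p" "\<And>x. x \<in> T \<Longrightarrow> ?E x = r x + t x"
      "(LINT x:T|lborel. (r x)\<^sup>2) \<le> Kc * h ^ CARD('n) * e"
      using interp_local[OF h basis wts T t(1) u z e] unfolding Eh_def Kc_def by blast
    obtain j where j: "T = cube (\<chi> i. x0 $ i + h * of_int (j i)) h" using act[OF T] by (rule meshE)
    have DE: "(derivs is ?E x)\<^sup>2 \<le> Ci * Kc * Cp / h ^ CARD('n) * G" if x: "x \<in> interior T" and l: "length is = m" for x "is"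
    proof -
      have "derivs is ?E x = derivs is (\<lambda>x. r x + t x) x"
        by (rule derivs_cong_open[OF open_interior _ x]) (use r(2) interior_subset in blast)
      also have "\<dots> = derivs is r x"
        using derivs_add[OF Qpoly_Ck[OF r(1)] Qpoly_Ck[OF t(1)] order_refl, of "is"] t(2)[OF l] by simp
      finally have "(derivs is ?E x)\<^sup>2 = (derivs is r x)\<^sup>2" by simp
      also have "\<dots> \<le> Ci / h ^ (2 * length is + CARD('n)) * (LINT x:T|lborel. (r x)\<^sup>2)"
        unfolding j
      proof (rule Ci(2)[OF r(1) h])
        fix i
        have "x \<in> T" using x interior_subset by auto
        then have "(x0 $ i + h * of_int (j i)) \<le> x $ i \<and> x $ i \<le> (x0 $ i + h * of_int (j i)) + h"
          unfolding j mem_cube by simp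
        then show "\<bar>x $ i - (\<chi> i. x0 $ i + h * of_int (j i)) $ i\<bar> \<le> 1 * h" by (simp add: abs_le_iff)
      qed (use l in simp)
      also have "\<dots> \<le> Ci / h ^ (2 * m + CARD('n)) * (Kc * h ^ CARD('n) * e)"
        using l r(3) Ci(1) h by (simp only:) (intro mult_left_mono, auto)
      \<comment> \<open>The factor \<open>h ^ (2 * m)\<close> won by the Poincare estimate
        compensates exactly the loss in the inverse estimate.\<close>
      also have "\<dots> = Ci * Kc * Cp / h ^ CARD('n) * G"
        using h by (simp add: e_def power_add)
      finally show ?thesis .
    qed
    have "(\<forall>x\<in>T. dist x y \<le> (R + a3) * h) \<and> (\<forall>x\<in>interior T. (grad_norm m ?E x)\<^sup>2
          \<le> (C + 1) / h ^ CARD('n) * (LINT z:\<Omega> \<inter> ball y ((R + a3) * h)|lborel. (grad_norm m v z)\<^sup>2))"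
    proof (intro conjI ballI)
      fix x assume "x \<in> T"
      then have "dist x y \<le> a3 * h" using repd[OF T _ y] by blast
      then show "dist x y \<le> (R + a3) * h" using Cp(2) h by (simp add: distrib_right add_increasing)
    next
      fix x assume x: "x \<in> interior T"
      have "(grad_norm m ?E x)\<^sup>2 \<le> (\<Sum>is | length (is::'n list) = m. Ci * Kc * Cp / h ^ CARD('n) * G)"
        unfolding grad_norm_square using DE[OF x] by (intro sum_mono) auto
      also have "\<dots> = C / h ^ CARD('n) * G" by (simp add: card_multi_index C_def)
      also have "\<dots> \<le> (C + 1) / h ^ CARD('n) * (LINT z:\<Omega> \<inter> ball y ((R + a3) * h)|lborel. (grad_norm m v z)\<^sup>2)"
      proof (rule mult_mono)
        show "C / h ^ CARD('n) \<le> (C + 1) / h ^ CARD('n)" using h by (simp add: divide_right_mono)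
        have sub: "ball y (R * h) \<subseteq> ball y ((R + a3) * h)"
          using a3 h by (intro subset_ball) (simp add: mult_right_mono)
        have si: "set_integrable lborel (\<Omega> \<inter> ball y s) (\<lambda>x. (grad_norm m v x)\<^sup>2)" for s
          by (rule set_integrable_subset[OF vint]) (use \<Omega> in auto)
        show "G \<le> (LINT z:\<Omega> \<inter> ball y ((R + a3) * h)|lborel. (grad_norm m v z)\<^sup>2)"
          unfolding G_def set_lebesgue_integral_def
          using si[unfolded set_integrable_def] sub
          by (intro integral_mono) (auto simp: indicator_def)
      qed (use G C0 h in auto)
      finally show "(grad_norm m ?E x)\<^sup>2
          \<le> (C + 1) / h ^ CARD('n) * (LINT z:\<Omega> \<inter> ball y ((R + a3) * h)|lborel. (grad_norm m v z)\<^sup>2)" .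
    qed
    then show "\<exists>y. (\<forall>x\<in>T. dist x y \<le> (R + a3) * h) \<and> (\<forall>x\<in>interior T. (grad_norm m ?E x)\<^sup>2
          \<le> (C + 1) / h ^ CARD('n) * (LINT z:\<Omega> \<inter> ball y ((R + a3) * h)|lborel. (grad_norm m v z)\<^sup>2))"
      by blast
  qed
qed

section \<open>Summation over the active elements\<close>

text \<open>If \<open>z\<close> lies in the ball belonging to \<open>T\<close>, then
  \<open>T\<close> meets the ball of radius \<open>2 * R * h\<close> around \<open>z\<close>;
  \<open>mesh_near\<close> bounds the number of such \<open>T\<close>.\<close>

lemma finite_overlap_integral:
  fixes g :: "real^'n \<Rightarrow> real"
  assumes h: "h > 0" and F: "finite F" "F \<subseteq> mesh h x0" and \<Omega>: "open \<Omega>"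
    and int: "set_integrable lborel \<Omega> g" and g: "\<And>x. g x \<ge> 0"
    and y: "\<And>T x. T \<in> F \<Longrightarrow> x \<in> T \<Longrightarrow> dist x (y T) \<le> R * h"
  shows "(\<Sum>T\<in>F. LINT z:\<Omega> \<inter> ball (y T) (R * h)|lborel. g z) \<le>
     real ((2 * nat \<lceil>2 * R\<rceil> + 3) ^ CARD('n)) * (LINT z:\<Omega>|lborel. g z)"
proof -
  let ?M = "real ((2 * nat \<lceil>2 * R\<rceil> + 3) ^ CARD('n))"
  let ?f = "\<lambda>T z. indicat_real (\<Omega> \<inter> ball (y T) (R * h)) z *\<^sub>R g z"
  have si: "integrable lborel (?f T)" for T
    using set_integrable_subset[OF int, of "\<Omega> \<inter> ball (y T) (R * h)"] \<Omega> unfolding set_integrable_def by auto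
  have "(\<Sum>T\<in>F. LINT z:\<Omega> \<inter> ball (y T) (R * h)|lborel. g z) = (LINT z|lborel. (\<Sum>T\<in>F. ?f T z))"
    unfolding set_lebesgue_integral_def using si by (subst Bochner_Integration.integral_sum) auto
  also have "\<dots> \<le> (LINT z|lborel. ?M * (indicat_real \<Omega> z *\<^sub>R g z))"
  proof (rule integral_mono)
    show "integrable lborel (\<lambda>z. \<Sum>T\<in>F. ?f T z)" using si by auto
    show "integrable lborel (\<lambda>z. ?M * (indicat_real \<Omega> z *\<^sub>R g z))"
      using int unfolding set_integrable_def by (intro integrable_mult_right)
    fix z
    let ?U = "{T \<in> mesh h x0. T \<inter> cball z (2 * R * h) \<noteq> {}}"
    have "(\<Sum>T\<in>F. ?f T z) \<le> (\<Sum>T\<in>F. if T \<in> ?U then indicat_real \<Omega> z *\<^sub>R g z else 0)"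
    proof (rule sum_mono)
      fix T assume T: "T \<in> F"
      show "?f T z \<le> (if T \<in> ?U then indicat_real \<Omega> z *\<^sub>R g z else 0)"
      proof (cases "z \<in> ball (y T) (R * h)")
        case True
        obtain j where j: "T = cube (\<chi> i. x0 $ i + h * of_int (j i)) h"
          by (rule meshE[OF subsetD[OF F(2) T]])
        define w where "w = (\<chi> i. x0 $ i + h * of_int (j i))"
        have w: "w \<in> T" using h unfolding j w_def by (simp add: mem_cube)
        have "dist z w \<le> 2 * R * h"
          using y[OF T w] True dist_triangle[of z w "y T"] by (simp add: dist_commute)
        then have "T \<in> ?U" using w T F(2) by auto
        then show ?thesis using g[of z] by (auto simp: indicator_def)
      next
        case False
        then show ?thesis using g[of z] by (auto simp: indicator_def)
      qed
    qed
    also have "\<dots> = real (card (F \<inter> ?U)) * (indicat_real \<Omega> z *\<^sub>R g z)"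
      using F(1) by (simp add: sum.If_cases del: mem_Collect_eq)
    also have "\<dots> \<le> ?M * (indicat_real \<Omega> z *\<^sub>R g z)"
    proof (rule mult_right_mono)
      have "card (F \<inter> ?U) \<le> card ?U" by (rule card_mono[OF mesh_near(1)[OF h]]) auto
      also have "\<dots> \<le> (2 * nat \<lceil>2 * R\<rceil> + 3) ^ CARD('n)" by (rule mesh_near(2)[OF h])
      finally show "real (card (F \<inter> ?U)) \<le> ?M" by (simp only: of_nat_le_iff)
    qed (use g[of z] in \<open>auto simp: indicator_def\<close>)
    finally show "(\<Sum>T\<in>F. ?f T z) \<le> ?M * (indicat_real \<Omega> z *\<^sub>R g z)" .
  qed
  also have "\<dots> = ?M * (LINT z:\<Omega>|lborel. g z)" unfolding set_lebesgue_integral_def by simp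
  finally show ?thesis .
qed

lemma global_estimate:
  fixes \<Omega> :: "(real^'n) set"
  assumes wc: "well_connected \<Omega> \<gamma> (2 * (max A3 0 + real CARD('n)) + max A1 0 + 2 * real CARD('n)) H"
    and H: "H \<subseteq> {0<..}" and \<Omega>: "open \<Omega>" and "m \<le> k"
  shows "\<exists>C>0. \<forall>h\<in>H. \<forall>x0 (J :: 'i set) \<phi> \<kappa> S v.
       spline_basis N A1 A2 p k h x0 J \<phi> \<longrightarrow>
       weights (active_mesh h x0 \<Omega>) (active_idx h x0 \<Omega> J \<phi>) \<phi> \<kappa> \<longrightarrow>
       elem_map A3 \<gamma> h x0 \<Omega> S \<longrightarrow> v \<in> active_span h x0 \<Omega> J \<phi> \<longrightarrow>
       L2norm (active_domain h x0 \<Omega>) (grad_norm m (Eh p \<gamma> h x0 \<Omega> J \<phi> \<kappa> S v))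
         \<le> C * L2norm \<Omega> (grad_norm m v)"
proof -
  obtain C R where C: "C > 0" "R \<ge> 0" and loc:
    "\<And>h x0 (J :: 'i set) \<phi> \<kappa> S v T. h \<in> H \<Longrightarrow> spline_basis N A1 A2 p k h x0 J \<phi> \<Longrightarrow>
       weights (active_mesh h x0 \<Omega>) (active_idx h x0 \<Omega> J \<phi>) \<phi> \<kappa> \<Longrightarrow> elem_map A3 \<gamma> h x0 \<Omega> S \<Longrightarrow>
       v \<in> active_span h x0 \<Omega> J \<phi> \<Longrightarrow> T \<in> active_mesh h x0 \<Omega> \<Longrightarrow>
       \<exists>y. (\<forall>x\<in>T. dist x y \<le> R * h) \<and> (\<forall>x\<in>interior T. (grad_norm m (Eh p \<gamma> h x0 \<Omega> J \<phi> \<kappa> S v) x)\<^sup>2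
          \<le> C / h ^ CARD('n) * (LINT z:\<Omega> \<inter> ball y (R * h)|lborel. (grad_norm m v z)\<^sup>2))"
    using local_estimate[OF wc H \<Omega> \<open>m \<le> k\<close>, where ?'i = 'i and N = N and ?A2.0 = A2 and p = p] by blast
  define M where "M = real ((2 * nat \<lceil>2 * R\<rceil> + 3) ^ CARD('n))"
  have M: "M > 0" unfolding M_def by simp
  show ?thesis
  proof (intro exI[of _ "sqrt (C * M)"] conjI ballI allI impI)
    show "sqrt (C * M) > 0" using C M by simp
  next
    fix h x0 \<kappa> S v and J :: "'i set" and \<phi>
    assume hH: "h \<in> H" and basis: "spline_basis N A1 A2 p k h x0 J \<phi>"
      and wts: "weights (active_mesh h x0 \<Omega>) (active_idx h x0 \<Omega> J \<phi>) \<phi> \<kappa>"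
      and S: "elem_map A3 \<gamma> h x0 \<Omega> S" and v: "v \<in> active_span h x0 \<Omega> J \<phi>"
    have h: "h > 0" using hH H by auto
    let ?\<T> = "active_mesh h x0 \<Omega>"
    define E where "E x = (grad_norm m (Eh p \<gamma> h x0 \<Omega> J \<phi> \<kappa> S v) x)\<^sup>2" for x
    define g where "g x = (grad_norm m v x)\<^sup>2" for x
    have g: "g x \<ge> 0" for x by (simp add: g_def)
    have act: "T \<in> mesh h x0" if "T \<in> ?\<T>" for T using that by (auto simp: active_mesh_def)
    note vspl = active_span_spline[OF basis v]
    obtain \<rho> where \<rho>: "\<forall>x. norm x > \<rho> \<longrightarrow> v x = 0" using vspl(3) by blast
    have gint: "set_integrable lborel \<Omega> g"
      unfolding g_def by (rule grad_norm_integrable[OF vspl(1) \<open>m \<le> k\<close> \<rho> \<Omega>])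
    obtain y where y: "\<And>T x. T \<in> ?\<T> \<Longrightarrow> x \<in> T \<Longrightarrow> dist x (y T) \<le> R * h"
      and Eb: "\<And>T x. T \<in> ?\<T> \<Longrightarrow> x \<in> interior T \<Longrightarrow>
         E x \<le> C / h ^ CARD('n) * (LINT z:\<Omega> \<inter> ball (y T) (R * h)|lborel. g z)"
      using loc[OF hH basis wts S v] unfolding E_def g_def by metis
    define G where "G T = (LINT z:\<Omega> \<inter> ball (y T) (R * h)|lborel. g z)" for T
    have G0: "G T \<ge> 0" for T
      unfolding G_def set_lebesgue_integral_def using g by (intro integral_nonneg_AE) (simp add: indicator_def)
    \<comment> \<open>There may be infinitely many active elements, but \<open>v\<close> has bounded
      support, so only finitely many contribute.\<close>
    define F where "F = {T \<in> ?\<T>. G T \<noteq> 0}"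
    have F: "finite F" "F \<subseteq> mesh h x0"
    proof -
      show "F \<subseteq> mesh h x0" using act by (auto simp: F_def)
      \<comment> \<open>An element farther out has its whole ball outside the support of
        \<open>v\<close>; the radius is written as a multiple of \<open>h\<close> to fit
        \<open>mesh_near\<close>.\<close>
      define \<sigma> where "\<sigma> = (\<rho> + 2 * R * h) / h"
      have "T \<inter> cball 0 (\<sigma> * h) \<noteq> {}" if T: "T \<in> F" for T
      proof (rule ccontr)
        assume far: "\<not> T \<inter> cball 0 (\<sigma> * h) \<noteq> {}"
        have Ta: "T \<in> ?\<T>" using T by (simp add: F_def)
        then obtain w where w: "w \<in> T" by (auto simp: active_mesh_def)
        have "norm w > \<sigma> * h" using far w by auto
        then have nw: "norm w > \<rho> + 2 * R * h" using h by (simp add: \<sigma>_def)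
        have "g z = 0" if z: "z \<in> ball (y T) (R * h)" for z
        proof -
          have "dist w z \<le> 2 * R * h" using y[OF Ta w] z dist_triangle[of w z "y T"] by simp
          then have "norm z > \<rho>" using nw norm_triangle_ineq[of "w - z" z] by (simp add: dist_norm)
          then show ?thesis unfolding g_def by (rule grad_norm_bounded_support[OF \<rho>])
        qed
        then have "(\<lambda>z. indicat_real (\<Omega> \<inter> ball (y T) (R * h)) z *\<^sub>R g z) = (\<lambda>z. 0)"
          by (auto simp: indicator_def fun_eq_iff)
        then have "G T = 0" unfolding G_def set_lebesgue_integral_def by simp
        then show False using T by (simp add: F_def)
      qed
      then have "F \<subseteq> {T \<in> mesh h x0. T \<inter> cball 0 (\<sigma> * h) \<noteq> {}}" using act by (auto simp: F_def)
      then show "finite F" by (rule finite_subset) (rule mesh_near(1)[OF h])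
    qed
    have main: "(LINT x:active_domain h x0 \<Omega>|lborel. E x) \<le> (C * M) * (LINT x:\<Omega>|lborel. g x)"
    proof (cases "set_integrable lborel (active_domain h x0 \<Omega>) E")
      case False \<comment> \<open>the Bochner integral is then \<open>0\<close>\<close>
      then have "(LINT x:active_domain h x0 \<Omega>|lborel. E x) = 0"
        unfolding set_lebesgue_integral_def set_integrable_def by (rule not_integrable_integral_eq)
      moreover have "(LINT x:\<Omega>|lborel. g x) \<ge> 0"
        unfolding set_lebesgue_integral_def using g by (intro integral_nonneg_AE) (simp add: indicator_def)
      ultimately show ?thesis using C M by simp
    next
      case True
      have cell: "T \<in> sets lborel" "emeasure lborel T < \<infinity>" "measure lborel T = h ^ CARD('n)" if TF: "T \<in> F" for T
      proof -
        obtain j where j: "T = cube (\<chi> i. x0 $ i + h * of_int (j i)) h"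
          by (rule meshE[OF subsetD[OF F(2) TF]])
        show "T \<in> sets lborel" "measure lborel T = h ^ CARD('n)"
          unfolding j using h by (simp_all add: measure_cube)
        show "emeasure lborel T < \<infinity>" unfolding j cube_def by (simp add: emeasure_lborel_cbox_eq)
      qed
      have "(LINT x:active_domain h x0 \<Omega>|lborel. E x) \<le> (LINT x|lborel. (\<Sum>T\<in>F. indicat_real T x * (C / h ^ CARD('n) * G T)))"
        unfolding set_lebesgue_integral_def
      proof (rule integral_mono_AE)
        show "integrable lborel (\<lambda>x. indicat_real (active_domain h x0 \<Omega>) x *\<^sub>R E x)"
          using True by (simp add: set_integrable_def)
        show "integrable lborel (\<lambda>x. \<Sum>T\<in>F. indicat_real T x * (C / h ^ CARD('n) * G T))"
          using cell by (intro Bochner_Integration.integrable_sum integrable_mult_left integrable_real_indicator) auto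
        \<comment> \<open>The bound \<open>Eb\<close> holds in the interiors of the elements; the
          faces form a null set.\<close>
        show "AE x in lborel. indicat_real (active_domain h x0 \<Omega>) x *\<^sub>R E x
            \<le> (\<Sum>T\<in>F. indicat_real T x * (C / h ^ CARD('n) * G T))"
          using AE_mesh_interior[of h x0]
        proof eventually_elim
          case (elim x)
          have nn: "(\<Sum>T\<in>F. indicat_real T x * (C / h ^ CARD('n) * G T)) \<ge> 0"
            using C G0 h by (intro sum_nonneg mult_nonneg_nonneg) auto
          show ?case
          proof (cases "x \<in> active_domain h x0 \<Omega>")
            case False
            then show ?thesis using nn by simp
          next
            case True
            then obtain T where T: "T \<in> ?\<T>" "x \<in> T" by (auto simp: active_domain_def)
            have "E x \<le> C / h ^ CARD('n) * G T"
              unfolding G_def using T elim act by (intro Eb) auto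
            also have "\<dots> \<le> (\<Sum>T\<in>F. indicat_real T x * (C / h ^ CARD('n) * G T))"
            proof (cases "T \<in> F")
              case True
              have "indicat_real T x * (C / h ^ CARD('n) * G T) \<le> (\<Sum>T\<in>F. indicat_real T x * (C / h ^ CARD('n) * G T))"
                using True F(1) C G0 h by (intro member_le_sum) auto
              then show ?thesis using T(2) by simp
            next
              case False
              \<comment> \<open>Here \<open>G T = 0\<close>, so the bound for \<open>E x\<close> is
                0.\<close>
              then show ?thesis using nn T by (simp add: F_def)
            qed
            finally show ?thesis using True by simp
          qed
        qed
      qed
      also have "\<dots> = (\<Sum>T\<in>F. h ^ CARD('n) * (C / h ^ CARD('n) * G T))"
      proof (subst Bochner_Integration.integral_sum)
        show "integrable lborel (\<lambda>x. indicat_real T x * (C / h ^ CARD('n) * G T))" if "T \<in> F" for T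
          using cell[OF that] by (intro integrable_mult_left integrable_real_indicator) auto
      qed (use cell in \<open>auto intro!: sum.cong\<close>)
      also have "\<dots> = C * (\<Sum>T\<in>F. G T)" using h by (simp add: sum_distrib_left)
      also have "\<dots> \<le> C * (M * (LINT x:\<Omega>|lborel. g x))"
        unfolding G_def M_def using C F y
        by (intro mult_left_mono finite_overlap_integral[OF h F \<Omega> gint g]) (auto simp: F_def)
      finally show ?thesis by simp
    qed
    then show "L2norm (active_domain h x0 \<Omega>) (grad_norm m (Eh p \<gamma> h x0 \<Omega> J \<phi> \<kappa> S v))
         \<le> sqrt (C * M) * L2norm \<Omega> (grad_norm m v)"
      unfolding L2norm_def E_def g_def by (simp flip: real_sqrt_mult)
  qed
qed

text \<open>\<open>C\<close> is chosen before the mesh, the basis, the weights and the element map,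
  which expresses its independence of \<open>h\<close> and of the cut. An unbounded domain can come
  close to itself with arbitrarily long connecting paths, so there \<open>h0\<close> is limited to
  the scale \<open>h1\<close> of the charts. \<open>\<gamma> > 0\<close> guarantees each large
  element the volume from which its deep ball is obtained.\<close>

theorem lemma4p3:
  fixes \<Omega> :: "(real^'n) set"
    and p k N :: nat
    and \<gamma> A1 A2 A3 :: real
  assumes "open \<Omega>" and "connected \<Omega>" and "lipschitz_boundary \<Omega>"
    and "k < p" and "\<gamma> > 0"
  shows "\<exists>h1>0. \<forall>h0>0. bounded \<Omega> \<or> h0 \<le> h1 \<longrightarrow>
    (\<exists>C>0. \<forall>h x0 (J :: 'i set) \<phi> \<kappa> S v m.
       0 < h \<longrightarrow> h \<le> h0 \<longrightarrow>
       spline_basis N A1 A2 p k h x0 J \<phi> \<longrightarrow>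
       weights (active_mesh h x0 \<Omega>) (active_idx h x0 \<Omega> J \<phi>) \<phi> \<kappa> \<longrightarrow>
       elem_map A3 \<gamma> h x0 \<Omega> S \<longrightarrow>
       v \<in> active_span h x0 \<Omega> J \<phi> \<longrightarrow>
       m \<le> k \<longrightarrow>
       L2norm (active_domain h x0 \<Omega>) (grad_norm m (Eh p \<gamma> h x0 \<Omega> J \<phi> \<kappa> S v))
         \<le> C * L2norm \<Omega> (grad_norm m v))"
proof -
  define A where "A = 2 * (max A3 0 + real CARD('n)) + max A1 0 + 2 * real CARD('n)"
  have "A \<ge> 0" by (simp add: A_def)
  then obtain h1 where h1: "h1 > 0" and wc1: "well_connected \<Omega> \<gamma> A {0<..h1}"
    using well_connected_small[OF assms(1,3,5)] by blast
  define est where "est C h m \<longleftrightarrow> (\<forall>x0 (J :: 'i set) \<phi> \<kappa> S v.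
       spline_basis N A1 A2 p k h x0 J \<phi> \<longrightarrow>
       weights (active_mesh h x0 \<Omega>) (active_idx h x0 \<Omega> J \<phi>) \<phi> \<kappa> \<longrightarrow>
       elem_map A3 \<gamma> h x0 \<Omega> S \<longrightarrow> v \<in> active_span h x0 \<Omega> J \<phi> \<longrightarrow>
       L2norm (active_domain h x0 \<Omega>) (grad_norm m (Eh p \<gamma> h x0 \<Omega> J \<phi> \<kappa> S v))
         \<le> C * L2norm \<Omega> (grad_norm m v))" for C h m
  have L2pos: "L2norm \<Omega> f \<ge> 0" for f :: "real^'n \<Rightarrow> real"
    unfolding L2norm_def set_lebesgue_integral_def by (intro real_sqrt_ge_zero integral_nonneg_AE) simp
  have est_mono: "est C' h m" if "est C h m" "C \<le> C'" for C C' h m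
    using that(1) mult_right_mono[OF that(2) L2pos] unfolding est_def by (meson order_trans)
  have uniform: "\<exists>C>0. \<forall>h\<in>H. \<forall>m\<le>k. est C h m" if "well_connected \<Omega> \<gamma> A H" "H \<subseteq> {0<..}" for H
  proof -
    have "\<forall>m. \<exists>C. m \<le> k \<longrightarrow> C > 0 \<and> (\<forall>h\<in>H. est C h m)"
      using global_estimate[OF that(1)[unfolded A_def] that(2) assms(1)] unfolding est_def by meson
    then obtain C where C: "\<And>m. m \<le> k \<Longrightarrow> C m > 0" "\<And>m h. m \<le> k \<Longrightarrow> h \<in> H \<Longrightarrow> est (C m) h m" by metis
    \<comment> \<open>The sum over \<open>m\<close> serves as one constant for all orders up to
      \<open>k\<close>.\<close>
    have le: "C m \<le> (\<Sum>m\<le>k. C m)" if "m \<le> k" for m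
      using that C(1) by (intro member_le_sum) (auto intro: less_imp_le)
    have "(\<Sum>m\<le>k. C m) > 0" using C(1) by (intro sum_pos) auto
    then show ?thesis using est_mono[OF C(2) le] by blast
  qed
  have "\<exists>C>0. \<forall>h m. 0 < h \<longrightarrow> h \<le> h0 \<longrightarrow> m \<le> k \<longrightarrow> est C h m"
    if h0: "bounded \<Omega> \<or> h0 \<le> h1" for h0
  proof -
    obtain C1 where C1: "C1 > 0" "\<And>h m. h \<in> {0<..h1} \<Longrightarrow> m \<le> k \<Longrightarrow> est C1 h m"
    proof -
      have "{0<..h1} \<subseteq> {0<..}" by auto
      from uniform[OF wc1 this] show ?thesis using that by blast
    qed
    show ?thesis
    proof (cases "h0 \<le> h1")
      case True
      then show ?thesis using C1 by (intro exI[of _ C1]) auto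
    next
      case False
      then have "bounded \<Omega>" using h0 by simp
      then have "well_connected \<Omega> \<gamma> A {h1<..h0}" using assms h1 by (intro well_connected_bounded)
      moreover have "{h1<..h0} \<subseteq> {0<..}" using h1 by auto
      ultimately obtain C2 where C2: "C2 > 0" "\<And>h m. h \<in> {h1<..h0} \<Longrightarrow> m \<le> k \<Longrightarrow> est C2 h m"
        using uniform by blast
      have "est (max C1 C2) h m" if "0 < h" "h \<le> h0" "m \<le> k" for h m
      proof (cases "h \<le> h1")
        case True
        then show ?thesis using that by (intro est_mono[OF C1(2)]) auto
      next
        case False
        then show ?thesis using that by (intro est_mono[OF C2(2)]) auto
      qed
      then show ?thesis using C1(1) by (intro exI[of _ "max C1 C2"]) auto
    qed
  qed
  note key = this
  show ?thesis
  proof (rule exI[of _ h1], intro conjI h1 allI impI)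
    fix h0 :: real assume "bounded \<Omega> \<or> h0 \<le> h1"
    then obtain C where C: "C > 0" "\<And>h m. 0 < h \<Longrightarrow> h \<le> h0 \<Longrightarrow> m \<le> k \<Longrightarrow> est C h m"
      using key by blast
    show "\<exists>C>0. \<forall>h x0 (J :: 'i set) \<phi> \<kappa> S v m.
       0 < h \<longrightarrow> h \<le> h0 \<longrightarrow>
       spline_basis N A1 A2 p k h x0 J \<phi> \<longrightarrow>
       weights (active_mesh h x0 \<Omega>) (active_idx h x0 \<Omega> J \<phi>) \<phi> \<kappa> \<longrightarrow>
       elem_map A3 \<gamma> h x0 \<Omega> S \<longrightarrow>
       v \<in> active_span h x0 \<Omega> J \<phi> \<longrightarrow>
       m \<le> k \<longrightarrow>
       L2norm (active_domain h x0 \<Omega>) (grad_norm m (Eh p \<gamma> h x0 \<Omega> J \<phi> \<kappa> S v))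
         \<le> C * L2norm \<Omega> (grad_norm m v)"
    proof (rule exI[of _ C], intro conjI C(1) allI impI)
      fix h x0 \<kappa> S v m and J :: "'i set" and \<phi>
      assume "0 < h" "h \<le> h0" and a: "spline_basis N A1 A2 p k h x0 J \<phi>"
        "weights (active_mesh h x0 \<Omega>) (active_idx h x0 \<Omega> J \<phi>) \<phi> \<kappa>"
        "elem_map A3 \<gamma> h x0 \<Omega> S" "v \<in> active_span h x0 \<Omega> J \<phi>" and "m \<le> k"
      then have "est C h m" by (intro C(2))
      from this[unfolded est_def, rule_format, OF a]
      show "L2norm (active_domain h x0 \<Omega>) (grad_norm m (Eh p \<gamma> h x0 \<Omega> J \<phi> \<kappa> S v))
         \<le> C * L2norm \<Omega> (grad_norm m v)" .
    qed
  qed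
qed

end
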